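(* Let $\alpha\in(0,1]$, $\lambda>0$, $K\ge 1$ an integer, and ${\bf p}=(p_1,\dots,p_K)$ with all $p_i>0$ and $p_1+\dots+p_K=1$. Let $N^{\alpha,\lambda}$ be a fractional Poisson process of index $\alpha$ and scale $\lambda$, and let each of its events be assigned to one of the classes $1,\dots,K$, independently of each other and of $N^{\alpha,\lambda}$, with probability $p_i$ of being assigned to class $i$. Let $N^{(i)}(t)$ be the number of events in $[0,t]$ assigned to class $i$, and ${\bf N}(t)=(N^{(1)}(t),\dots,N^{(K)}(t))$. Then we have the weak convergence $$\{u^{-\alpha}{\bf N}(ut)\}_{t\ge 0}\stackrel{d}{\longrightarrow}\{\lambda^\alpha{\bf p}\,Y_\alpha(t)\}_{t\ge 0},\qquad u\to\infty,$$ in the space $D([0,\infty),\mathbb{R}^K)$ of càdlàg functions equipped with the Skorokhod topology $J_1$, where $Y_\alpha$ is the inverse of a standard $\alpha$-stable subordinator.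
   Context: Mittag-Leffler function: $E_\theta(z)=\sum_{\ell\ge 0} z^\ell/\Gamma(1+\theta\ell)$. Fractional Poisson process: for $\theta\in(0,1]$ and $\lambda>0$, ${\rm FPP}(\theta,\lambda)$ denotes the law of the counting process $N^{\theta,\lambda}(t)=\max\{n\ge 0: X_1+\dots+X_n\le t\}$, $t\ge 0$, where $X_1,X_2,\dots$ are i.i.d. nonnegative random variables with distribution function $F(x)=1-E_\theta(-\lambda^\theta x^\theta)$, $x\ge 0$. For $\theta=1$ this is a Poisson process of rate $\lambda$. Inverse stable subordinator: a standard $\theta$-stable subordinator $L_\theta$, $\theta\in(0,1]$, is a nondecreasing Lévy process with $\mathbb{E}(e^{-tL_\theta(s)})=e^{-st^\theta}$ for $s,t\ge 0$ (so $L_1(s)=s$). Its inverse is $Y_\theta(t)=\inf\{s>0:L_\theta(s)>t\}$, $t\ge 0$ (so $Y_1(t)=t$). *)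

theory Defs
  imports "HOL-Probability.Probability"
begin

section \<open>The space of cadlag functions with the Skorokhod topology J1\<close>

definition cadlag :: "(real \<Rightarrow> 'a::topological_space) \<Rightarrow> bool" where
  "cadlag x \<longleftrightarrow>
     (\<forall>t\<ge>0. (x \<longlongrightarrow> x t) (at_right t) \<and> (t > 0 \<longrightarrow> (\<exists>l. (x \<longlongrightarrow> l) (at_left t))))"

text \<open>Functions on the half-line are represented as extensional functions on \<open>{0..}\<close>, so that
  two elements of the space are equal iff they agree on \<open>{0..}\<close>.\<close>

definition skorokhod_space :: "(real \<Rightarrow> 'a::real_normed_vector) set" where
  "skorokhod_space = {x \<in> extensional {0..}. cadlag x}"

definition time_changes :: "real \<Rightarrow> (real \<Rightarrow> real) set" where
  "time_changes m =
     {\<mu>. continuous_on {0..m} \<mu> \<and> strict_mono_on {0..m} \<mu> \<and> \<mu> ` {0..m} = {0..m}}"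

text \<open>Skorokhod's metric on the cadlag functions on \<open>{0..m}\<close>.\<close>

definition skorokhod_dist_on ::
    "real \<Rightarrow> (real \<Rightarrow> 'a::real_normed_vector) \<Rightarrow> (real \<Rightarrow> 'a) \<Rightarrow> real" where
  "skorokhod_dist_on m x y =
     (INF \<mu>\<in>time_changes m.
        max (SUP t\<in>{0..m}. \<bar>\<mu> t - t\<bar>) (SUP t\<in>{0..m}. norm (x t - y (\<mu> t))))"

text \<open>The cutoff is 1 up to time \<open>m - 1\<close> and decreases linearly to 0 at time \<open>m\<close>. Without it,
  a jump near time \<open>m\<close> would spoil the comparison on \<open>{0..m}\<close>; see Billingsley,
  \<^emph>\<open>Convergence of Probability Measures\<close>, 2nd ed., Section 16, for this construction of the
  topology on the half-line.\<close>

definition cutoff :: "real \<Rightarrow> (real \<Rightarrow> 'a::real_normed_vector) \<Rightarrow> real \<Rightarrow> 'a" where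
  "cutoff m x t = max 0 (min 1 (m - t)) *\<^sub>R x t"

text \<open>Outside the space the value 0 is chosen only to satisfy \<open>Metric_space\<close>, which requires
  nonnegativity and symmetry on the whole type.\<close>

definition skorokhod_dist ::
    "(real \<Rightarrow> 'a::real_normed_vector) \<Rightarrow> (real \<Rightarrow> 'a) \<Rightarrow> real" where
  "skorokhod_dist x y =
     (if x \<in> skorokhod_space \<and> y \<in> skorokhod_space
      then \<Sum>m. (1/2) ^ Suc m * min 1 (skorokhod_dist_on (real (Suc m))
                                        (cutoff (real (Suc m)) x) (cutoff (real (Suc m)) y))
      else 0)"

lemma cadlag_bounded:
  fixes x :: "real \<Rightarrow> 'a::real_normed_vector"
  assumes "cadlag x"
  shows "\<exists>B. \<forall>t\<in>{0..m}. norm (x t) \<le> B"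
proof -
  have loc: "\<exists>U. open U \<and> t \<in> U \<and> (\<exists>B. \<forall>s\<in>U. 0 \<le> s \<longrightarrow> norm (x s) \<le> B)" if t: "t \<in> {0..m}" for t
  proof -
    have "(x \<longlongrightarrow> x t) (at_right t)"
      using assms t by (auto simp: cadlag_def)
    then have "\<forall>\<^sub>F s in at_right t. norm (x s) < norm (x t) + 1"
      by (intro order_tendstoD(2)[OF tendsto_norm]) auto
    moreover have "\<exists>B. \<forall>\<^sub>F s in at_left t. 0 \<le> s \<longrightarrow> norm (x s) < B"
    proof (cases "t = 0")
      case True
      then have "\<forall>\<^sub>F s in at_left t. 0 \<le> s \<longrightarrow> norm (x s) < 0"
        by (auto simp: eventually_at_filter)
      then show ?thesis by blast
    next
      case False
      then obtain l where "(x \<longlongrightarrow> l) (at_left t)"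
        using assms t by (auto simp: cadlag_def)
      then have "\<forall>\<^sub>F s in at_left t. norm (x s) < norm l + 1"
        by (intro order_tendstoD(2)[OF tendsto_norm]) auto
      then have "\<forall>\<^sub>F s in at_left t. 0 \<le> s \<longrightarrow> norm (x s) < norm l + 1"
        by eventually_elim auto
      then show ?thesis by blast
    qed
    then obtain B where "\<forall>\<^sub>F s in at_left t. 0 \<le> s \<longrightarrow> norm (x s) < B" by blast
    ultimately have "\<forall>\<^sub>F s in at t. 0 \<le> s \<longrightarrow> norm (x s) \<le> max B (norm (x t) + 1)"
      unfolding eventually_at_split by (auto elim!: eventually_mono)
    then obtain U where "open U" "t \<in> U"
      and U: "\<And>s. s \<in> U \<Longrightarrow> s \<noteq> t \<Longrightarrow> 0 \<le> s \<Longrightarrow> norm (x s) \<le> max B (norm (x t) + 1)"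
      unfolding eventually_at_topological by blast
    moreover have "norm (x s) \<le> max B (norm (x t) + 1)" if "s \<in> U" "0 \<le> s" for s
      using U[of s] that by (cases "s = t") auto
    ultimately show ?thesis by blast
  qed
  then obtain U where U: "\<And>t. t \<in> {0..m} \<Longrightarrow> open (U t) \<and> t \<in> U t"
    and "\<And>t. t \<in> {0..m} \<Longrightarrow> \<exists>B. \<forall>s\<in>U t. 0 \<le> s \<longrightarrow> norm (x s) \<le> B"
    by metis
  then obtain B where B: "\<And>t s. t \<in> {0..m} \<Longrightarrow> s \<in> U t \<Longrightarrow> 0 \<le> s \<Longrightarrow> norm (x s) \<le> B t"
    by metis
  obtain F where F: "F \<subseteq> {0..m}" "finite F" "{0..m} \<subseteq> (\<Union>t\<in>F. U t)"
    by (rule compactE_image[of "{0..m}" "{0..m}" U]) (use U in auto)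
  have "norm (x s) \<le> Max (B ` F)" if s: "s \<in> {0..m}" for s
  proof -
    obtain t where t: "t \<in> F" "s \<in> U t" using F s by blast
    then have "norm (x s) \<le> B t" using B[of t s] F s by auto
    also have "\<dots> \<le> Max (B ` F)" using F t by auto
    finally show ?thesis .
  qed
  then show ?thesis by blast
qed

lemma cutoff_bounded:
  assumes "cadlag x"
  shows "\<exists>B. \<forall>t\<in>{0..m}. norm (cutoff k x t) \<le> B"
proof -
  obtain B where B: "\<And>t. t \<in> {0..m} \<Longrightarrow> norm (x t) \<le> B"
    using cadlag_bounded[OF assms] by blast
  have "norm (cutoff k x t) \<le> B" if "t \<in> {0..m}" for t
  proof -
    have "norm (cutoff k x t) \<le> 1 * norm (x t)"
      unfolding cutoff_def norm_scaleR by (intro mult_right_mono) auto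
    with B[OF that] show ?thesis by simp
  qed
  then show ?thesis by blast
qed

lemma time_changes_id: "(\<lambda>t. t) \<in> time_changes m"
  by (auto simp: time_changes_def strict_mono_on_def)

lemma time_changes_mem: "\<mu> \<in> time_changes m \<Longrightarrow> t \<in> {0..m} \<Longrightarrow> \<mu> t \<in> {0..m}"
  unfolding time_changes_def by blast

lemma time_changes_compose:
  assumes "\<mu> \<in> time_changes m" "\<nu> \<in> time_changes m"
  shows "(\<lambda>t. \<nu> (\<mu> t)) \<in> time_changes m"
proof -
  have im: "\<mu> ` {0..m} = {0..m}" "\<nu> ` {0..m} = {0..m}"
    using assms by (auto simp: time_changes_def)
  have "continuous_on {0..m} (\<lambda>t. \<nu> (\<mu> t))"
    by (rule continuous_on_compose2[of "{0..m}"]) (use assms im in \<open>auto simp: time_changes_def\<close>)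
  moreover have "strict_mono_on {0..m} (\<lambda>t. \<nu> (\<mu> t))"
  proof (rule strict_mono_onI)
    fix s t assume st: "s \<in> {0..m}" "t \<in> {0..m}" "s < t"
    have "\<mu> s < \<mu> t"
      using assms(1) st strict_mono_onD[of "{0..m}" \<mu> s t] by (simp add: time_changes_def)
    then show "\<nu> (\<mu> s) < \<nu> (\<mu> t)"
      using assms(2) time_changes_mem[OF assms(1) st(1)] time_changes_mem[OF assms(1) st(2)]
        strict_mono_onD[of "{0..m}" \<nu> "\<mu> s" "\<mu> t"] by (simp add: time_changes_def)
  qed
  moreover have "(\<lambda>t. \<nu> (\<mu> t)) ` {0..m} = \<nu> ` \<mu> ` {0..m}"
    by (rule image_image[symmetric])
  then have "(\<lambda>t. \<nu> (\<mu> t)) ` {0..m} = {0..m}"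
    by (simp only: im)
  ultimately show ?thesis by (simp add: time_changes_def)
qed

lemma time_changes_inverse:
  assumes "\<mu> \<in> time_changes m"
  obtains \<nu> where "\<nu> \<in> time_changes m" "\<And>t. t \<in> {0..m} \<Longrightarrow> \<mu> (\<nu> t) = t"
proof -
  let ?\<nu> = "inv_into {0..m} \<mu>"
  have c: "continuous_on {0..m} \<mu>" and mono: "strict_mono_on {0..m} \<mu>" and im: "\<mu> ` {0..m} = {0..m}"
    using assms by (auto simp: time_changes_def)
  have inj: "inj_on \<mu> {0..m}"
    using mono by (rule strict_mono_on_imp_inj_on)
  have r: "\<mu> (?\<nu> t) = t" if "t \<in> {0..m}" for t
    using im that by (simp add: f_inv_into_f)
  have mem: "?\<nu> t \<in> {0..m}" if "t \<in> {0..m}" for t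
    using im that by (metis inv_into_into)
  have "continuous_on (\<mu> ` {0..m}) ?\<nu>"
    by (rule continuous_on_inv[OF c]) (use inj in auto)
  moreover have "strict_mono_on {0..m} ?\<nu>"
  proof (rule strict_mono_onI)
    fix s t assume st: "s \<in> {0..m}" "t \<in> {0..m}" "s < t"
    show "?\<nu> s < ?\<nu> t"
    proof (rule ccontr)
      assume "\<not> ?\<nu> s < ?\<nu> t"
      then have "\<mu> (?\<nu> t) \<le> \<mu> (?\<nu> s)"
        using strict_mono_on_leD[OF mono mem[OF st(2)] mem[OF st(1)]] by simp
      with r st show False by simp
    qed
  qed
  moreover have "?\<nu> ` {0..m} = {0..m}"
    using inv_into_image_cancel[OF inj, of "{0..m}"] im by simp
  ultimately have "?\<nu> \<in> time_changes m" using im by (simp add: time_changes_def)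
  then show ?thesis using r that by blast
qed

lemma time_changes_SUP_nonneg:
  assumes "\<mu> \<in> time_changes m" "0 \<le> m"
  shows "0 \<le> (SUP t\<in>{0..m}. \<bar>\<mu> t - t\<bar>)"
proof -
  have "bdd_above ((\<lambda>t. \<bar>\<mu> t - t\<bar>) ` {0..m})"
  proof (rule bdd_aboveI2)
    fix t assume "t \<in> {0..m}"
    with time_changes_mem[OF assms(1) this] show "\<bar>\<mu> t - t\<bar> \<le> m" by auto
  qed
  then have "\<bar>\<mu> 0 - 0\<bar> \<le> (SUP t\<in>{0..m}. \<bar>\<mu> t - t\<bar>)"
    using assms(2) by (intro cSUP_upper) auto
  then show ?thesis by linarith
qed

lemma skorokhod_dist_on_nonneg: "0 \<le> m \<Longrightarrow> 0 \<le> skorokhod_dist_on m x y"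
  unfolding skorokhod_dist_on_def using time_changes_id[of m]
  by (intro cINF_greatest) (auto simp: le_max_iff_disj time_changes_SUP_nonneg)

lemma skorokhod_dist_on_le:
  assumes "0 \<le> m" "\<mu> \<in> time_changes m"
    and "\<And>t. t \<in> {0..m} \<Longrightarrow> \<bar>\<mu> t - t\<bar> \<le> e" "\<And>t. t \<in> {0..m} \<Longrightarrow> norm (x t - y (\<mu> t)) \<le> e"
  shows "skorokhod_dist_on m x y \<le> e"
  unfolding skorokhod_dist_on_def
proof (rule cINF_lower2[OF _ assms(2)])
  show "bdd_below ((\<lambda>\<mu>. max (SUP t\<in>{0..m}. \<bar>\<mu> t - t\<bar>) (SUP t\<in>{0..m}. norm (x t - y (\<mu> t)))) `
      time_changes m)"
    using assms(1) by (intro bdd_belowI2[of _ 0]) (auto simp: le_max_iff_disj time_changes_SUP_nonneg)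
  show "max (SUP t\<in>{0..m}. \<bar>\<mu> t - t\<bar>) (SUP t\<in>{0..m}. norm (x t - y (\<mu> t))) \<le> e"
    using assms by (auto intro!: cSUP_least)
qed

lemma skorokhod_dist_on_lessE:
  assumes d: "skorokhod_dist_on m x y < e"
    and bx: "\<exists>B. \<forall>t\<in>{0..m}. norm (x t) \<le> B" and bounded_y: "\<exists>B. \<forall>t\<in>{0..m}. norm (y t) \<le> B"
  obtains \<mu> where "\<mu> \<in> time_changes m"
    "\<And>t. t \<in> {0..m} \<Longrightarrow> \<bar>\<mu> t - t\<bar> < e" "\<And>t. t \<in> {0..m} \<Longrightarrow> norm (x t - y (\<mu> t)) < e"
proof -
  have "(INF \<mu>\<in>time_changes m.
      max (SUP t\<in>{0..m}. \<bar>\<mu> t - t\<bar>) (SUP t\<in>{0..m}. norm (x t - y (\<mu> t)))) < e"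
    using d by (simp add: skorokhod_dist_on_def)
  then have "\<exists>\<mu>\<in>time_changes m.
      max (SUP t\<in>{0..m}. \<bar>\<mu> t - t\<bar>) (SUP t\<in>{0..m}. norm (x t - y (\<mu> t))) < e"
    by (rule contrapos_pp) (use time_changes_id[of m] in \<open>auto simp: not_less intro!: cINF_greatest\<close>)
  then obtain \<mu> where \<mu>: "\<mu> \<in> time_changes m"
    and lt: "(SUP t\<in>{0..m}. \<bar>\<mu> t - t\<bar>) < e" "(SUP t\<in>{0..m}. norm (x t - y (\<mu> t))) < e"
    by auto
  obtain Bx By where B: "\<And>t. t \<in> {0..m} \<Longrightarrow> norm (x t) \<le> Bx" "\<And>t. t \<in> {0..m} \<Longrightarrow> norm (y t) \<le> By"
    using bx bounded_y by blast
  have bd1: "bdd_above ((\<lambda>t. \<bar>\<mu> t - t\<bar>) ` {0..m})"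
  proof (rule bdd_aboveI2)
    fix t assume "t \<in> {0..m}"
    with time_changes_mem[OF \<mu> this] show "\<bar>\<mu> t - t\<bar> \<le> m" by auto
  qed
  have bd2: "bdd_above ((\<lambda>t. norm (x t - y (\<mu> t))) ` {0..m})"
  proof (rule bdd_aboveI2)
    fix t assume t: "t \<in> {0..m}"
    show "norm (x t - y (\<mu> t)) \<le> Bx + By"
      using norm_triangle_ineq4[of "x t" "y (\<mu> t)"] B(1)[OF t] B(2)[OF time_changes_mem[OF \<mu> t]]
      by linarith
  qed
  show ?thesis
    by (rule that[OF \<mu> le_less_trans[OF cSUP_upper[OF _ bd1] lt(1)]
          le_less_trans[OF cSUP_upper[OF _ bd2] lt(2)]])
qed

lemma skorokhod_dist_on_commute_le:
  assumes "0 \<le> m"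
    and "\<exists>B. \<forall>t\<in>{0..m}. norm (x t) \<le> B" "\<exists>B. \<forall>t\<in>{0..m}. norm (y t) \<le> B"
  shows "skorokhod_dist_on m y x \<le> skorokhod_dist_on m x y"
proof (rule dense_ge)
  fix e assume "skorokhod_dist_on m x y < e"
  from skorokhod_dist_on_lessE[OF this assms(2,3)] obtain \<mu> where \<mu>: "\<mu> \<in> time_changes m"
    "\<And>t. t \<in> {0..m} \<Longrightarrow> \<bar>\<mu> t - t\<bar> < e" "\<And>t. t \<in> {0..m} \<Longrightarrow> norm (x t - y (\<mu> t)) < e" by blast
  obtain \<nu> where \<nu>: "\<nu> \<in> time_changes m" "\<And>t. t \<in> {0..m} \<Longrightarrow> \<mu> (\<nu> t) = t"
    using time_changes_inverse[OF \<mu>(1)] by blast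
  show "skorokhod_dist_on m y x \<le> e"
  proof (rule skorokhod_dist_on_le[OF assms(1) \<nu>(1)])
    fix t assume t: "t \<in> {0..m}"
    show "\<bar>\<nu> t - t\<bar> \<le> e"
      using \<mu>(2)[OF time_changes_mem[OF \<nu>(1) t]] \<nu>(2)[OF t] by simp
    show "norm (y t - x (\<nu> t)) \<le> e"
      using \<mu>(3)[OF time_changes_mem[OF \<nu>(1) t]] \<nu>(2)[OF t] by (simp add: norm_minus_commute)
  qed
qed

lemma skorokhod_dist_on_triangle:
  assumes "0 \<le> m" and bx: "\<exists>B. \<forall>t\<in>{0..m}. norm (x t) \<le> B"
    and bounded_y: "\<exists>B. \<forall>t\<in>{0..m}. norm (y t) \<le> B" and bz: "\<exists>B. \<forall>t\<in>{0..m}. norm (z t) \<le> B"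
  shows "skorokhod_dist_on m x z \<le> skorokhod_dist_on m x y + skorokhod_dist_on m y z"
proof (rule field_le_epsilon)
  fix e :: real assume e: "0 < e"
  let ?a = "skorokhod_dist_on m x y + e/2" and ?b = "skorokhod_dist_on m y z + e/2"
  obtain \<mu> where \<mu>: "\<mu> \<in> time_changes m"
    "\<And>t. t \<in> {0..m} \<Longrightarrow> \<bar>\<mu> t - t\<bar> < ?a" "\<And>t. t \<in> {0..m} \<Longrightarrow> norm (x t - y (\<mu> t)) < ?a"
    using skorokhod_dist_on_lessE[OF _ bx bounded_y, of ?a] e by auto
  obtain \<nu> where \<nu>: "\<nu> \<in> time_changes m"
    "\<And>t. t \<in> {0..m} \<Longrightarrow> \<bar>\<nu> t - t\<bar> < ?b" "\<And>t. t \<in> {0..m} \<Longrightarrow> norm (y t - z (\<nu> t)) < ?b"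
    using skorokhod_dist_on_lessE[OF _ bounded_y bz, of ?b] e by auto
  have "skorokhod_dist_on m x z \<le> ?a + ?b"
  proof (rule skorokhod_dist_on_le[OF assms(1) time_changes_compose[OF \<mu>(1) \<nu>(1)]])
    fix t assume t: "t \<in> {0..m}"
    note t' = time_changes_mem[OF \<mu>(1) t]
    show "\<bar>\<nu> (\<mu> t) - t\<bar> \<le> ?a + ?b"
      using \<mu>(2)[OF t] \<nu>(2)[OF t'] by linarith
    show "norm (x t - z (\<nu> (\<mu> t))) \<le> ?a + ?b"
      using norm_triangle_ineq[of "x t - y (\<mu> t)" "y (\<mu> t) - z (\<nu> (\<mu> t))"]
        \<mu>(3)[OF t] \<nu>(3)[OF t'] by simp
  qed
  then show "skorokhod_dist_on m x z \<le> skorokhod_dist_on m x y + skorokhod_dist_on m y z + e" by simp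
qed

lemma skorokhod_dist_on_refl: "0 \<le> m \<Longrightarrow> skorokhod_dist_on m x x = 0"
  using skorokhod_dist_on_nonneg[of m x x] skorokhod_dist_on_le[OF _ time_changes_id, of m 0 x x]
  by auto

lemma skorokhod_dist_on_zeroD:
  assumes d: "skorokhod_dist_on m x y \<le> 0"
    and bx: "\<exists>B. \<forall>t\<in>{0..m}. norm (x t) \<le> B" and bounded_y: "\<exists>B. \<forall>t\<in>{0..m}. norm (y t) \<le> B"
    and t: "0 \<le> t" "t < m"
    and lim: "(x \<longlongrightarrow> x t) (at_right t)" "(y \<longlongrightarrow> y t) (at_right t)"
  shows "x t = y t"
proof (rule ccontr)
  assume "x t \<noteq> y t"
  define e where "e = norm (x t - y t) / 3"
  have e: "e > 0" using \<open>x t \<noteq> y t\<close> by (simp add: e_def)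
  have "\<forall>\<^sub>F s in at_right t. dist (x s) (x t) < e \<and> dist (y s) (y t) < e"
    using tendstoD[OF lim(1) e] tendstoD[OF lim(2) e] by eventually_elim auto
  then obtain b where b: "b > t"
    "\<And>s. t < s \<Longrightarrow> s < b \<Longrightarrow> dist (x s) (x t) < e \<and> dist (y s) (y t) < e"
    unfolding eventually_at_right_field by blast
  define c where "c = min b m"
  have c: "t < c" "c \<le> b" "c \<le> m" using b t by (auto simp: c_def)
  define s where "s = (t + c) / 2"
  have "0 < min e ((c - t) / 2)" using e c by simp
  with d have "skorokhod_dist_on m x y < min e ((c - t) / 2)" by linarith
  from skorokhod_dist_on_lessE[OF this bx bounded_y] obtain \<mu> where \<mu>: "\<mu> \<in> time_changes m"
    "\<And>t'. t' \<in> {0..m} \<Longrightarrow> \<bar>\<mu> t' - t'\<bar> < min e ((c - t) / 2)"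
    "\<And>t'. t' \<in> {0..m} \<Longrightarrow> norm (x t' - y (\<mu> t')) < min e ((c - t) / 2)" by blast
  have s: "s \<in> {0..m}" "t < s" "s < b" using t c by (auto simp: s_def)
  have "t < \<mu> s" "\<mu> s < b"
    using \<mu>(2)[OF s(1)] c by (auto simp: s_def abs_less_iff field_simps)
  then have "dist (y (\<mu> s)) (y t) < e" using b by blast
  moreover have "dist (x s) (x t) < e" using b s by blast
  moreover have "dist (x s) (y (\<mu> s)) < e" using \<mu>(3)[OF s(1)] by (simp add: dist_norm)
  moreover have "dist (x t) (y t) \<le> dist (x s) (x t) + dist (x s) (y (\<mu> s)) + dist (y (\<mu> s)) (y t)"
    using dist_triangle[of "x t" "y t" "x s"] dist_triangle[of "x s" "y t" "y (\<mu> s)"]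
    by (simp add: dist_commute)
  ultimately show False by (simp add: e_def dist_norm)
qed

lemma cutoff_right_cont:
  assumes "cadlag x" "0 \<le> t"
  shows "(cutoff m x \<longlongrightarrow> cutoff m x t) (at_right t)"
proof -
  have "(x \<longlongrightarrow> x t) (at_right t)" using assms by (auto simp: cadlag_def)
  then have "((\<lambda>t. max 0 (min 1 (m - t)) *\<^sub>R x t) \<longlongrightarrow> max 0 (min 1 (m - t)) *\<^sub>R x t) (at_right t)"
    by (intro tendsto_intros)
  then show ?thesis by (simp add: cutoff_def[abs_def])
qed

lemma Metric_space_skorokhod:
  "Metric_space (skorokhod_space :: (real \<Rightarrow> 'a::real_normed_vector) set) skorokhod_dist"
proof -
  define D where "D m x y = min 1 (skorokhod_dist_on (real (Suc m))
      (cutoff (real (Suc m)) x) (cutoff (real (Suc m)) y))" for m and x y :: "real \<Rightarrow> 'a"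
  have dist: "skorokhod_dist x y = (\<Sum>m. (1/2) ^ Suc m * D m x y)"
    if "x \<in> skorokhod_space" "y \<in> skorokhod_space" for x y :: "real \<Rightarrow> 'a"
    using that by (simp add: skorokhod_dist_def D_def)
  have D: "0 \<le> D m x y" "D m x y \<le> 1" for m and x y :: "real \<Rightarrow> 'a"
    by (auto simp: D_def skorokhod_dist_on_nonneg)
  have sm: "summable (\<lambda>m. (1/2) ^ Suc m * D m x y)" for x y :: "real \<Rightarrow> 'a"
  proof (rule summable_comparison_test')
    show "summable (\<lambda>m. (1/2::real) ^ Suc m)"
      by (intro summable_Suc_iff[THEN iffD2] summable_geometric) simp
    show "norm ((1/2) ^ Suc m * D m x y) \<le> (1/2) ^ Suc m" for m
      using D[of m x y] by (simp add: abs_mult)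
  qed
  have bd: "\<exists>B. \<forall>t\<in>{0..m}. norm (cutoff m x t) \<le> B" if "x \<in> skorokhod_space"
    for m and x :: "real \<Rightarrow> 'a"
    using that cutoff_bounded by (auto simp: skorokhod_space_def)
  have D_commute: "D m x y = D m y x" if "x \<in> skorokhod_space" "y \<in> skorokhod_space"
    for m and x y :: "real \<Rightarrow> 'a"
    unfolding D_def using that
    by (intro arg_cong[of _ _ "min 1"] antisym skorokhod_dist_on_commute_le bd) auto
  have D_triangle: "D m x z \<le> D m x y + D m y z"
    if "x \<in> skorokhod_space" "y \<in> skorokhod_space" "z \<in> skorokhod_space"
    for m and x y z :: "real \<Rightarrow> 'a"
  proof -
    have min: "min 1 a \<le> min 1 b + min 1 c" if "a \<le> b + c" "0 \<le> b" "0 \<le> c" for a b c :: real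
      using that by (auto simp: min_def)
    show ?thesis
      unfolding D_def
      by (intro min skorokhod_dist_on_triangle skorokhod_dist_on_nonneg bd that of_nat_0_le_iff)
  qed
  show ?thesis
  proof
    fix x y :: "real \<Rightarrow> 'a"
    show "0 \<le> skorokhod_dist x y"
    proof (cases "x \<in> skorokhod_space \<and> y \<in> skorokhod_space")
      case True
      have "0 \<le> (\<Sum>m. (1/2) ^ Suc m * D m x y)"
        by (rule suminf_nonneg[OF sm]) (simp add: D)
      then show ?thesis using True dist by metis
    next
      case False
      then show ?thesis unfolding skorokhod_dist_def by auto
    qed
    show "skorokhod_dist x y = skorokhod_dist y x"
    proof (cases "x \<in> skorokhod_space \<and> y \<in> skorokhod_space")
      case True
      then show ?thesis using D_commute[of x y] by (simp add: dist)
    next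
      case False
      then show ?thesis unfolding skorokhod_dist_def by auto
    qed
  next
    fix x y :: "real \<Rightarrow> 'a"
    assume xy: "x \<in> skorokhod_space" "y \<in> skorokhod_space"
    show "skorokhod_dist x y = 0 \<longleftrightarrow> x = y"
    proof
      assume "skorokhod_dist x y = 0"
      then have "(1/2) ^ Suc m * D m x y = 0" for m
        using suminf_eq_zero_iff[OF sm, of x y] D dist[OF xy] by simp
      then have D_eq: "D m x y = 0" for m by (simp del: power_Suc)
      have D0: "skorokhod_dist_on (real (Suc m)) (cutoff (real (Suc m)) x) (cutoff (real (Suc m)) y) \<le> 0" for m
        using D_eq[of m] unfolding D_def by linarith
      have "x t = y t" if t: "0 \<le> t" for t
      proof -
        obtain m where m: "t + 1 \<le> real (Suc m)"
          using real_arch_simple[of "t + 1"] by (metis le_SucI of_nat_mono order_refl order_trans)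
        have "cutoff (real (Suc m)) x t = cutoff (real (Suc m)) y t"
          using xy t m
          by (intro skorokhod_dist_on_zeroD[OF D0 bd[OF xy(1)] bd[OF xy(2)]] cutoff_right_cont)
             (auto simp: skorokhod_space_def)
        then show ?thesis using m by (auto simp: cutoff_def)
      qed
      then show "x = y"
        using xy by (intro extensionalityI[of _ "{0..}"]) (auto simp: skorokhod_space_def)
    next
      assume "x = y"
      then show "skorokhod_dist x y = 0"
        using xy by (simp add: dist D_def skorokhod_dist_on_refl)
    qed
  next
    fix x y z :: "real \<Rightarrow> 'a"
    assume *: "x \<in> skorokhod_space" "y \<in> skorokhod_space" "z \<in> skorokhod_space"
    have "(\<Sum>m. (1/2) ^ Suc m * D m x z) \<le> (\<Sum>m. (1/2) ^ Suc m * D m x y + (1/2) ^ Suc m * D m y z)"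
    proof (rule suminf_le[OF _ sm summable_add[OF sm sm]])
      show "(1/2) ^ Suc m * D m x z \<le> (1/2) ^ Suc m * D m x y + (1/2) ^ Suc m * D m y z" for m
        unfolding distrib_left[symmetric] by (intro mult_left_mono D_triangle *) simp
    qed
    also have "\<dots> = (\<Sum>m. (1/2) ^ Suc m * D m x y) + (\<Sum>m. (1/2) ^ Suc m * D m y z)"
      by (rule suminf_add[OF sm sm, symmetric])
    finally show "skorokhod_dist x z \<le> skorokhod_dist x y + skorokhod_dist y z"
      using * by (simp add: dist)
  qed
qed

definition skorokhod_J1 :: "(real \<Rightarrow> 'a::real_normed_vector) topology" where
  "skorokhod_J1 = Metric_space.mtopology skorokhod_space skorokhod_dist"


section \<open>Convergence in distribution in a topological space\<close>

definition borel_of :: "'a topology \<Rightarrow> 'a measure" where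
  "borel_of T = sigma (topspace T) {U. openin T U}"

definition converges_weakly ::
    "'a topology \<Rightarrow> ('i \<Rightarrow> 'a measure) \<Rightarrow> 'a measure \<Rightarrow> 'i filter \<Rightarrow> bool" where
  "converges_weakly T \<mu> \<nu> F \<longleftrightarrow>
     (\<forall>f. continuous_map T euclideanreal f \<and> bounded (f ` topspace T) \<longrightarrow>
        ((\<lambda>i. \<integral>x. f x \<partial>\<mu> i) \<longlongrightarrow> (\<integral>x. f x \<partial>\<nu>)) F)"

text \<open>Processes are only determined up to null sets (their paths may fail to be cadlag on a null
  set), so the law of \<open>X\<close> is that of any measurable map into the space that is almost surely
  equal to \<open>X\<close>.\<close>

definition is_law_of :: "'b measure \<Rightarrow> 'b measure \<Rightarrow> 'a measure \<Rightarrow> ('a \<Rightarrow> 'b) \<Rightarrow> bool" where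
  "is_law_of \<mu> S M X \<longleftrightarrow>
     (\<exists>X'. X' \<in> measurable M S \<and> (AE \<omega> in M. X' \<omega> = X \<omega>) \<and> \<mu> = distr M S X')"

definition converges_in_distribution ::
    "'b topology \<Rightarrow> 'a measure \<Rightarrow> ('i \<Rightarrow> 'a \<Rightarrow> 'b) \<Rightarrow> 'c measure \<Rightarrow> ('c \<Rightarrow> 'b) \<Rightarrow> 'i filter \<Rightarrow> bool"
where
  "converges_in_distribution T M X M' Y F \<longleftrightarrow>
     (\<exists>\<mu> \<nu>. (\<forall>\<^sub>F i in F. is_law_of (\<mu> i) (borel_of T) M (X i)) \<and>
            is_law_of \<nu> (borel_of T) M' Y \<and>
            converges_weakly T \<mu> \<nu> F)"


section \<open>Independence of two random elements\<close>

text \<open>This is \<open>prob_space.indep_var\<close> (see \<open>prob_space.indep_var_eq\<close>), which is only available for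
  two random elements whose values have the same type.\<close>

definition independent_elements ::
    "'a measure \<Rightarrow> 'b measure \<Rightarrow> ('a \<Rightarrow> 'b) \<Rightarrow> 'c measure \<Rightarrow> ('a \<Rightarrow> 'c) \<Rightarrow> bool" where
  "independent_elements M S X T Y \<longleftrightarrow>
     X \<in> measurable M S \<and> Y \<in> measurable M T \<and>
     prob_space.indep_set M
       (sigma_sets (space M) {X -` A \<inter> space M | A. A \<in> sets S})
       (sigma_sets (space M) {Y -` A \<inter> space M | A. A \<in> sets T})"


section \<open>Fractional Poisson processes\<close>

definition mittag_leffler :: "real \<Rightarrow> real \<Rightarrow> real" where
  "mittag_leffler \<theta> z = (\<Sum>l. z ^ l / Gamma (1 + \<theta> * real l))"

text \<open>\<open>X j\<close> is the waiting time before the event number \<open>j + 1\<close>. The set whose maximum is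
  taken contains 0, and is almost surely finite for all \<open>t\<close>.\<close>

definition fractional_poisson_process ::
    "'a measure \<Rightarrow> real \<Rightarrow> real \<Rightarrow> (real \<Rightarrow> 'a \<Rightarrow> nat) \<Rightarrow> bool" where
  "fractional_poisson_process M \<theta> lam N \<longleftrightarrow>
     prob_space M \<and>
     (\<forall>t\<ge>0. N t \<in> measurable M (count_space UNIV)) \<and>
     (\<exists>X :: nat \<Rightarrow> 'a \<Rightarrow> real.
        prob_space.indep_vars M (\<lambda>_. borel) X UNIV \<and>
        (\<forall>j. AE \<omega> in M. X j \<omega> \<ge> 0) \<and>
        (\<forall>j. \<forall>x\<ge>0. measure M {\<omega> \<in> space M. X j \<omega> \<le> x} =
                      1 - mittag_leffler \<theta> (- (lam powr \<theta> * x powr \<theta>))) \<and>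
        (AE \<omega> in M. \<forall>t\<ge>0. N t \<omega> = Max {n. (\<Sum>j<n. X j \<omega>) \<le> t}))"

text \<open>\<open>C n\<close> is the class of the event number \<open>n + 1\<close>.\<close>

definition class_count ::
    "(real \<Rightarrow> 'a \<Rightarrow> nat) \<Rightarrow> (nat \<Rightarrow> 'a \<Rightarrow> 'k) \<Rightarrow> 'k \<Rightarrow> real \<Rightarrow> 'a \<Rightarrow> nat" where
  "class_count N C i t \<omega> = card {n. n < N t \<omega> \<and> C n \<omega> = i}"


section \<open>Inverse stable subordinators\<close>

definition levy_process :: "'a measure \<Rightarrow> (real \<Rightarrow> 'a \<Rightarrow> real) \<Rightarrow> bool" where
  "levy_process M L \<longleftrightarrow>
     prob_space M \<and>
     (\<forall>s\<ge>0. L s \<in> borel_measurable M) \<and>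
     (AE \<omega> in M. L 0 \<omega> = 0) \<and>
     (\<forall>(n::nat) t. 0 \<le> t 0 \<and> (\<forall>i<n. t i \<le> t (Suc i)) \<longrightarrow>
        prob_space.indep_vars M (\<lambda>_. borel) (\<lambda>i \<omega>. L (t (Suc i)) \<omega> - L (t i) \<omega>) {..<n}) \<and>
     (\<forall>s\<ge>0. \<forall>h\<ge>0. distr M borel (\<lambda>\<omega>. L (s + h) \<omega> - L s \<omega>) = distr M borel (L h)) \<and>
     (AE \<omega> in M. cadlag (\<lambda>s. L s \<omega>))"

definition standard_stable_subordinator ::
    "'a measure \<Rightarrow> real \<Rightarrow> (real \<Rightarrow> 'a \<Rightarrow> real) \<Rightarrow> bool" where
  "standard_stable_subordinator M \<theta> L \<longleftrightarrow>
     levy_process M L \<and>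
     (AE \<omega> in M. mono_on {0..} (\<lambda>s. L s \<omega>)) \<and>
     (\<forall>s\<ge>0. \<forall>t\<ge>0. (\<integral>\<omega>. exp (- t * L s \<omega>) \<partial>M) = exp (- s * t powr \<theta>))"

definition inverse_process :: "(real \<Rightarrow> 'a \<Rightarrow> real) \<Rightarrow> real \<Rightarrow> 'a \<Rightarrow> real" where
  "inverse_process L t \<omega> = Inf {s. s > 0 \<and> L s \<omega> > t}"

end

theory Submission
  imports Defs
begin

text \<open>Put \<open>l = lam powr \<alpha>\<close>, let \<open>\<Gamma>\<^sub>1 < \<Gamma>\<^sub>2 < \<dots>\<close> be the points of a Poisson process of rate \<open>l\<close> independent
  of \<open>L\<close>, and let \<open>u > 0\<close>. The increments of \<open>L\<close> between the times \<open>\<Gamma>\<^sub>k / u powr \<alpha>\<close>, multiplied by \<open>u\<close>, are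
  independent with Laplace transform \<open>l / (l + s powr \<alpha>)\<close>, which is that of the Mittag-Leffler waiting
  times. Hence the rescaled process has, for each \<open>u\<close>, the same law as the one with arrival times
  \<open>L (\<Gamma>\<^sub>k / u powr \<alpha>)\<close>. In this coupling there is almost sure convergence: the number of arrivals of class
  \<open>i\<close> up to \<open>t\<close> is essentially the number of \<open>\<Gamma>\<^sub>k \<le> u powr \<alpha> * Y t\<close> of class \<open>i\<close>, where \<open>Y\<close> is the inverse of
  \<open>L\<close>, and the strong law of large numbers gives the limit \<open>l * p $ i * Y t\<close> for each \<open>t\<close>. As the paths are
  monotone and the limit is continuous, the convergence is locally uniform, hence holds in the
  Skorokhod topology, and dominated convergence yields the weak convergence.\<close>

section \<open>Convergence and measurability in the Skorokhod space\<close>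

text \<open>Weak convergence involves one \<open>u\<close> at a time, so equality in law for each
  fixed \<open>u\<close> suffices and the given process can be replaced by one for which the limit
  is pathwise. The transform \<open>l / (l + s powr \<alpha>)\<close> arises from \<open>L\<close>
  at an independent exponential time \<open>T\<close> of rate \<open>l\<close>: conditioning on
  \<open>T\<close> leaves the mean of \<open>exp (- T * s powr \<alpha>)\<close>, and the outer
  factor \<open>u\<close> cancels against the inner \<open>u powr \<alpha>\<close> by
  self-similarity. Two obstacles shape the proof. The path laws live on the Borel sets of J1, so
  equality in law of arrival times says something about paths only once a path is known to be a
  Borel function of arrival times and classes. That measurability is the only place where nontrivial
  time changes are needed; the limit theorem itself uses the identity. Moreover the law of a whole
  sequence of increments sampled at random times has to be found: independence is available at
  deterministic times, and Fubini carries it over to the exponential gaps.\<close>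

lemma space_borel_of [simp]: "space (borel_of T) = topspace T"
  and sets_borel_of: "sets (borel_of T) = sigma_sets (topspace T) {U. openin T U}"
  unfolding borel_of_def by (auto intro!: space_measure_of sets_measure_of dest: openin_subset)

lemma openin_sets_borel_of: "openin T U \<Longrightarrow> U \<in> sets (borel_of T)"
  by (auto simp: sets_borel_of)

lemma closedin_sets_borel_of:
  assumes "closedin T C"
  shows "C \<in> sets (borel_of T)"
proof -
  have "space (borel_of T) - (topspace T - C) \<in> sets (borel_of T)"
    using assms by (intro sets.compl_sets openin_sets_borel_of) (auto simp: closedin_def)
  moreover have "space (borel_of T) - (topspace T - C) = C"
    using closedin_subset[OF assms] by auto
  ultimately show ?thesis by simp
qed

lemma measurable_borel_ofI:
  assumes "\<And>x. x \<in> space N \<Longrightarrow> f x \<in> topspace T"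
    and "\<And>U. openin T U \<Longrightarrow> f -` U \<inter> space N \<in> sets N"
  shows "f \<in> measurable N (borel_of T)"
  unfolding borel_of_def
  by (rule measurable_measure_of) (use assms in \<open>auto dest: openin_subset\<close>)

lemma continuous_map_measurable_borel_of:
  assumes "continuous_map T euclideanreal f"
  shows "f \<in> borel_measurable (borel_of T)"
proof (rule borel_measurableI)
  fix S :: "real set" assume "open S"
  then have "openin T {x \<in> topspace T. f x \<in> S}"
    using assms by (auto simp: continuous_map_def)
  then have "{x \<in> topspace T. f x \<in> S} \<in> sets (borel_of T)" by (rule openin_sets_borel_of)
  also have "{x \<in> topspace T. f x \<in> S} = f -` S \<inter> space (borel_of T)" by auto
  finally show "f -` S \<inter> space (borel_of T) \<in> sets (borel_of T)" .
qed

text \<open>An open set \<open>U\<close> is the increasing union of the closed sets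
  \<open>V k\<close> of points at distance at least \<open>1 / Suc k\<close> from its complement.
  The limit lies in \<open>U\<close> iff the sequence eventually stays in a single
  \<open>V k\<close>, which is a countable combination of measurable events.\<close>

lemma (in Metric_space) measurable_borel_of_limit:
  assumes f: "\<And>n::nat. f n \<in> measurable N (borel_of mtopology)"
    and lim: "\<And>x. x \<in> space N \<Longrightarrow> limitin mtopology (\<lambda>n. f n x) (g x) sequentially"
  shows "g \<in> measurable N (borel_of mtopology)"
proof (rule measurable_borel_ofI)
  show g: "g x \<in> topspace mtopology" if "x \<in> space N" for x
    using lim[OF that] by (simp add: limitin_metric)
  have fM: "f n x \<in> M" if "x \<in> space N" for n x
    using measurable_space[OF f that] by simp
  fix U assume U: "openin mtopology U"
  then have UM: "U \<subseteq> M" using openin_subset[OF U] by simp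
  define V where "V k = M - (\<Union>z\<in>M - U. mball z (1 / real (Suc k)))" for k
  have V: "V k \<in> sets (borel_of mtopology)" for k
    unfolding V_def by (intro closedin_sets_borel_of) (auto simp: closedin_def Diff_Diff_Int openin_Int intro!: openin_Union)
  have "g x \<in> U \<longleftrightarrow> (\<exists>k N0. \<forall>n\<ge>N0. f n x \<in> V k)" if x: "x \<in> space N" for x
  proof
    assume gU: "g x \<in> U"
    then obtain r where r: "r > 0" "mball (g x) r \<subseteq> U" using U by (auto simp: openin_mtopology)
    obtain k where k: "1 / real (Suc k) < r / 2"
      using r(1) by (metis half_gt_zero nat_approx_posE)
    obtain N0 where N0: "\<And>n. n \<ge> N0 \<Longrightarrow> d (f n x) (g x) < r / 2"
      using lim[OF x] r(1) unfolding limitin_metric eventually_sequentially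
      by (meson half_gt_zero)
    have "f n x \<in> V k" if "n \<ge> N0" for n
    proof -
      have "\<not> d z (f n x) < 1 / real (Suc k)" if z: "z \<in> M - U" for z
      proof
        assume "d z (f n x) < 1 / real (Suc k)"
        then have "d z (g x) < r"
          using triangle[of z "f n x" "g x"] N0[OF \<open>n \<ge> N0\<close>] k z fM[OF x, of n] g[OF x] by auto
        then have "z \<in> mball (g x) r" using z g[OF x] by (auto simp: commute)
        then show False using r z by auto
      qed
      then show ?thesis using fM[OF x] by (auto simp: V_def)
    qed
    then show "\<exists>k N0. \<forall>n\<ge>N0. f n x \<in> V k" by blast
  next
    assume "\<exists>k N0. \<forall>n\<ge>N0. f n x \<in> V k"
    then obtain k N0 where 1: "\<And>n. n \<ge> N0 \<Longrightarrow> f n x \<in> V k" by blast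
    obtain N1 where 2: "\<And>n. n \<ge> N1 \<Longrightarrow> d (f n x) (g x) < 1 / real (Suc k)"
      using lim[OF x] unfolding limitin_metric eventually_sequentially
      by (metis of_nat_0_less_iff zero_less_Suc zero_less_divide_1_iff)
    define n where "n = max N0 N1"
    have "f n x \<in> V k" "d (g x) (f n x) < 1 / real (Suc k)"
      using 1 2 by (auto simp: n_def commute)
    then show "g x \<in> U" using g[OF x] by (auto simp: V_def)
  qed
  then have "g -` U \<inter> space N = {x \<in> space N. \<exists>k N0. \<forall>n\<ge>N0. f n x \<in> V k}"
    by auto
  also have "\<dots> \<in> sets N"
    using f V by measurable
  finally show "g -` U \<inter> space N \<in> sets N" .
qed

section \<open>Criteria for convergence in the Skorokhod topology\<close>

lemma topspace_skorokhod_J1 [simp]: "topspace skorokhod_J1 = skorokhod_space"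
  unfolding skorokhod_J1_def by (rule Metric_space.topspace_mtopology[OF Metric_space_skorokhod])

text \<open>Tannery's theorem: the weights \<open>(1/2) ^ Suc m\<close> dominate the series, so each
  horizon can be treated alone. The limit path stands first in the distance because in
  \<open>jump_path_limit\<close> the time change carries its jump times onto those of the
  approximating path.\<close>

lemma skorokhod_limitI:
  fixes x :: "'i \<Rightarrow> real \<Rightarrow> 'a::real_normed_vector"
  assumes y: "y \<in> skorokhod_space" and x: "\<And>i. x i \<in> skorokhod_space"
    and lim: "\<And>m. ((\<lambda>i. skorokhod_dist_on (real (Suc m)) (cutoff (real (Suc m)) y)
        (cutoff (real (Suc m)) (x i))) \<longlongrightarrow> 0) F"
  shows "limitin skorokhod_J1 x y F"
proof (cases "F = bot")
  case False
  interpret Metric_space "skorokhod_space :: (real \<Rightarrow> 'a) set" skorokhod_dist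
    by (rule Metric_space_skorokhod)
  let ?D = "\<lambda>m i. skorokhod_dist_on (real (Suc m)) (cutoff (real (Suc m)) y) (cutoff (real (Suc m)) (x i))"
  have "((\<lambda>i. \<Sum>m. (1/2) ^ Suc m * min 1 (?D m i)) \<longlongrightarrow> (\<Sum>m. 0::real)) F"
  proof (rule tannerys_theorem[THEN conjunct2, THEN conjunct2])
    show "((\<lambda>i. (1/2) ^ Suc m * min 1 (?D m i)) \<longlongrightarrow> 0) F" for m
      using tendsto_mult[OF tendsto_const[of "(1/2) ^ Suc m"] tendsto_min[OF tendsto_const[of 1] lim[of m]]]
      by simp
    show "summable (\<lambda>m. (1/2::real) ^ Suc m)"
      by (intro summable_Suc_iff[THEN iffD2] summable_geometric) simp
    have "norm ((1/2) ^ Suc m * min 1 (?D m i)) \<le> (1/2) ^ Suc m" for m i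
      using skorokhod_dist_on_nonneg[of "real (Suc m)" "cutoff (real (Suc m)) y" "cutoff (real (Suc m)) (x i)"]
      by (simp add: abs_mult)
    then show "\<forall>\<^sub>F (m, i) in sequentially \<times>\<^sub>F F. norm ((1/2) ^ Suc m * min 1 (?D m i)) \<le> (1/2) ^ Suc m"
      by (intro always_eventually) auto
  qed fact
  then have "((\<lambda>i. skorokhod_dist (x i) y) \<longlongrightarrow> 0) F"
    using x y by (subst commute) (simp add: skorokhod_dist_def)
  then show ?thesis
    unfolding skorokhod_J1_def limitin_metric using y x by (auto dest: order_tendstoD)
qed (auto simp: limitin_def y)

text \<open>The identity is an admissible time change and the cutoff factor never exceeds 1, so the
  uniform distance on \<open>{0..m}\<close> bounds Skorokhod's.\<close>

lemma skorokhod_limit_uniformI: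
  fixes x :: "'i \<Rightarrow> real \<Rightarrow> 'a::real_normed_vector"
  assumes y: "y \<in> skorokhod_space" and x: "\<And>i. x i \<in> skorokhod_space"
    and unif: "\<And>m e. 0 < m \<Longrightarrow> 0 < e \<Longrightarrow> \<forall>\<^sub>F i in F. \<forall>t\<in>{0..m}. norm (x i t - y t) \<le> e"
  shows "limitin skorokhod_J1 x y F"
proof (rule skorokhod_limitI[OF y x])
  fix m
  let ?m = "real (Suc m)"
  show "((\<lambda>i. skorokhod_dist_on ?m (cutoff ?m y) (cutoff ?m (x i))) \<longlongrightarrow> 0) F"
  proof (rule tendstoI)
    fix e :: real assume e: "0 < e"
    show "\<forall>\<^sub>F i in F. dist (skorokhod_dist_on ?m (cutoff ?m y) (cutoff ?m (x i))) 0 < e"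
    proof (rule eventually_mono[OF unif[of ?m "e/2"]])
      fix i assume i: "\<forall>t\<in>{0..?m}. norm (x i t - y t) \<le> e / 2"
      have "norm (cutoff ?m y t - cutoff ?m (x i) t) \<le> e / 2" if "t \<in> {0..?m}" for t
      proof -
        have "norm (cutoff ?m y t - cutoff ?m (x i) t) = \<bar>max 0 (min 1 (?m - t))\<bar> * norm (y t - x i t)"
          unfolding cutoff_def scaleR_diff_right[symmetric] norm_scaleR ..
        also have "\<dots> \<le> 1 * norm (y t - x i t)" by (intro mult_right_mono) auto
        finally show ?thesis using bspec[OF i that] norm_minus_commute[of "x i t" "y t"] by linarith
      qed
      then have "skorokhod_dist_on ?m (cutoff ?m y) (cutoff ?m (x i)) \<le> e / 2"
        using e by (intro skorokhod_dist_on_le[OF _ time_changes_id]) auto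
      then show "dist (skorokhod_dist_on ?m (cutoff ?m y) (cutoff ?m (x i))) 0 < e"
        using e skorokhod_dist_on_nonneg[of ?m "cutoff ?m y" "cutoff ?m (x i)"] by simp
    qed (use e in auto)
  qed
qed

section \<open>Time changes that move finitely many points, and paths with moving jumps\<close>

lemma tent_lipschitz:
  assumes "(w::real) > 0"
  shows "\<bar>max 0 (1 - \<bar>t - a\<bar> / w) - max 0 (1 - \<bar>s - a\<bar> / w)\<bar> \<le> \<bar>t - s\<bar> / w"
proof -
  have "\<bar>max 0 (1 - \<bar>t - a\<bar> / w) - max 0 (1 - \<bar>s - a\<bar> / w)\<bar> \<le> \<bar>\<bar>t - a\<bar> / w - \<bar>s - a\<bar> / w\<bar>" by linarith
  also have "\<dots> = \<bar>\<bar>t - a\<bar> - \<bar>s - a\<bar>\<bar> / w" using assms by (simp add: diff_divide_distrib[symmetric])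
  also have "\<dots> \<le> \<bar>t - s\<bar> / w" using assms by (intro divide_right_mono) auto
  finally show ?thesis .
qed

text \<open>The time change is the identity plus a multiple of a tent function of width \<open>w\<close>
  at each point. The tents vanish at the other points and at the endpoints, and the sum of their
  slopes is below 1, so that the time change is increasing.\<close>

lemma time_change_moving_points:
  fixes a d :: "'i \<Rightarrow> real"
  assumes I: "finite I" and w: "0 < w" and m: "0 \<le> m"
    and inside: "\<And>i. i \<in> I \<Longrightarrow> w \<le> a i" "\<And>i. i \<in> I \<Longrightarrow> a i + w \<le> m"
    and apart: "\<And>i j. i \<in> I \<Longrightarrow> j \<in> I \<Longrightarrow> i \<noteq> j \<Longrightarrow> w \<le> \<bar>a i - a j\<bar>"
    and small: "(\<Sum>i\<in>I. \<bar>d i\<bar>) < w"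
  obtains \<mu> where "\<mu> \<in> time_changes m" "\<mu> m = m" "\<And>i. i \<in> I \<Longrightarrow> \<mu> (a i) = a i + d i"
    "\<And>t. \<bar>\<mu> t - t\<bar> \<le> (\<Sum>i\<in>I. \<bar>d i\<bar>)"
proof -
  define \<phi> where "\<phi> i t = max 0 (1 - \<bar>t - a i\<bar> / w)" for i t
  define \<mu> where "\<mu> t = t + (\<Sum>i\<in>I. d i * \<phi> i t)" for t
  have \<phi>0: "\<phi> i t = 0" if "w \<le> \<bar>t - a i\<bar>" for i t
    using that w by (simp add: \<phi>_def field_simps)
  have ends: "\<mu> 0 = 0" "\<mu> m = m"
    using inside w by (force simp: \<mu>_def intro!: sum.neutral \<phi>0)+
  have "continuous_on {0..m} \<mu>"
    unfolding \<mu>_def[abs_def] \<phi>_def by (intro continuous_intros) (use w in auto)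
  moreover have "\<mu> s < \<mu> t" if "s < t" for s t
  proof -
    have "\<bar>\<Sum>i\<in>I. d i * \<phi> i t - d i * \<phi> i s\<bar> \<le> (\<Sum>i\<in>I. \<bar>d i\<bar> * (\<bar>t - s\<bar> / w))"
    proof (rule order_trans[OF sum_abs], rule sum_mono)
      fix i show "\<bar>d i * \<phi> i t - d i * \<phi> i s\<bar> \<le> \<bar>d i\<bar> * (\<bar>t - s\<bar> / w)"
        unfolding right_diff_distrib[symmetric] abs_mult \<phi>_def
        by (intro mult_left_mono tent_lipschitz w) auto
    qed
    also have "\<dots> = (\<Sum>i\<in>I. \<bar>d i\<bar>) * (\<bar>t - s\<bar> / w)" by (rule sum_distrib_right[symmetric])
    also have "\<dots> < w * (\<bar>t - s\<bar> / w)" using small that w by (intro mult_strict_right_mono) auto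
    also have "\<dots> = t - s" using w that by simp
    finally show ?thesis by (simp add: \<mu>_def sum_subtractf abs_less_iff)
  qed
  then have "strict_mono_on {0..m} \<mu>" by (auto intro: strict_mono_onI)
  moreover have "\<mu> ` {0..m} = {0..m}"
  proof
    show "\<mu> ` {0..m} \<subseteq> {0..m}"
    proof safe
      fix t assume "t \<in> {0..m}"
      then have "\<mu> 0 \<le> \<mu> t" "\<mu> t \<le> \<mu> m"
        using \<open>strict_mono_on {0..m} \<mu>\<close> m by (auto intro: strict_mono_on_leD)
      then show "\<mu> t \<in> {0..m}" using ends by simp
    qed
    show "{0..m} \<subseteq> \<mu> ` {0..m}"
    proof
      fix u assume "u \<in> {0..m}"
      then have "\<exists>t\<ge>0. t \<le> m \<and> \<mu> t = u"
        using IVT'[of \<mu> 0 u m] ends m \<open>continuous_on {0..m} \<mu>\<close> by auto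
      then show "u \<in> \<mu> ` {0..m}" by auto
    qed
  qed
  ultimately have "\<mu> \<in> time_changes m" by (simp add: time_changes_def)
  moreover note ends(2)
  moreover have "\<mu> (a i) = a i + d i" if i: "i \<in> I" for i
  proof -
    have "(\<Sum>j\<in>I. d j * \<phi> j (a i)) = (\<Sum>j\<in>{i}. d j * \<phi> j (a i))"
      using i apart I by (intro sum.mono_neutral_right) (auto intro!: \<phi>0)
    then show ?thesis by (simp add: \<mu>_def \<phi>_def)
  qed
  moreover have "\<bar>\<mu> t - t\<bar> \<le> (\<Sum>i\<in>I. \<bar>d i\<bar>)" for t
  proof -
    have "\<bar>\<Sum>i\<in>I. d i * \<phi> i t\<bar> \<le> (\<Sum>i\<in>I. \<bar>d i\<bar> * 1)"
      using w by (intro order_trans[OF sum_abs] sum_mono) (auto simp: abs_mult \<phi>_def intro!: mult_left_le)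
    then show ?thesis by (simp add: \<mu>_def)
  qed
  ultimately show ?thesis using that by blast
qed

text \<open>\<open>s k\<close> is the time of point number \<open>k\<close>, counted from 0,
  \<open>c k\<close> the coordinate in which it makes the path jump, and \<open>v\<close> the height
  of the jump. Since \<open>card\<close> is 0 on infinite sets, this is a counting path only if
  finitely many points lie below each time, which the lemmas assume.\<close>

definition jump_path :: "real \<Rightarrow> (nat \<Rightarrow> real) \<Rightarrow> (nat \<Rightarrow> 'k::finite) \<Rightarrow> real \<Rightarrow> real ^ 'k" where
  "jump_path v s c = (\<lambda>t\<in>{0..}. v *\<^sub>R (\<chi> i. real (card {k. s k \<le> t \<and> c k = i})))"

lemma jump_path_cong:
  assumes "0 \<le> t" "0 \<le> t'" "\<And>k. s k \<le> t \<and> c k = i \<longleftrightarrow> s' k \<le> t' \<and> c' k = i"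
  shows "jump_path v s c t $ i = jump_path v s' c' t' $ i"
  using assms by (simp add: jump_path_def)

text \<open>Only the finitely many points up to \<open>t + 1\<close> matter near \<open>t\<close>,
  so the path is constant on a small interval on either side. The left limit counts the points
  strictly before \<open>t\<close>.\<close>

lemma jump_path_in_skorokhod_space:
  assumes fin: "\<And>t. finite {k. s k \<le> t}"
  shows "jump_path v s c \<in> skorokhod_space"
proof -
  let ?x = "jump_path v s c"
  have right: "(?x \<longlongrightarrow> ?x t) (at_right t)" if t: "0 \<le> t" for t
  proof (rule tendsto_eventually)
    have "\<forall>\<^sub>F t' in at_right t. \<forall>k\<in>{k. s k \<le> t + 1}. s k \<le> t' \<longleftrightarrow> s k \<le> t"
    proof (intro eventually_ball_finite fin ballI)
      fix k
      show "\<forall>\<^sub>F t' in at_right t. s k \<le> t' \<longleftrightarrow> s k \<le> t"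
      proof (cases "s k \<le> t")
        case True
        then show ?thesis by (auto simp: eventually_at_filter)
      next
        case False
        then show ?thesis by (auto simp: eventually_at_right_field intro!: exI[of _ "s k"])
      qed
    qed
    moreover have "\<forall>\<^sub>F t' in at_right t. t < t' \<and> t' < t + 1"
      by (auto simp: eventually_at_right_field intro!: exI[of _ "t + 1"])
    ultimately show "\<forall>\<^sub>F t' in at_right t. ?x t' = ?x t"
    proof eventually_elim
      case (elim t')
      have "s k \<le> t' \<longleftrightarrow> s k \<le> t" for k
        using elim by (cases "s k \<le> t + 1") auto
      then show ?case using elim t by (simp add: jump_path_def)
    qed
  qed
  have left: "\<exists>l. (?x \<longlongrightarrow> l) (at_left t)" if t: "0 < t" for t
  proof (intro exI, rule tendsto_eventually)
    have "\<forall>\<^sub>F t' in at_left t. \<forall>k\<in>{k. s k \<le> t}. s k \<le> t' \<longleftrightarrow> s k < t"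
    proof (intro eventually_ball_finite fin ballI)
      fix k
      show "\<forall>\<^sub>F t' in at_left t. s k \<le> t' \<longleftrightarrow> s k < t"
      proof (cases "s k < t")
        case False
        then show ?thesis by (auto simp: eventually_at_filter)
      next
        case True
        then show ?thesis by (auto simp: eventually_at_left_field intro!: exI[of _ "s k"])
      qed
    qed
    moreover have "\<forall>\<^sub>F t' in at_left t. 0 < t' \<and> t' < t"
      using t by (auto simp: eventually_at_left_field)
    ultimately show "\<forall>\<^sub>F t' in at_left t. ?x t' = v *\<^sub>R (\<chi> i. real (card {k. s k < t \<and> c k = i}))"
    proof eventually_elim
      case (elim t')
      have "s k \<le> t' \<longleftrightarrow> s k < t" for k
        using elim by (cases "s k \<le> t") auto
      then show ?case using elim by (simp add: jump_path_def)
    qed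
  qed
  show ?thesis
    using right left by (auto simp: skorokhod_space_def cadlag_def jump_path_def)
qed

text \<open>Jumps at or after the horizon \<open>m\<close> must stay there, because a time change of \<open>{0..m}\<close> cannot
  absorb a new jump; this is what \<open>late\<close> guarantees.\<close>

lemma jump_path_limit:
  fixes s :: "nat \<Rightarrow> real" and s' :: "nat \<Rightarrow> nat \<Rightarrow> real"
  assumes s: "strict_mono s" "0 < s 0" and fin: "\<And>t. finite {k. s k \<le> t}"
    and fin': "\<And>n t. finite {k. s' n k \<le> t}"
    and lim: "\<And>k. (\<lambda>n. s' n k) \<longlonglongrightarrow> s k"
    and late: "\<And>m. \<forall>\<^sub>F n in sequentially. \<forall>k. m \<le> s k \<longrightarrow> m \<le> s' n k"
    and label: "\<And>m. \<forall>\<^sub>F n in sequentially. \<forall>k. s k < m \<longrightarrow> c' n k = c k"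
  shows "limitin skorokhod_J1 (\<lambda>n. jump_path v (s' n) (c' n)) (jump_path v s c) sequentially"
proof (rule skorokhod_limitI)
  show x: "jump_path v s c \<in> skorokhod_space" and "jump_path v (s' n) (c' n) \<in> skorokhod_space" for n
    by (rule jump_path_in_skorokhod_space fin fin')+
  let ?x = "jump_path v s c" and ?x' = "\<lambda>n. jump_path v (s' n) (c' n)"
  fix m'
  define m where "m = real (Suc m')"
  have m: "0 < m" by (simp add: m_def)
  define I where "I = {k. s k < m}"
  have I: "finite I" unfolding I_def by (rule finite_subset[OF _ fin[of m]]) auto
  obtain B where B: "\<And>t. t \<in> {0..m} \<Longrightarrow> norm (?x t) \<le> B"
    using cadlag_bounded[of ?x m] x by (fastforce simp: skorokhod_space_def)
  \<comment> \<open>The width \<open>w\<close> of the tents may not exceed the distances of the jump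
    times before \<open>m\<close> from 0, from \<open>m\<close> and from each other. The entry 1
    keeps \<open>W\<close> nonempty if there is no jump before \<open>m\<close>.\<close>
  define W where "W = insert 1 (s ` I \<union> (\<lambda>k. m - s k) ` I \<union> (\<lambda>(k, j). \<bar>s k - s j\<bar>) ` {(k, j) \<in> I \<times> I. k \<noteq> j})"
  define w where "w = Min W"
  have W: "finite W"
    unfolding W_def using I by (auto intro!: finite_imageI finite_subset[OF _ finite_cartesian_product[OF I I]])
  have s0: "0 < s k" for k
    using s strict_mono_less_eq[OF s(1), of 0 k] by linarith
  have "s k \<noteq> s j" if "k \<noteq> j" for k j
    using that strict_mono_eq[OF s(1)] by auto
  then have "0 < w"
    unfolding w_def using W s0 by (subst Min_gr_iff) (auto simp: W_def I_def)
  have w: "w \<le> y" if "y \<in> W" for y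
    unfolding w_def using W that by auto
  define D where "D n = (\<Sum>k\<in>I. \<bar>s' n k - s k\<bar>)" for n
  have "(\<lambda>n. D n) \<longlonglongrightarrow> (\<Sum>k\<in>I. \<bar>s k - s k\<bar>)"
    unfolding D_def by (intro tendsto_intros lim)
  then have D: "D \<longlonglongrightarrow> 0" by simp
  then have "\<forall>\<^sub>F n in sequentially. D n < w" using \<open>0 < w\<close> by (rule order_tendstoD)
  \<comment> \<open>\<open>D n\<close> bounds the displacement of time. After the time change the
    two paths agree before \<open>m\<close>, so the remaining error comes from the cutoff factors
    alone; these are 1-Lipschitz in time and multiply values of norm at most \<open>B\<close>. Hence
    the factor \<open>max 1 B\<close>.\<close>
  with late[of m] label[of m]
  have "\<forall>\<^sub>F n in sequentially. skorokhod_dist_on m (cutoff m ?x) (cutoff m (?x' n)) \<le> max 1 B * D n"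
  proof eventually_elim
    case (elim n)
    have D0: "0 \<le> D n" by (auto simp: D_def intro!: sum_nonneg)
    obtain \<mu> where \<mu>: "\<mu> \<in> time_changes m" "\<mu> m = m"
      and \<mu>_s: "\<And>k. k \<in> I \<Longrightarrow> \<mu> (s k) = s k + (s' n k - s k)"
      and \<mu>_close: "\<And>t. \<bar>\<mu> t - t\<bar> \<le> D n"
    proof (rule time_change_moving_points[OF I \<open>0 < w\<close>, of m s "\<lambda>k. s' n k - s k"])
      show "w \<le> s k" if "k \<in> I" for k using that by (intro w) (auto simp: W_def)
      show "s k + w \<le> m" if "k \<in> I" for k using w[of "m - s k"] that by (auto simp: W_def)
      show "w \<le> \<bar>s k - s j\<bar>" if "k \<in> I" "j \<in> I" "k \<noteq> j" for k j
        using that by (intro w) (auto simp: W_def)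
    qed (use m elim in \<open>auto simp: D_def\<close>)
    have mono: "strict_mono_on {0..m} \<mu>" using \<mu> by (simp add: time_changes_def)
    have same: "?x' n (\<mu> t) = ?x t" if t: "0 \<le> t" "t < m" for t
    proof -
      have \<mu>t: "0 \<le> \<mu> t" "\<mu> t < m"
        using time_changes_mem[OF \<mu>(1), of t] strict_mono_onD[OF mono, of t m] \<mu>(2) t by auto
      have "s k \<le> t \<and> c k = i \<longleftrightarrow> s' n k \<le> \<mu> t \<and> c' n k = i" for k i
      proof (cases "k \<in> I")
        case True
        have "s k \<le> t \<longleftrightarrow> \<mu> (s k) \<le> \<mu> t"
          using strict_mono_on_less_eq[OF mono, of "s k" t] True t s0[of k] by (auto simp: I_def)
        moreover have "\<mu> (s k) = s' n k" using \<mu>_s[OF True] by simp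
        ultimately show ?thesis using True elim(2) by (auto simp: I_def)
      next
        case False
        then have "m \<le> s k" "m \<le> s' n k" using elim(1) by (auto simp: I_def)
        then show ?thesis using t \<mu>t by auto
      qed
      then have "?x t $ i = ?x' n (\<mu> t) $ i" for i by (intro jump_path_cong \<mu>t t)
      then show ?thesis by (simp add: vec_eq_iff)
    qed
    show ?case
    proof (rule skorokhod_dist_on_le[OF _ \<mu>(1)])
      fix t assume t: "t \<in> {0..m}"
      have "1 * D n \<le> max 1 B * D n" using D0 by (intro mult_right_mono) auto
      then show "\<bar>\<mu> t - t\<bar> \<le> max 1 B * D n" using \<mu>_close[of t] by linarith
      show "norm (cutoff m ?x t - cutoff m (?x' n) (\<mu> t)) \<le> max 1 B * D n"
      \<comment> \<open>The limit may jump exactly at \<open>m\<close>, where \<open>same\<close>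
        says nothing; but there both cutoffs vanish, as \<open>\<mu> m = m\<close>.\<close>
      proof (cases "t = m")
        case True
        then show ?thesis using \<mu>(2) D0 by (simp add: cutoff_def)
      next
        case False
        with t have t': "0 \<le> t" "t < m" by auto
        have "norm (cutoff m ?x t - cutoff m (?x' n) (\<mu> t))
            = \<bar>max 0 (min 1 (m - t)) - max 0 (min 1 (m - \<mu> t))\<bar> * norm (?x t)"
          unfolding cutoff_def same[OF t'] scaleR_diff_left[symmetric] norm_scaleR ..
        also have "\<dots> \<le> D n * max 1 B"
          using B[OF t] \<mu>_close[of t] by (intro mult_mono) auto
        finally show ?thesis by (simp add: mult.commute)
      qed
    qed (use m in auto)
  qed
  note upper = this
  have upper_lim: "(\<lambda>n. max 1 B * D n) \<longlonglongrightarrow> 0" using tendsto_mult_left[OF D] by simp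
  have lower: "\<forall>\<^sub>F n in sequentially. 0 \<le> skorokhod_dist_on m (cutoff m ?x) (cutoff m (?x' n))"
    using m by (intro always_eventually allI skorokhod_dist_on_nonneg) simp
  have "(\<lambda>n. skorokhod_dist_on m (cutoff m ?x) (cutoff m (?x' n))) \<longlonglongrightarrow> 0"
    by (rule tendsto_sandwich[OF lower upper tendsto_const upper_lim])
  then show "(\<lambda>n. skorokhod_dist_on (real (Suc m')) (cutoff (real (Suc m')) ?x)
      (cutoff (real (Suc m')) (?x' n))) \<longlonglongrightarrow> 0"
    by (simp only: m_def)
qed

section \<open>Measurability of random paths\<close>

lemma measurable_list_map:
  fixes f :: "nat \<Rightarrow> 'a \<Rightarrow> 'b::countable"
  assumes [measurable]: "\<And>k. f k \<in> measurable N (count_space UNIV)"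
  shows "(\<lambda>x. map (\<lambda>k. f k x) [0..<n]) \<in> measurable N (count_space UNIV)"
proof (rule measurable_count_space_eq2_countable[THEN iffD2], intro conjI ballI)
  fix l :: "'b list"
  have "map (\<lambda>k. f k x) [0..<n] = l \<longleftrightarrow> length l = n \<and> (\<forall>k\<in>{..<n}. f k x = l ! k)" for x
    unfolding list_eq_iff_nth_eq by auto
  then have "(\<lambda>x. map (\<lambda>k. f k x) [0..<n]) -` {l} \<inter> space N =
      {x \<in> space N. length l = n \<and> (\<forall>k\<in>{..<n}. f k x = l ! k)}"
    by blast
  also have "\<dots> \<in> sets N" by measurable
  finally show "(\<lambda>x. map (\<lambda>k. f k x) [0..<n]) -` {l} \<inter> space N \<in> sets N" .
qed simp

text \<open>Measurability for the Borel sets of the Skorokhod topology is obtained from approximations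
  with countably many values: the first \<open>n\<close> jump times are rounded up (never down, cf. \<open>jump_path_limit\<close>) to
  multiples of \<open>1/n\<close>, and the others are replaced by late deterministic times.\<close>

lemma jump_path_measurable:
  fixes S :: "nat \<Rightarrow> 'a \<Rightarrow> real" and C :: "nat \<Rightarrow> 'a \<Rightarrow> 'k::finite"
  assumes [measurable]: "\<And>k. S k \<in> borel_measurable N" "\<And>k. C k \<in> measurable N (count_space UNIV)"
    and s: "\<And>x. x \<in> space N \<Longrightarrow> strict_mono (\<lambda>k. S k x) \<and> 0 < S 0 x \<and> (\<forall>t. finite {k. S k x \<le> t})"
  shows "(\<lambda>x. jump_path v (\<lambda>k. S k x) (\<lambda>k. C k x)) \<in> measurable N (borel_of skorokhod_J1)"
proof -
  \<comment> \<open>\<open>G\<close> depends on lists over countable types, on which every map into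
    the path space is measurable, so no Borel set of J1 has to be described. The replacement times
    \<open>n + k\<close> pass every fixed horizon as \<open>n\<close> grows, which makes the label
    \<open>undefined\<close> harmless.\<close>
  define G where "G n l l' = jump_path v
      (\<lambda>k. if k < n then real_of_int (l ! k + 1) / real n else real (n + k))
      (\<lambda>k. if k < n then l' ! k else undefined :: 'k)" for n l l'
  define F where "F n x = G n (map (\<lambda>k. \<lfloor>real n * S k x\<rfloor>) [0..<n]) (map (\<lambda>k. C k x) [0..<n])" for n x
  have F: "F n x = jump_path v
      (\<lambda>k. if k < n then real_of_int (\<lfloor>real n * S k x\<rfloor> + 1) / real n else real (n + k))
      (\<lambda>k. if k < n then C k x else undefined)" for n x
    unfolding F_def G_def by (intro arg_cong2[of _ _ _ _ "jump_path v"]) auto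
  have fin: "finite {k. (if k < n then l k else real (n + k)) \<le> t}" for n t and l :: "nat \<Rightarrow> real"
  proof (rule finite_subset)
    show "{k. (if k < n then l k else real (n + k)) \<le> t} \<subseteq> {..<n} \<union> {..nat \<lfloor>t\<rfloor>}"
    proof
      fix k assume "k \<in> {k. (if k < n then l k else real (n + k)) \<le> t}"
      then have "k < n \<or> real k \<le> t" by (auto split: if_splits)
      then show "k \<in> {..<n} \<union> {..nat \<lfloor>t\<rfloor>}" by (auto intro: le_nat_floor)
    qed
  qed auto
  have G_space: "G n l l' \<in> skorokhod_space" for n l l'
    unfolding G_def by (rule jump_path_in_skorokhod_space fin)+
  interpret Metric_space "skorokhod_space :: (real \<Rightarrow> real ^ 'k) set" skorokhod_dist
    by (rule Metric_space_skorokhod)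
  show ?thesis
    unfolding skorokhod_J1_def
  proof (rule measurable_borel_of_limit)
    fix n
    have "(\<lambda>x. (map (\<lambda>k. \<lfloor>real n * S k x\<rfloor>) [0..<n], map (\<lambda>k. C k x) [0..<n])) \<in>
        measurable N (count_space UNIV \<Otimes>\<^sub>M count_space UNIV)"
      by (intro measurable_Pair measurable_list_map) measurable
    then have "(\<lambda>x. (map (\<lambda>k. \<lfloor>real n * S k x\<rfloor>) [0..<n], map (\<lambda>k. C k x) [0..<n])) \<in>
        measurable N (count_space UNIV)"
      by (simp add: pair_measure_countable)
    moreover have "(\<lambda>(l, l'). G n l l') \<in> measurable (count_space UNIV) (borel_of mtopology)"
      using G_space by auto
    ultimately have "(\<lambda>x. case (map (\<lambda>k. \<lfloor>real n * S k x\<rfloor>) [0..<n], map (\<lambda>k. C k x) [0..<n]) of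
        (l, l') \<Rightarrow> G n l l') \<in> measurable N (borel_of mtopology)"
      by (rule measurable_compose)
    then show "F n \<in> measurable N (borel_of mtopology)"
      by (simp add: F_def[abs_def])
  next
    fix x assume x: "x \<in> space N"
    let ?s' = "\<lambda>n k. if k < n then real_of_int (\<lfloor>real n * S k x\<rfloor> + 1) / real n else real (n + k)"
    have up: "S k x \<le> ?s' n k" if "k < n" for n k
      using that by (simp add: field_simps) linarith
    have near: "?s' n k \<le> S k x + 1 / real n" if "k < n" for n k
      using that by (simp add: field_simps)
    have "limitin skorokhod_J1 (\<lambda>n. F n x) (jump_path v (\<lambda>k. S k x) (\<lambda>k. C k x)) sequentially"
      unfolding F
    proof (rule jump_path_limit)
      show "(\<lambda>n. ?s' n k) \<longlonglongrightarrow> S k x" for k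
      proof (rule tendsto_sandwich)
        show "\<forall>\<^sub>F n in sequentially. S k x \<le> ?s' n k"
          using eventually_gt_at_top[of k] by eventually_elim (rule up)
        show "\<forall>\<^sub>F n in sequentially. ?s' n k \<le> S k x + 1 / real n"
          using eventually_gt_at_top[of k] by eventually_elim (rule near)
        show "(\<lambda>n. S k x + 1 / real n) \<longlonglongrightarrow> S k x"
          using tendsto_add[OF tendsto_const[of "S k x"] lim_1_over_n] by simp
      qed auto
      show "\<forall>\<^sub>F n in sequentially. \<forall>k. m \<le> S k x \<longrightarrow> m \<le> ?s' n k" for m
        using eventually_ge_at_top[of "nat \<lceil>m\<rceil>"]
      proof eventually_elim
        case (elim n)
        then have "m \<le> real n" by linarith
        then show ?case using up[of _ n] by (auto intro: order_trans)
      qed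
      show "\<forall>\<^sub>F n in sequentially. \<forall>k. S k x < m \<longrightarrow> (if k < n then C k x else undefined) = C k x" for m
      proof -
        have "finite {k. S k x < m}"
          using s[OF x] by (auto intro: finite_subset[of _ "{k. S k x \<le> m}"])
        then obtain n0 where "\<And>k. S k x < m \<Longrightarrow> k < n0" by (auto simp: finite_nat_set_iff_bounded)
        then show ?thesis by (force simp: eventually_sequentially intro!: exI[of _ n0])
      qed
    qed (use s[OF x] fin in auto)
    then show "limitin mtopology (\<lambda>n. F n x) (jump_path v (\<lambda>k. S k x) (\<lambda>k. C k x)) sequentially"
      by (simp add: skorokhod_J1_def)
  qed
qed

lemma skorokhod_space_scaleR:
  fixes q :: "'a::real_normed_vector"
  assumes "continuous_on {0..} y"
  shows "(\<lambda>t\<in>{0..}. y t *\<^sub>R q) \<in> skorokhod_space"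
proof -
  have lim: "(y \<longlongrightarrow> y t) (at t within {0..})" if "0 \<le> t" for t
    using assms that by (auto simp: continuous_on_def)
  have "((\<lambda>t\<in>{0..}. y t *\<^sub>R q) \<longlongrightarrow> y t *\<^sub>R q) (at t within {0..})" if "0 \<le> t" for t
    using tendsto_scaleR[OF lim[OF that] tendsto_const[of q]]
    by (rule Lim_transform_eventually) (auto simp: eventually_at_filter)
  moreover have "at_right t \<le> at t within {0..}" if "0 \<le> t" for t :: real
    using that by (intro at_le) auto
  moreover have "at_left t \<le> at t within {0..}" if "0 < t" for t :: real
  proof -
    have "at_left t = at t within {0..<t}"
      using that by (intro at_within_nhd[of _ "{0<..}"]) auto
    also have "\<dots> \<le> at t within {0..}" by (rule at_le) auto
    finally show ?thesis .
  qed
  ultimately have "\<And>t. 0 \<le> t \<Longrightarrow> ((\<lambda>t\<in>{0..}. y t *\<^sub>R q) \<longlongrightarrow> y t *\<^sub>R q) (at_right t)"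
    and "\<And>t. 0 < t \<Longrightarrow> ((\<lambda>t\<in>{0..}. y t *\<^sub>R q) \<longlongrightarrow> y t *\<^sub>R q) (at_left t)"
    by (meson tendsto_mono less_imp_le)+
  then show ?thesis
    unfolding skorokhod_space_def cadlag_def by auto
qed

lemma step_path_in_skorokhod_space:
  fixes g :: "int \<Rightarrow> 'a::real_normed_vector"
  assumes "0 < a"
  shows "(\<lambda>t\<in>{0..}. g \<lfloor>a * t\<rfloor>) \<in> skorokhod_space"
proof -
  have right: "((\<lambda>t\<in>{0..}. g \<lfloor>a * t\<rfloor>) \<longlongrightarrow> g \<lfloor>a * t\<rfloor>) (at_right t)" if t: "0 \<le> t" for t
  proof (rule tendsto_eventually)
    have "\<lfloor>a * t'\<rfloor> = \<lfloor>a * t\<rfloor>" if "t < t'" "t' < (real_of_int \<lfloor>a * t\<rfloor> + 1) / a" for t'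
    proof (rule floor_unique)
      have "a * t \<le> a * t'" using assms that by simp
      then show "real_of_int \<lfloor>a * t\<rfloor> \<le> a * t'" by linarith
      show "a * t' < real_of_int \<lfloor>a * t\<rfloor> + 1" using that assms by (simp add: pos_less_divide_eq mult.commute)
    qed
    moreover have "t < (real_of_int \<lfloor>a * t\<rfloor> + 1) / a"
      using assms by (simp add: pos_less_divide_eq mult.commute)
    ultimately show "\<forall>\<^sub>F t' in at_right t. (\<lambda>t\<in>{0..}. g \<lfloor>a * t\<rfloor>) t' = g \<lfloor>a * t\<rfloor>"
      unfolding eventually_at_right_field using t by (intro exI[of _ "(real_of_int \<lfloor>a * t\<rfloor> + 1) / a"]) auto
  qed
  have left: "\<exists>l. ((\<lambda>t\<in>{0..}. g \<lfloor>a * t\<rfloor>) \<longlongrightarrow> l) (at_left t)" if t: "0 < t" for t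
  proof (intro exI tendsto_eventually)
    \<comment> \<open>At a grid point the left limit is the value on the preceding cell; the ceiling
      minus 1 covers this case and the interior of a cell alike.\<close>
    have "\<lfloor>a * t'\<rfloor> = \<lceil>a * t\<rceil> - 1" if "t' < t" "(real_of_int \<lceil>a * t\<rceil> - 1) / a < t'" for t'
    proof (rule floor_unique)
      have "a * t' < a * t" using assms that by simp
      then show "a * t' < real_of_int (\<lceil>a * t\<rceil> - 1) + 1" by linarith
      show "real_of_int (\<lceil>a * t\<rceil> - 1) \<le> a * t'" using that assms by (simp add: pos_divide_less_eq mult.commute)
    qed
    moreover have "(real_of_int \<lceil>a * t\<rceil> - 1) / a < t"
      using assms by (simp add: pos_divide_less_eq mult.commute) linarith
    ultimately show "\<forall>\<^sub>F t' in at_left t. (\<lambda>t\<in>{0..}. g \<lfloor>a * t\<rfloor>) t' = g (\<lceil>a * t\<rceil> - 1)"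
      unfolding eventually_at_left_field
      using t by (intro exI[of _ "max 0 ((real_of_int \<lceil>a * t\<rceil> - 1) / a)"]) auto
  qed
  show ?thesis using right left by (auto simp: skorokhod_space_def cadlag_def)
qed

text \<open>As for jump paths, the approximations depend on a finite list of integers only. Here
  continuity makes them converge locally uniformly, so no time change has to be built.\<close>

lemma scaled_path_measurable:
  fixes q :: "'a::real_normed_vector"
  assumes Y [measurable]: "\<And>t. 0 \<le> t \<Longrightarrow> Y t \<in> borel_measurable N"
    and cont: "\<And>x. x \<in> space N \<Longrightarrow> continuous_on {0..} (\<lambda>t. Y t x)"
  shows "(\<lambda>x. \<lambda>t\<in>{0..}. Y t x *\<^sub>R q) \<in> measurable N (borel_of skorokhod_J1)"
proof -
  \<comment> \<open>Mesh \<open>1 / Suc n\<close> up to the horizon \<open>Suc n\<close> requires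
    \<open>Suc n * Suc n\<close> samples, each rounded down to a multiple of
    \<open>1 / Suc n\<close>; past the horizon the path is set to 0.\<close>
  define G where "G n l = (\<lambda>t\<in>{0..}. (if \<lfloor>real (Suc n) * t\<rfloor> < int (Suc n * Suc n)
      then real_of_int (l ! nat \<lfloor>real (Suc n) * t\<rfloor>) / real (Suc n) else 0) *\<^sub>R q)" for n l
  define F where "F n x = G n (map (\<lambda>j. \<lfloor>real (Suc n) * Y (real j / real (Suc n)) x\<rfloor>) [0..<Suc n * Suc n])" for n x
  have G_space: "G n l \<in> skorokhod_space" for n l
    unfolding G_def by (rule step_path_in_skorokhod_space) simp
  interpret Metric_space "skorokhod_space :: (real \<Rightarrow> 'a) set" skorokhod_dist
    by (rule Metric_space_skorokhod)
  show ?thesis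
    unfolding skorokhod_J1_def
  proof (rule measurable_borel_of_limit)
    fix n
    have [measurable]: "Y (real j / real (Suc n)) \<in> borel_measurable N" for j by (rule Y) simp
    have "(\<lambda>x. map (\<lambda>j. \<lfloor>real (Suc n) * Y (real j / real (Suc n)) x\<rfloor>) [0..<Suc n * Suc n])
        \<in> measurable N (count_space UNIV)"
      by (rule measurable_list_map) measurable
    moreover have "G n \<in> measurable (count_space UNIV) (borel_of mtopology)"
      using G_space by auto
    ultimately show "F n \<in> measurable N (borel_of mtopology)"
      unfolding F_def[abs_def] by (rule measurable_compose)
  next
    fix x assume x: "x \<in> space N"
    have "limitin skorokhod_J1 (\<lambda>n. F n x) (\<lambda>t\<in>{0..}. Y t x *\<^sub>R q) sequentially"
    proof (rule skorokhod_limit_uniformI)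
      show "(\<lambda>t\<in>{0..}. Y t x *\<^sub>R q) \<in> skorokhod_space" by (rule skorokhod_space_scaleR[OF cont[OF x]])
      show "F n x \<in> skorokhod_space" for n unfolding F_def by (rule G_space)
      fix m e :: real assume m: "0 < m" and e: "0 < e"
      define e' where "e' = e / (norm q + 1)"
      have e': "0 < e'" using e by (auto simp: e'_def intro!: divide_pos_pos add_nonneg_pos)
      have "uniformly_continuous_on {0..m} (\<lambda>t. Y t x)"
        by (intro compact_uniformly_continuous continuous_on_subset[OF cont[OF x]]) auto
      then obtain \<delta> where \<delta>: "0 < \<delta>"
        "\<And>s t. s \<in> {0..m} \<Longrightarrow> t \<in> {0..m} \<Longrightarrow> dist s t < \<delta> \<Longrightarrow> dist (Y s x) (Y t x) < e' / 2"
        using e' unfolding uniformly_continuous_on_def by (meson half_gt_zero)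
      have "\<forall>\<^sub>F n in sequentially. 1 / real (Suc n) < min \<delta> (e' / 2)"
        using order_tendstoD(2)[OF LIMSEQ_inverse_real_of_nat, of "min \<delta> (e' / 2)"] \<delta> e'
        by (simp add: inverse_eq_divide)
      then show "\<forall>\<^sub>F n in sequentially. \<forall>t\<in>{0..m}. norm (F n x t - (\<lambda>t\<in>{0..}. Y t x *\<^sub>R q) t) \<le> e"
        using eventually_ge_at_top[of "nat \<lceil>m\<rceil>"]
      proof eventually_elim
        case (elim n)
        let ?N = "real (Suc n)"
        show ?case
        proof
          fix t assume t: "t \<in> {0..m}"
          define j where "j = nat \<lfloor>?N * t\<rfloor>"
          have jr: "real j = real_of_int \<lfloor>?N * t\<rfloor>" using t by (simp add: j_def)
          have j: "real j \<le> ?N * t" "?N * t < real j + 1" unfolding jr by linarith+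
          have "t < ?N" using elim t m by (simp add: ceiling_le_iff nat_le_iff)
          then have "?N * t < ?N * ?N" by simp
          then have "real j < real (Suc n * Suc n)" using j(1) unfolding of_nat_mult by linarith
          then have jn: "j < Suc n * Suc n" by (simp only: of_nat_less_iff)
          have jt: "real j / ?N \<le> t" "t < real j / ?N + 1 / ?N"
            using j by (simp_all add: field_simps)
          then have "dist (Y (real j / ?N) x) (Y t x) < e' / 2"
            using t elim by (intro \<delta>) (auto simp: dist_real_def)
          moreover have "\<bar>real_of_int \<lfloor>?N * y\<rfloor> / ?N - y\<bar> \<le> 1 / ?N" for y
          proof -
            have "real_of_int \<lfloor>?N * y\<rfloor> / ?N - y = (real_of_int \<lfloor>?N * y\<rfloor> - ?N * y) / ?N"
              by (simp add: diff_divide_distrib del: of_nat_Suc)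
            also have "\<bar>\<dots>\<bar> = \<bar>real_of_int \<lfloor>?N * y\<rfloor> - ?N * y\<bar> / ?N"
              unfolding abs_divide by (simp del: of_nat_Suc)
            also have "\<dots> \<le> 1 / ?N" by (intro divide_right_mono) linarith+
            finally show ?thesis .
          qed
          note this[of "Y (real j / ?N) x"]
          ultimately have close: "\<bar>real_of_int \<lfloor>?N * Y (real j / ?N) x\<rfloor> / ?N - Y t x\<bar> \<le> e'"
            using elim unfolding dist_real_def by linarith
          have "\<lfloor>?N * t\<rfloor> = int j" using jr by linarith
          then have "F n x t = (real_of_int \<lfloor>?N * Y (real j / ?N) x\<rfloor> / ?N) *\<^sub>R q"
            using t jn unfolding F_def G_def by (simp del: of_nat_Suc of_nat_mult mult_Suc mult_Suc_right upt_Suc)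
          then have "norm (F n x t - (\<lambda>t\<in>{0..}. Y t x *\<^sub>R q) t) =
              \<bar>real_of_int \<lfloor>?N * Y (real j / ?N) x\<rfloor> / ?N - Y t x\<bar> * norm q"
            using t by (simp add: scaleR_diff_left[symmetric] del: of_nat_Suc)
          also have "\<dots> \<le> e' * (norm q + 1)" using close e' by (intro mult_mono) auto
          also have "\<dots> = e" by (simp add: e'_def add_nonneg_eq_0_iff)
          finally show "norm (F n x t - (\<lambda>t\<in>{0..}. Y t x *\<^sub>R q) t) \<le> e" .
        qed
      qed
    qed
    then show "limitin mtopology (\<lambda>n. F n x) (\<lambda>t\<in>{0..}. Y t x *\<^sub>R q) sequentially"
      by (simp add: skorokhod_J1_def)
  qed
qed

text \<open>The argument of Polya and Dini: convergence is simultaneous at finitely many grid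
  points, and between neighbours monotonicity squeezes \<open>f i\<close> while \<open>g\<close>
  varies by less than \<open>e / 2\<close>. It reduces the functional limit to limits at single
  times.\<close>

lemma mono_pointwise_imp_uniform:
  fixes f :: "'i \<Rightarrow> real \<Rightarrow> real"
  assumes mono: "\<And>i. mono_on {0..} (f i)"
    and lim: "\<And>t. 0 \<le> t \<Longrightarrow> ((\<lambda>i. f i t) \<longlongrightarrow> g t) F"
    and cont: "continuous_on {0..} g" and e: "0 < e"
  shows "\<forall>\<^sub>F i in F. \<forall>t\<in>{0..m}. \<bar>f i t - g t\<bar> \<le> e"
proof -
  \<comment> \<open>The right grid neighbour of a time in \<open>{0..m}\<close> may exceed
    \<open>m\<close>, but by at most 1.\<close>
  have "uniformly_continuous_on {0..m + 1} g"
    by (intro compact_uniformly_continuous continuous_on_subset[OF cont]) auto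
  then obtain \<delta> where \<delta>: "0 < \<delta>"
    "\<And>s t. s \<in> {0..m + 1} \<Longrightarrow> t \<in> {0..m + 1} \<Longrightarrow> dist s t < \<delta> \<Longrightarrow> dist (g s) (g t) < e / 2"
    using e unfolding uniformly_continuous_on_def by (meson half_gt_zero)
  obtain n where n: "1 / real (Suc n) < \<delta>" using \<delta>(1) by (rule nat_approx_posE)
  let ?N = "real (Suc n)"
  have "\<forall>\<^sub>F i in F. \<forall>j\<in>{..Suc (nat \<lfloor>?N * m\<rfloor>)}. dist (f i (real j / ?N)) (g (real j / ?N)) < e / 2"
    using e by (intro eventually_ball_finite ballI tendstoD[OF lim]) auto
  then show ?thesis
  proof eventually_elim
    case (elim i)
    show ?case
    proof
      fix t assume t: "t \<in> {0..m}"
      define j where "j = nat \<lfloor>?N * t\<rfloor>"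
      have jr: "real j = real_of_int \<lfloor>?N * t\<rfloor>" using t by (simp add: j_def)
      have j: "real j \<le> ?N * t" "?N * t < real j + 1" unfolding jr by linarith+
      define a b where "a = real j / ?N" and "b = real (Suc j) / ?N"
      have ab: "0 \<le> a" "a \<le> t" "t < b" "b = a + 1 / ?N"
        using j by (simp_all add: a_def b_def field_simps)
      have "1 / ?N \<le> 1" by simp
      then have b1: "b \<le> m + 1" using ab t unfolding atLeastAtMost_iff by linarith
      have "j \<le> nat \<lfloor>?N * m\<rfloor>"
        unfolding j_def using t by (intro nat_mono floor_mono mult_left_mono) auto
      then have "dist (f i a) (g a) < e / 2" "dist (f i b) (g b) < e / 2"
        using elim by (auto simp: a_def b_def simp del: of_nat_Suc)
      moreover have "dist (g a) (g t) < e / 2"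
        by (rule \<delta>(2)) (use ab b1 n t in \<open>auto simp: dist_real_def\<close>)
      moreover have "dist (g b) (g t) < e / 2"
        by (rule \<delta>(2)) (use ab b1 n t in \<open>auto simp: dist_real_def\<close>)
      moreover have "f i a \<le> f i t" "f i t \<le> f i b"
        using mono[of i] ab t by (auto simp: mono_on_def)
      ultimately show "\<bar>f i t - g t\<bar> \<le> e"
        unfolding dist_real_def abs_le_iff abs_less_iff by (auto simp: abs_less_iff)
    qed
  qed
qed

section \<open>A strong law of large numbers\<close>

text \<open>For partial sums of nonnegative variables, convergence along the squares suffices, and there the
  variances of the averages are summable.\<close>

lemma mean_tendsto_of_squares:
  fixes a :: "nat \<Rightarrow> real"
  assumes a: "incseq a" "0 \<le> a 0"
    and lim: "(\<lambda>k. a (k\<^sup>2) / real (k\<^sup>2)) \<longlonglongrightarrow> m"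
  shows "(\<lambda>n. a n / real n) \<longlonglongrightarrow> m"
proof -
  \<comment> \<open>The integer square root: \<open>n\<close> lies between the squares of
    \<open>r n\<close> and \<open>Suc (r n)\<close>, whose ratio tends to 1, so monotonicity of
    \<open>a\<close> squeezes \<open>a n / real n\<close> between values along the squares.\<close>
  define r where "r n = nat \<lfloor>sqrt (real n)\<rfloor>" for n
  have r: "(r n)\<^sup>2 \<le> n" "n < (Suc (r n))\<^sup>2" for n
  proof -
    have "real (r n) = real_of_int \<lfloor>sqrt (real n)\<rfloor>" by (simp add: r_def)
    then have "real (r n) \<le> sqrt (real n)" "sqrt (real n) < real (Suc (r n))" by linarith+
    then have "real (r n) ^ 2 \<le> sqrt (real n) ^ 2" "sqrt (real n) ^ 2 < real (Suc (r n)) ^ 2"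
      by (intro power_mono power_strict_mono; simp)+
    then have "real ((r n)\<^sup>2) \<le> real n" "real n < real ((Suc (r n))\<^sup>2)" by (simp_all del: of_nat_Suc)
    then show "(r n)\<^sup>2 \<le> n" "n < (Suc (r n))\<^sup>2" by (simp_all only: of_nat_le_iff of_nat_less_iff)
  qed
  have r_lim: "filterlim r at_top sequentially"
    unfolding r_def
    by (rule filterlim_compose[OF filterlim_nat_sequentially])
       (intro filterlim_compose[OF filterlim_floor_sequentially] filterlim_compose[OF sqrt_at_top] filterlim_real_sequentially)
  have a0: "0 \<le> a n" for n using incseqD[OF a(1), of 0 n] a(2) by simp
  have ratio: "(\<lambda>k. (real k / real (Suc k))\<^sup>2) \<longlonglongrightarrow> 1"
    using tendsto_power[OF LIMSEQ_n_over_Suc_n, of 2] by simp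
  have ratio': "(\<lambda>k. (real (Suc k) / real k)\<^sup>2) \<longlonglongrightarrow> 1"
    using tendsto_power[OF LIMSEQ_Suc_n_over_n, of 2] by simp
  have "(\<lambda>k. a (k\<^sup>2) / real (k\<^sup>2) * (real k / real (Suc k))\<^sup>2) \<longlonglongrightarrow> m"
    using tendsto_mult[OF lim ratio] by simp
  then have lower: "(\<lambda>n. a ((r n)\<^sup>2) / real ((r n)\<^sup>2) * (real (r n) / real (Suc (r n)))\<^sup>2) \<longlonglongrightarrow> m"
    using r_lim by (rule filterlim_compose)
  have "(\<lambda>k. a ((Suc k)\<^sup>2) / real ((Suc k)\<^sup>2) * (real (Suc k) / real k)\<^sup>2) \<longlonglongrightarrow> m"
    using tendsto_mult[OF LIMSEQ_Suc[OF lim] ratio'] by simp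
  then have upper: "(\<lambda>n. a ((Suc (r n))\<^sup>2) / real ((Suc (r n))\<^sup>2) * (real (Suc (r n)) / real (r n))\<^sup>2) \<longlonglongrightarrow> m"
    using r_lim by (rule filterlim_compose)
  have pos: "\<forall>\<^sub>F n in sequentially. 0 < r n"
    by (rule eventually_compose_filterlim[OF eventually_gt_at_top r_lim])
  show ?thesis
  proof (rule tendsto_sandwich[OF _ _ lower upper])
    show "\<forall>\<^sub>F n in sequentially. a ((r n)\<^sup>2) / real ((r n)\<^sup>2) * (real (r n) / real (Suc (r n)))\<^sup>2 \<le> a n / real n"
      using pos
    proof eventually_elim
      case (elim n)
      have n: "0 < n" using elim r(1)[of n] by (metis less_le_trans zero_less_power)
      have "a ((r n)\<^sup>2) / real ((r n)\<^sup>2) * (real (r n) / real (Suc (r n)))\<^sup>2 = a ((r n)\<^sup>2) / real ((Suc (r n))\<^sup>2)"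
        using elim by (simp add: power_divide del: of_nat_Suc)
      also have "\<dots> \<le> a n / real n"
        using n r[of n] a0 by (intro frac_le incseqD[OF a(1)]) (auto simp del: of_nat_Suc of_nat_power)
      finally show ?case .
    qed
    show "\<forall>\<^sub>F n in sequentially. a n / real n \<le> a ((Suc (r n))\<^sup>2) / real ((Suc (r n))\<^sup>2) * (real (Suc (r n)) / real (r n))\<^sup>2"
      using pos
    proof eventually_elim
      case (elim n)
      have "a n / real n \<le> a ((Suc (r n))\<^sup>2) / real ((r n)\<^sup>2)"
        using elim r[of n] a0 by (intro frac_le incseqD[OF a(1)]) (auto simp del: of_nat_Suc of_nat_power)
      also have "\<dots> = a ((Suc (r n))\<^sup>2) / real ((Suc (r n))\<^sup>2) * (real (Suc (r n)) / real (r n))\<^sup>2"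
        using elim by (simp add: power_divide del: of_nat_Suc)
      finally show ?case .
    qed
  qed
qed

text \<open>Expand the square; independence makes the mixed terms vanish.\<close>

lemma (in prob_space) variance_sum_indep:
  fixes Z :: "nat \<Rightarrow> 'a \<Rightarrow> real"
  assumes indep: "indep_vars (\<lambda>_. borel) Z UNIV" and I: "finite I"
    and sq: "\<And>n. integrable M (\<lambda>x. (Z n x)\<^sup>2)"
    and mean: "\<And>n. expectation (Z n) = m"
  shows "integrable M (\<lambda>x. (\<Sum>n\<in>I. Z n x - m)\<^sup>2)"
    and "expectation (\<lambda>x. (\<Sum>n\<in>I. Z n x - m)\<^sup>2) = (\<Sum>n\<in>I. variance (Z n))"
proof -
  have [measurable]: "random_variable borel (Z n)" for n
    using indep by (auto simp: indep_vars_def)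
  have Z: "integrable M (Z n)" for n
    by (rule square_integrable_imp_integrable[OF _ sq]) simp
  have indep': "indep_vars (\<lambda>_. borel) (\<lambda>n x. Z n x - m) UNIV"
    by (rule indep_vars_compose2[OF indep]) simp
  have sq': "integrable M (\<lambda>x. (Z n x - m)\<^sup>2)" for n
    using Z sq by (simp add: power2_diff)
  have cov: "integrable M (\<lambda>x. (Z i x - m) * (Z j x - m)) \<and>
      expectation (\<lambda>x. (Z i x - m) * (Z j x - m)) = (if i = j then variance (Z i) else 0)" for i j
  proof (cases "i = j")
    case True
    then show ?thesis using sq' by (simp add: power2_eq_square mean)
  next
    case False
    have ind: "indep_vars (\<lambda>_. borel) (\<lambda>n x. Z n x - m) {i, j}"
      by (rule indep_vars_subset[OF indep']) simp
    show ?thesis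
      using indep_vars_integrable[OF _ ind] indep_vars_lebesgue_integral[OF _ ind] False Z mean
      by (simp add: prob_space)
  qed
  have eq: "(\<Sum>n\<in>I. Z n x - m)\<^sup>2 = (\<Sum>i\<in>I. \<Sum>j\<in>I. (Z i x - m) * (Z j x - m))" for x
    by (simp add: power2_eq_square sum_product)
  show "integrable M (\<lambda>x. (\<Sum>n\<in>I. Z n x - m)\<^sup>2)"
    unfolding eq using cov by (intro Bochner_Integration.integrable_sum) auto
  show "expectation (\<lambda>x. (\<Sum>n\<in>I. Z n x - m)\<^sup>2) = (\<Sum>n\<in>I. variance (Z n))"
    unfolding eq using cov I by (simp add: Bochner_Integration.integral_sum Bochner_Integration.integrable_sum sum.delta)
qed

text \<open>A nonnegative series with finite expectation is almost surely finite, so the squared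
  centred averages \<open>D k\<close> tend to 0. Nonnegativity of the \<open>Z n\<close> makes the
  partial sums increasing, which \<open>mean_tendsto_of_squares\<close> uses to fill the gaps
  between squares.\<close>

lemma (in prob_space) strong_law_nonneg:
  fixes Z :: "nat \<Rightarrow> 'a \<Rightarrow> real"
  assumes indep: "indep_vars (\<lambda>_. borel) Z UNIV"
    and nonneg: "\<And>n. AE x in M. 0 \<le> Z n x"
    and sq: "\<And>n. integrable M (\<lambda>x. (Z n x)\<^sup>2)"
    and mean: "\<And>n. expectation (Z n) = m"
    and var: "\<And>n. variance (Z n) \<le> V"
  shows "AE x in M. (\<lambda>n. (\<Sum>k<n. Z k x) / real n) \<longlonglongrightarrow> m"
proof -
  have [measurable]: "random_variable borel (Z n)" for n
    using indep by (auto simp: indep_vars_def)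
  define D where "D k x = ((\<Sum>n<k\<^sup>2. Z n x - m) / real (k\<^sup>2))\<^sup>2" for k :: nat and x
  have [measurable]: "D k \<in> borel_measurable M" for k unfolding D_def by simp
  have V0: "0 \<le> V" using var[of 0] variance_positive[of "Z 0"] by linarith
  have D_le: "(\<integral>\<^sup>+x. ennreal (D k x) \<partial>M) \<le> ennreal (V / real (k\<^sup>2))" for k
  proof -
    note vs = variance_sum_indep[OF indep _ sq mean, of "{..<k\<^sup>2}"]
    have D: "integrable M (D k)"
      unfolding D_def[abs_def] power_divide using vs by (intro integrable_divide) simp
    have "expectation (D k) = (\<Sum>n<k\<^sup>2. variance (Z n)) / (real (k\<^sup>2))\<^sup>2"
      unfolding D_def power_divide using vs by simp
    also have "\<dots> \<le> (real (k\<^sup>2) * V) / (real (k\<^sup>2))\<^sup>2"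
      using sum_bounded_above[of "{..<k\<^sup>2}" "\<lambda>n. variance (Z n)" V] var
      by (intro divide_right_mono) auto
    also have "\<dots> = V / real (k\<^sup>2)" by (simp add: power2_eq_square)
    finally have "expectation (D k) \<le> V / real (k\<^sup>2)" .
    then show ?thesis
      using D by (subst nn_integral_eq_integral) (auto simp: D_def intro!: ennreal_leI)
  qed
  have "summable (\<lambda>k. V / real (k\<^sup>2))"
    using summable_mult[OF inverse_power_summable[of 2, where 'a = real], of V]
    by (simp add: divide_inverse power_inverse)
  have "(\<integral>\<^sup>+x. (\<Sum>k. ennreal (D k x)) \<partial>M) = (\<Sum>k. \<integral>\<^sup>+x. ennreal (D k x) \<partial>M)"
    by (rule nn_integral_suminf) simp
  also have "\<dots> \<le> (\<Sum>k. ennreal (V / real (k\<^sup>2)))"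
    by (intro suminf_le D_le) auto
  also have "\<dots> = ennreal (\<Sum>k. V / real (k\<^sup>2))"
    by (rule suminf_ennreal2[OF _ \<open>summable (\<lambda>k. V / real (k\<^sup>2))\<close>]) (simp add: V0)
  also have "\<dots> < \<infinity>" by simp
  finally have "AE x in M. (\<Sum>k. ennreal (D k x)) \<noteq> \<infinity>"
    by (intro nn_integral_PInf_AE) auto
  moreover have "AE x in M. \<forall>n. 0 \<le> Z n x"
    using nonneg by (simp add: AE_all_countable)
  ultimately show ?thesis
  proof eventually_elim
    case (elim x)
    have "summable (\<lambda>k. D k x)"
      using elim(1) by (intro summable_suminf_not_top) (auto simp: D_def)
    then have "(\<lambda>k. D k x) \<longlonglongrightarrow> 0" by (rule summable_LIMSEQ_zero)
    then have "(\<lambda>k. sqrt (D k x)) \<longlonglongrightarrow> sqrt 0" by (rule tendsto_real_sqrt)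
    then have "(\<lambda>k. (\<Sum>n<k\<^sup>2. Z n x - m) / real (k\<^sup>2)) \<longlonglongrightarrow> 0"
      by (intro tendsto_rabs_zero_cancel[of "\<lambda>k. (\<Sum>n<k\<^sup>2. Z n x - m) / real (k\<^sup>2)"]) (simp add: D_def)
    then have "(\<lambda>k. (\<Sum>n<k\<^sup>2. Z n x - m) / real (k\<^sup>2) + m) \<longlonglongrightarrow> 0 + m"
      by (intro tendsto_add tendsto_const)
    moreover have "\<forall>\<^sub>F k in sequentially. (\<Sum>n<k\<^sup>2. Z n x - m) / real (k\<^sup>2) + m = (\<Sum>n<k\<^sup>2. Z n x) / real (k\<^sup>2)"
      using eventually_gt_at_top[of 0]
      by eventually_elim (simp add: sum_subtractf diff_divide_distrib)
    ultimately have "(\<lambda>k. (\<Sum>n<k\<^sup>2. Z n x) / real (k\<^sup>2)) \<longlonglongrightarrow> m"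
      by (simp add: tendsto_cong)
    then show ?case
      using elim(2) by (intro mean_tendsto_of_squares) (auto intro!: incseq_SucI)
  qed
qed

section \<open>Laplace transforms and the Mittag-Leffler law\<close>

text \<open>After the substitution \<open>y = exp (- x)\<close>, the values of the Laplace transform at
  \<open>s, s + 1, s + 2, \<dots>\<close> are the moments of a measure on the unit interval, so that they determine the
  law by the theorem of Weierstrass. Starting at \<open>s > lam\<close> avoids the region where the Mittag-Leffler
  series cannot be integrated term by term.\<close>

lemma laplace_weighted_integral_eq:
  fixes \<mu> \<nu> :: "real measure" and g :: "real \<Rightarrow> real"
  assumes \<mu>: "real_distribution \<mu>" "AE x in \<mu>. 0 \<le> x" and \<nu>: "real_distribution \<nu>" "AE x in \<nu>. 0 \<le> x"
    and s: "0 \<le> s"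
    and eq: "\<And>k::nat. (\<integral>x. exp (- (s + real k) * x) \<partial>\<mu>) = (\<integral>x. exp (- (s + real k) * x) \<partial>\<nu>)"
    and g: "continuous_on UNIV g"
  shows "(\<integral>x. exp (- s * x) * g (exp (- x)) \<partial>\<mu>) = (\<integral>x. exp (- s * x) * g (exp (- x)) \<partial>\<nu>)"
proof -
  have [measurable]: "g \<in> borel_measurable borel" using g by (rule borel_measurable_continuous_onI)
  obtain B where B: "\<And>y. y \<in> {0..1} \<Longrightarrow> \<bar>g y\<bar> \<le> B"
  proof -
    have "compact (g ` {0..1})" by (intro compact_continuous_image continuous_on_subset[OF g]) auto
    then show ?thesis using that by (force dest!: compact_imp_bounded simp: bounded_iff)
  qed
  \<comment> \<open>Exchanging \<open>g\<close> for a polynomial costs at most \<open>e\<close>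
    under any law on the half-line, where \<open>exp (- s * x) \<le> 1\<close>; the polynomial turns
    the integral into a combination of Laplace values.\<close>
  have close: "\<bar>(\<integral>x. exp (- s * x) * g (exp (- x)) \<partial>N) - (\<Sum>i\<le>n. a i * (\<integral>x. exp (- (s + real i) * x) \<partial>N))\<bar> \<le> e"
    if N: "real_distribution N" "AE x in N. 0 \<le> x"
      and e: "\<And>y. y \<in> {0..1} \<Longrightarrow> \<bar>g y - (\<Sum>i\<le>n. a i * y ^ i)\<bar> \<le> e" for N :: "real measure" and n e and a :: "nat \<Rightarrow> real"
  proof -
    interpret real_distribution N by fact
    have i1: "integrable N (\<lambda>x. exp (- (s + real k) * x))" for k
      by (rule integrable_const_bound[of _ 1])
         (use N(2) s in \<open>auto elim!: eventually_mono intro: mult_nonpos_nonneg\<close>)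
    have i2: "integrable N (\<lambda>x. exp (- s * x) * g (exp (- x)))"
    proof (rule integrable_const_bound[of _ "1 * B"])
      show "AE x in N. norm (exp (- s * x) * g (exp (- x))) \<le> 1 * B"
        using N(2)
      proof eventually_elim
        case (elim x)
        then show ?case unfolding norm_mult using s B[of "exp (-x)"] by (intro mult_mono) auto
      qed
    qed simp
    have "(\<Sum>i\<le>n. a i * (\<integral>x. exp (- (s + real i) * x) \<partial>N)) = (\<integral>x. (\<Sum>i\<le>n. a i * exp (- (s + real i) * x)) \<partial>N)"
      using i1 by (subst Bochner_Integration.integral_sum) auto
    then have "(\<integral>x. exp (- s * x) * g (exp (- x)) \<partial>N) - (\<Sum>i\<le>n. a i * (\<integral>x. exp (- (s + real i) * x) \<partial>N))
        = (\<integral>x. exp (- s * x) * g (exp (- x)) - (\<Sum>i\<le>n. a i * exp (- (s + real i) * x)) \<partial>N)"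
      using i1 i2 by (simp add: Bochner_Integration.integral_diff)
    also have "\<bar>\<dots>\<bar> \<le> (\<integral>x. e \<partial>N)"
    proof (rule order_trans[OF integral_abs_bound], rule integral_mono_AE)
      show "AE x in N. \<bar>exp (- s * x) * g (exp (- x)) - (\<Sum>i\<le>n. a i * exp (- (s + real i) * x))\<bar> \<le> e"
        using N(2)
      proof eventually_elim
        case (elim x)
        have *: "exp (- (s + real i) * x) = exp (- s * x) * exp (- x) ^ i" for i
          by (simp add: exp_of_nat_mult[symmetric] exp_add[symmetric] algebra_simps)
        have "exp (- s * x) * g (exp (- x)) - (\<Sum>i\<le>n. a i * exp (- (s + real i) * x)) =
            exp (- s * x) * (g (exp (- x)) - (\<Sum>i\<le>n. a i * exp (- x) ^ i))"
          unfolding * by (simp add: right_diff_distrib sum_distrib_left mult.left_commute)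
        also have "\<bar>\<dots>\<bar> \<le> 1 * e"
          unfolding abs_mult using s elim e[of "exp (-x)"] by (intro mult_mono) auto
        finally show ?case by simp
      qed
    qed (use i1 i2 in auto)
    finally show ?thesis using prob_space by simp
  qed
  show ?thesis
  proof (rule ccontr)
    assume ne: "\<not> ?thesis"
    \<comment> \<open>Both integrals will lie within \<open>e\<close> of the same number and so
      differ by at most \<open>2 * e\<close>; taking a third of their distance makes this
      absurd.\<close>
    define e where "e = \<bar>(\<integral>x. exp (- s * x) * g (exp (- x)) \<partial>\<mu>) - (\<integral>x. exp (- s * x) * g (exp (- x)) \<partial>\<nu>)\<bar> / 3"
    have e: "0 < e" using ne by (simp add: e_def)
    obtain p where p: "real_polynomial_function p" "\<And>y. y \<in> {0..1} \<Longrightarrow> \<bar>g y - p y\<bar> < e"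
      using Stone_Weierstrass_real_polynomial_function[of "{0..1}" g e] e continuous_on_subset[OF g] by auto
    obtain a n where a: "p = (\<lambda>y. \<Sum>i\<le>n. a i * y ^ i)"
      using p(1) unfolding real_polynomial_function_iff_sum by auto
    have ge: "\<And>y. y \<in> {0..1} \<Longrightarrow> \<bar>g y - (\<Sum>i\<le>n. a i * y ^ i)\<bar> \<le> e"
      using p(2) by (auto simp: a intro: less_imp_le)
    have "\<bar>(\<integral>x. exp (- s * x) * g (exp (- x)) \<partial>\<mu>) - (\<Sum>i\<le>n. a i * (\<integral>x. exp (- (s + real i) * x) \<partial>\<nu>))\<bar> \<le> e"
      using close[OF \<mu>] ge unfolding eq by blast
    moreover have "\<bar>(\<integral>x. exp (- s * x) * g (exp (- x)) \<partial>\<nu>) - (\<Sum>i\<le>n. a i * (\<integral>x. exp (- (s + real i) * x) \<partial>\<nu>))\<bar> \<le> e"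
      using close[OF \<nu>] ge by blast
    moreover have False if "\<bar>A - S\<bar> \<le> e" "\<bar>B - S\<bar> \<le> e" "e = \<bar>A - B\<bar> / 3" for A B S :: real
    proof -
      have "\<bar>A - B\<bar> \<le> 2 * e" using that(1,2) by linarith
      also have "\<dots> < 3 * e" using e by simp
      also have "\<dots> = \<bar>A - B\<bar>" using that(3) by simp
      finally show False by simp
    qed
    ultimately show False using e_def by blast
  qed
qed

text \<open>The ramps \<open>h n\<close> decrease to the indicator of \<open>{..a}\<close>, so their
  integrals recover the distribution function. To write a ramp as
  \<open>exp (- s * x) * g (exp (- x))\<close>, the function \<open>g\<close> must divide by the
  weight; this is possible continuously because the ramp vanishes before \<open>exp (- x)\<close>
  comes near 0.\<close>

lemma laplace_unique:
  fixes \<mu> \<nu> :: "real measure"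
  assumes \<mu>: "real_distribution \<mu>" "AE x in \<mu>. 0 \<le> x" and \<nu>: "real_distribution \<nu>" "AE x in \<nu>. 0 \<le> x"
    and s: "0 \<le> s"
    and eq: "\<And>k::nat. (\<integral>x. exp (- (s + real k) * x) \<partial>\<mu>) = (\<integral>x. exp (- (s + real k) * x) \<partial>\<nu>)"
  shows "\<mu> = \<nu>"
proof (rule cdf_unique[OF \<mu>(1) \<nu>(1)], rule ext)
  fix a :: real
  show "cdf \<mu> a = cdf \<nu> a"
  proof (cases "0 \<le> a")
    case False
    have "cdf N a = 0" if N: "real_distribution N" "AE x in N. 0 \<le> x" for N
    proof -
      interpret real_distribution N by fact
      have "AE x in N. x \<notin> {..a}" using N(2) by eventually_elim (use False in auto)
      then have "measure N {..a} = 0" by (subst prob_eq_0) auto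
      then show ?thesis by (simp add: cdf_def)
    qed
    then show ?thesis using \<mu> \<nu> by simp
  next
    case a: True
    define h where "h n x = max 0 (min 1 (1 + real (Suc n) * (a - x)))" for n x
    \<comment> \<open>All ramps vanish beyond \<open>a + 1\<close>. Truncating
      \<open>y = exp (- x)\<close> from below at \<open>\<delta>\<close> therefore changes nothing,
      and it keeps the logarithm and the negative power continuous on the whole line.\<close>
    define \<delta> where "\<delta> = exp (- (a + 1))"
    define g where "g n y = max y \<delta> powr (- s) * h n (- ln (max y \<delta>))" for n y
    have "0 < \<delta>" by (simp add: \<delta>_def)
    have g: "continuous_on UNIV (g n)" for n
      unfolding g_def[abs_def] h_def using \<open>0 < \<delta>\<close>
      by (intro continuous_intros) (auto simp: max_def)
    have gh: "exp (- s * x) * g n (exp (- x)) = h n x" if "0 \<le> x" for n x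
    proof (cases "x \<le> a + 1")
      case True
      then have "max (exp (- x)) \<delta> = exp (- x)" by (simp add: \<delta>_def)
      then show ?thesis by (simp add: g_def powr_def exp_add[symmetric])
    next
      case False
      then have mx: "max (exp (- x)) \<delta> = \<delta>" by (simp add: \<delta>_def)
      have "h n (a + 1) = 0" by (simp add: h_def)
      moreover have "1 + real (Suc n) * (a - x) \<le> 0"
        using False mult_mono[of 1 "real (Suc n)" 1 "x - a"] by (simp add: algebra_simps)
      then have "h n x = 0" by (simp add: h_def)
      moreover have "- ln \<delta> = a + 1" by (simp add: \<delta>_def)
      ultimately show ?thesis unfolding g_def mx by simp
    qed
    have lim: "(\<lambda>n. \<integral>x. exp (- s * x) * g n (exp (- x)) \<partial>N) \<longlonglongrightarrow> cdf N a"
      if N: "real_distribution N" "AE x in N. 0 \<le> x" for N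
    proof -
      interpret real_distribution N by fact
      have [measurable]: "h n \<in> borel_measurable borel" for n unfolding h_def by simp
      have "(\<lambda>n. \<integral>x. h n x \<partial>N) \<longlonglongrightarrow> (\<integral>x. indicator {..a} x \<partial>N)"
      proof (rule integral_dominated_convergence[where w = "\<lambda>_. 1"])
        show "AE x in N. (\<lambda>n. h n x) \<longlonglongrightarrow> indicator {..a} x"
        proof (rule AE_I2)
          fix x
          show "(\<lambda>n. h n x) \<longlonglongrightarrow> indicator {..a} x"
          proof (cases "x \<le> a")
            case True
            then have "h n x = 1" for n by (simp add: h_def)
            then show ?thesis using True by simp
          next
            case False
            then obtain n0 where n0: "1 / (x - a) < real n0"
              using reals_Archimedean2 by blast
            have "h n x = 0" if "n0 \<le> n" for n
            proof -
              have "1 / (x - a) \<le> real (Suc n)" using n0 that by linarith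
              then have "1 \<le> real (Suc n) * (x - a)" using False by (simp add: pos_divide_le_eq)
              then show ?thesis by (simp add: h_def algebra_simps)
            qed
            then have "\<forall>\<^sub>F n in sequentially. h n x = 0" by (auto simp: eventually_sequentially)
            then show ?thesis using False by (simp add: tendsto_eventually)
          qed
        qed
      qed (auto simp: h_def)
      moreover have "(\<integral>x. exp (- s * x) * g n (exp (- x)) \<partial>N) = (\<integral>x. h n x \<partial>N)" for n
        using borel_measurable_continuous_onI[OF g[of n]] N(2)
        by (intro integral_cong_AE) (auto elim!: eventually_mono simp: gh[simplified])
      ultimately show ?thesis by (simp add: cdf_def)
    qed
    have "(\<lambda>n. \<integral>x. exp (- s * x) * g n (exp (- x)) \<partial>\<mu>) \<longlonglongrightarrow> cdf \<nu> a"
      unfolding laplace_weighted_integral_eq[OF \<mu> \<nu> s eq g] by (rule lim[OF \<nu>])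
    then show ?thesis using lim[OF \<mu>] by (rule LIMSEQ_unique[symmetric])
  qed
qed

text \<open>Integration by parts in Tonelli's form: \<open>exp (- s * x)\<close> is the integral of
  \<open>s * exp (- s * y)\<close> over \<open>y \<ge> x\<close>, and exchanging the order of
  integration brings in the distribution function.\<close>

lemma laplace_eq_integral_cdf:
  assumes \<mu>: "real_distribution \<mu>" "AE x in \<mu>. 0 \<le> x" and s: "0 < s"
  shows "ennreal (\<integral>x. exp (- s * x) \<partial>\<mu>) = (\<integral>\<^sup>+y. ennreal (indicator {0..} y * (s * exp (- s * y)) * measure \<mu> {..y}) \<partial>lborel)"
proof -
  interpret real_distribution \<mu> by fact
  interpret pair_sigma_finite \<mu> lborel ..
  have "integrable \<mu> (\<lambda>x. exp (- s * x))"
    by (rule integrable_const_bound[of _ 1]) (use \<mu>(2) s in \<open>auto elim!: eventually_mono\<close>)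
  then have "ennreal (\<integral>x. exp (- s * x) \<partial>\<mu>) = (\<integral>\<^sup>+x. ennreal (exp (- s * x)) \<partial>\<mu>)"
    by (subst nn_integral_eq_integral) auto
  also have "\<dots> = (\<integral>\<^sup>+x. (\<integral>\<^sup>+y. ennreal (s * exp (- s * y)) * indicator {x..} y \<partial>lborel) \<partial>\<mu>)"
  proof (rule nn_integral_cong)
    fix x
    have "(\<integral>\<^sup>+y. ennreal (s * exp (- s * y)) * indicator {x..} y \<partial>lborel) = ennreal (0 - (- exp (- s * x)))"
    proof (rule nn_integral_FTC_atLeast)
      show "((\<lambda>y. - exp (- s * y)) has_real_derivative s * exp (- s * y)) (at y)" for y
        by (auto intro!: derivative_eq_intros)
      have "((\<lambda>y. exp (- s * y)) \<longlongrightarrow> 0) at_top"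
        by (rule filterlim_compose[OF exp_at_bot],
            rule filterlim_tendsto_neg_mult_at_bot[OF tendsto_const _ filterlim_ident]) (use s in simp)
      then show "((\<lambda>y. - exp (- s * y)) \<longlongrightarrow> 0) at_top" using tendsto_minus by fastforce
    qed (use s in auto)
    then show "ennreal (exp (- s * x)) = (\<integral>\<^sup>+y. ennreal (s * exp (- s * y)) * indicator {x..} y \<partial>lborel)" by simp
  qed
  also have "\<dots> = (\<integral>\<^sup>+x. (\<integral>\<^sup>+y. ennreal (indicator {0..} y * (s * exp (- s * y))) * indicator {p. fst p \<le> snd p} (x, y) \<partial>lborel) \<partial>\<mu>)"
    using \<mu>(2)
    by (intro nn_integral_cong_AE) (auto elim!: eventually_mono intro!: nn_integral_cong split: split_indicator)
  also have "\<dots> = (\<integral>\<^sup>+y. (\<integral>\<^sup>+x. ennreal (indicator {0..} y * (s * exp (- s * y))) * indicator {p. fst p \<le> snd p} (x, y) \<partial>\<mu>) \<partial>lborel)"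
    by (rule Fubini'[symmetric]) measurable
  also have "\<dots> = (\<integral>\<^sup>+y. ennreal (indicator {0..} y * (s * exp (- s * y)) * measure \<mu> {..y}) \<partial>lborel)"
  proof (rule nn_integral_cong)
    fix y
    have "(\<integral>\<^sup>+x. ennreal (indicator {0..} y * (s * exp (- s * y))) * indicator {p. fst p \<le> snd p} (x, y) \<partial>\<mu>) =
        (\<integral>\<^sup>+x. ennreal (indicator {0..} y * (s * exp (- s * y))) * indicator {..y} x \<partial>\<mu>)"
      by (intro nn_integral_cong) (auto split: split_indicator)
    also have "\<dots> = ennreal (indicator {0..} y * (s * exp (- s * y))) * emeasure \<mu> {..y}"
      by (rule nn_integral_cmult_indicator) simp
    also have "\<dots> = ennreal (indicator {0..} y * (s * exp (- s * y)) * measure \<mu> {..y})"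
      using s by (subst ennreal_mult) (auto simp: emeasure_eq_measure)
    finally show "(\<integral>\<^sup>+x. ennreal (indicator {0..} y * (s * exp (- s * y))) * indicator {p. fst p \<le> snd p} (x, y) \<partial>\<mu>) = \<dots>" .
  qed
  finally show ?thesis .
qed

text \<open>Euler's integral for \<open>Gamma\<close> under the substitution
  \<open>t = s * y\<close>. The resulting Gamma value will cancel the denominator of the
  Mittag-Leffler series.\<close>

lemma nn_integral_powr_exp:
  fixes \<theta> s :: real
  assumes s: "0 < s" and \<theta>: "0 \<le> \<theta>"
  shows "(\<integral>\<^sup>+y. ennreal (indicator {0..} y * (s * exp (- s * y)) * (y powr \<theta>) ^ j) \<partial>lborel) =
    ennreal (Gamma (1 + \<theta> * real j) / (s powr \<theta>) ^ j)"
proof -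
  let ?z = "\<theta> * real j"
  have powr: "(y powr \<theta>) ^ j = y powr ?z" if "0 < y" for y
    using that by (simp add: powr_powr powr_realpow[symmetric])
  have "ennreal (Gamma (1 + ?z)) = (\<integral>\<^sup>+t. ennreal (indicator {0..} t * t powr ?z / exp t) \<partial>lborel)"
    using Gamma_conv_nn_integral_real[of "1 + ?z"] \<theta> by (simp add: add_pos_nonneg)
  also have "\<dots> = ennreal \<bar>s\<bar> * (\<integral>\<^sup>+y. ennreal (indicator {0..} (0 + s * y) * (0 + s * y) powr ?z / exp (0 + s * y)) \<partial>lborel)"
    using s by (intro nn_integral_real_affine) auto
  also have "\<dots> = (\<integral>\<^sup>+y. ennreal s * ennreal (indicator {0..} (0 + s * y) * (0 + s * y) powr ?z / exp (0 + s * y)) \<partial>lborel)"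
    using s by (subst nn_integral_cmult) auto
  also have "\<dots> = (\<integral>\<^sup>+y. ennreal ((s powr \<theta>) ^ j) * ennreal (indicator {0..} y * (s * exp (- s * y)) * (y powr \<theta>) ^ j) \<partial>lborel)"
  proof (rule nn_integral_cong_AE)
    \<comment> \<open>At \<open>y = 0\<close> the integrands differ for \<open>j = 0\<close>,
      because \<open>0 powr 0 = 0\<close> whereas a power with exponent 0 is 1.\<close>
    have "AE y in lborel. y \<noteq> (0::real)" by (rule AE_lborel_singleton)
    then show "AE y in lborel. ennreal s * ennreal (indicator {0..} (0 + s * y) * (0 + s * y) powr ?z / exp (0 + s * y)) =
      ennreal ((s powr \<theta>) ^ j) * ennreal (indicator {0..} y * (s * exp (- s * y)) * (y powr \<theta>) ^ j)"
    proof eventually_elim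
      case (elim y)
      show ?case
      proof (cases "0 < y")
        case True
        then show ?thesis
          using s unfolding powr[OF True] powr[OF s]
          by (subst (1 2) ennreal_mult[symmetric]) (auto simp: powr_mult exp_minus field_simps)
      next
        case False
        then show ?thesis using elim s by (simp add: indicator_def zero_le_mult_iff)
      qed
    qed
  qed
  also have "\<dots> = ennreal ((s powr \<theta>) ^ j) * (\<integral>\<^sup>+y. ennreal (indicator {0..} y * (s * exp (- s * y)) * (y powr \<theta>) ^ j) \<partial>lborel)"
    by (rule nn_integral_cmult) simp
  finally have *: "ennreal (Gamma (1 + ?z)) = ennreal ((s powr \<theta>) ^ j) * (\<integral>\<^sup>+y. ennreal (indicator {0..} y * (s * exp (- s * y)) * (y powr \<theta>) ^ j) \<partial>lborel)" (is "_ = _ * ?I") .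
  have pos: "0 < (s powr \<theta>) ^ j" using s by (intro zero_less_power) simp
  have "ennreal (1 / (s powr \<theta>) ^ j) * ennreal (Gamma (1 + ?z)) = (ennreal (1 / (s powr \<theta>) ^ j) * ennreal ((s powr \<theta>) ^ j)) * ?I"
    unfolding * by (simp add: mult.assoc)
  also have "ennreal (1 / (s powr \<theta>) ^ j) * ennreal ((s powr \<theta>) ^ j) = 1"
    using s by (subst ennreal_mult[symmetric]) auto
  finally show ?thesis
    using pos \<theta> by (subst (asm) ennreal_mult[symmetric]) (auto intro!: Gamma_real_nonneg add_pos_nonneg)
qed

text \<open>Integration against \<open>s * exp (- s * y)\<close> turns term \<open>j\<close> of the
  Mittag-Leffler series into \<open>(- r) ^ j\<close> with \<open>r = l / s powr \<theta>\<close>.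
  The hypothesis \<open>lam < s\<close> gives \<open>r < 1\<close>, and the geometric sum yields
  \<open>1 - 1 / (1 + r)\<close>.\<close>

lemma laplace_mittag_leffler:
  assumes \<mu>: "real_distribution \<mu>" "AE x in \<mu>. 0 \<le> x"
    and \<theta>: "0 < \<theta>" and lam: "0 < lam"
    and cdf: "\<And>x. 0 \<le> x \<Longrightarrow> measure \<mu> {..x} = 1 - mittag_leffler \<theta> (- (lam powr \<theta> * x powr \<theta>))"
    and s: "lam < s"
  shows "(\<integral>x. exp (- s * x) \<partial>\<mu>) = lam powr \<theta> / (lam powr \<theta> + s powr \<theta>)"
proof -
  interpret real_distribution \<mu> by fact
  define l where "l = lam powr \<theta>"
  have l: "0 < l" using lam by (simp add: l_def)
  have s0: "0 < s" using lam s by simp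
  define r where "r = l / s powr \<theta>"
  have "l < s powr \<theta>" unfolding l_def using lam s \<theta> by (intro powr_less_mono2) auto
  then have r: "0 < r" "r < 1" using l s0 by (auto simp: r_def)
  define w where "w y = indicator {0..} y * (s * exp (- s * y))" for y :: real
  have w0: "0 \<le> w y" for y using s0 by (simp add: w_def)
  define K where "K j y = w y * ((- (l * y powr \<theta>)) ^ j / Gamma (1 + \<theta> * real j))" for j y
  have [measurable]: "w \<in> borel_measurable borel" "K j \<in> borel_measurable borel" for j
    unfolding K_def w_def by simp_all
  have G: "0 < Gamma (1 + \<theta> * real j)" for j using \<theta> by (intro Gamma_real_pos) (simp add: add_pos_nonneg)
  have absK: "\<bar>K j y\<bar> = l ^ j / Gamma (1 + \<theta> * real j) * (w y * (y powr \<theta>) ^ j)" for j y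
    using G[of j] w0[of y] l by (simp add: K_def abs_mult power_abs power_mult_distrib field_simps)
  have signK: "K j y = (- 1) ^ j * \<bar>K j y\<bar>" for j y
    by (subst absK) (simp add: K_def power_mult_distrib power_minus[of "l * y powr \<theta>"])
  have nnK: "(\<integral>\<^sup>+y. ennreal \<bar>K j y\<bar> \<partial>lborel) = ennreal (r ^ j)" for j
  proof -
    have "(\<integral>\<^sup>+y. ennreal \<bar>K j y\<bar> \<partial>lborel) = (\<integral>\<^sup>+y. ennreal (l ^ j / Gamma (1 + \<theta> * real j)) * ennreal (w y * (y powr \<theta>) ^ j) \<partial>lborel)"
      unfolding absK using l G[of j] w0 by (intro nn_integral_cong ennreal_mult) auto
    also have "\<dots> = ennreal (l ^ j / Gamma (1 + \<theta> * real j)) * ennreal (Gamma (1 + \<theta> * real j) / (s powr \<theta>) ^ j)"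
      using nn_integral_powr_exp[OF s0, of \<theta> j] \<theta> by (subst nn_integral_cmult) (auto simp: w_def)
    also have "\<dots> = ennreal (r ^ j)"
      using l G[of j] by (subst ennreal_mult[symmetric]) (auto simp: r_def power_divide field_simps)
    finally show ?thesis .
  qed
  have hK: "has_bochner_integral lborel (\<lambda>y. \<bar>K j y\<bar>) (r ^ j)" for j
    using nnK[of j] r by (intro has_bochner_integral_nn_integral) auto
  have iK: "integrable lborel (K j)" for j
    using hK[of j] by (intro integrable_norm_cancel[of _ "K j"]) (auto simp: has_bochner_integral_iff)
  have IK: "(\<integral>y. K j y \<partial>lborel) = (- r) ^ j" for j
  proof -
    have "(\<integral>y. K j y \<partial>lborel) = (\<integral>y. (- 1) ^ j * \<bar>K j y\<bar> \<partial>lborel)" using signK by metis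
    also have "\<dots> = (- 1) ^ j * r ^ j" using hK[of j] by (simp add: has_bochner_integral_iff)
    finally show ?thesis by (simp add: power_minus[of r])
  qed
  have "summable (\<lambda>j. r ^ j)" using r by (intro summable_geometric) auto
  \<comment> \<open>Finiteness of this integral serves twice: it permits the exchange of sum and
    integral, and it provides the convergence of the Mittag-Leffler series at almost every
    \<open>y \<ge> 0\<close>.\<close>
  have "(\<integral>\<^sup>+y. (\<Sum>j. ennreal \<bar>K j y\<bar>) \<partial>lborel) = (\<Sum>j. ennreal (r ^ j))"
    by (subst nn_integral_suminf) (auto simp: nnK)
  also have "\<dots> = ennreal (\<Sum>j. r ^ j)"
    by (rule suminf_ennreal2[OF _ \<open>summable (\<lambda>j. r ^ j)\<close>]) (use r in auto)
  also have "\<dots> < \<infinity>" by simp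
  finally have "AE y in lborel. (\<Sum>j. ennreal \<bar>K j y\<bar>) \<noteq> \<infinity>"
    by (intro nn_integral_PInf_AE) auto
  then have smK: "AE y in lborel. summable (\<lambda>j. norm (K j y))"
    by eventually_elim (auto intro!: summable_suminf_not_top)
  have sm: "summable (\<lambda>j. \<integral>y. norm (K j y) \<partial>lborel)"
    using hK \<open>summable (\<lambda>j. r ^ j)\<close> by (simp add: has_bochner_integral_iff)
  have mlf: "(\<Sum>j. K j y) = w y * mittag_leffler \<theta> (- (l * y powr \<theta>))" if "summable (\<lambda>j. norm (K j y))" for y
  proof (cases "w y = 0")
    case False
    let ?c = "\<lambda>j. (- (l * y powr \<theta>)) ^ j / Gamma (1 + \<theta> * real j)"
    have "summable (\<lambda>j. w y * ?c j)" using summable_norm_cancel[OF that] by (simp add: K_def)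
    then have "summable ?c" using summable_cmult_iff[of "w y" ?c] False by blast
    then show ?thesis unfolding K_def mittag_leffler_def by (rule suminf_mult)
  qed (simp add: K_def)
  have i_mlf: "integrable lborel (\<lambda>y. \<Sum>j. K j y)" and "(\<integral>y. (\<Sum>j. K j y) \<partial>lborel) = (\<Sum>j. \<integral>y. K j y \<partial>lborel)"
    using integrable_suminf[OF iK smK sm] integral_suminf[OF iK smK sm] by auto
  then have int_mlf: "(\<integral>y. (\<Sum>j. K j y) \<partial>lborel) = 1 / (1 + r)"
    using suminf_geometric[of "- r"] r by (simp add: IK)
  have Kw: "K 0 y = w y" for y by (simp add: K_def)
  have iw: "integrable lborel w" and Iw: "(\<integral>y. w y \<partial>lborel) = 1"
    using iK[of 0] IK[of 0] by (simp_all add: Kw[abs_def] Kw)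
  have eq: "AE y in lborel. w y - (\<Sum>j. K j y) = w y * measure \<mu> {..y}"
    using smK
  proof eventually_elim
    case (elim y)
    show ?case
    proof (cases "0 \<le> y")
      case True
      show ?thesis unfolding mlf[OF elim] cdf[OF True] l_def by (simp add: right_diff_distrib)
    next
      case False
      then have "w y = 0" by (simp add: w_def)
      then show ?thesis unfolding mlf[OF elim] by simp
    qed
  qed
  have m: "(\<lambda>y. w y * measure \<mu> {..y}) \<in> borel_measurable lborel"
    using borel_measurable_mono[OF monoI[OF cdf_nondecreasing]] by (simp add: cdf_def[abs_def])
  have "ennreal (\<integral>x. exp (- s * x) \<partial>\<mu>) = (\<integral>\<^sup>+y. ennreal (w y * measure \<mu> {..y}) \<partial>lborel)"
    unfolding w_def by (rule laplace_eq_integral_cdf[OF \<mu> s0])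
  also have "\<dots> = ennreal (\<integral>y. w y * measure \<mu> {..y} \<partial>lborel)"
  proof (rule nn_integral_eq_integral)
    have "integrable lborel (\<lambda>y. w y - (\<Sum>j. K j y))" using iw i_mlf by simp
    then show "integrable lborel (\<lambda>y. w y * measure \<mu> {..y})"
      using integrable_cong_AE[OF _ m eq] by (auto dest: borel_measurable_integrable)
  qed (use w0 in auto)
  also have "(\<integral>y. w y * measure \<mu> {..y} \<partial>lborel) = (\<integral>y. w y - (\<Sum>j. K j y) \<partial>lborel)"
    using eq m iw i_mlf by (intro integral_cong_AE) (auto elim: eventually_mono)
  also have "\<dots> = 1 - 1 / (1 + r)"
    using iw i_mlf Iw int_mlf by simp
  finally have "(\<integral>x. exp (- s * x) \<partial>\<mu>) = 1 - 1 / (1 + r)"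
    using r by (subst (asm) ennreal_inj) auto
  also have "\<dots> = l / (l + s powr \<theta>)"
    using r l s0 by (simp add: r_def field_simps)
  finally show ?thesis by (simp add: l_def)
qed

section \<open>Stable subordinators and their inverses\<close>

text \<open>Divergence makes the inverse finite, strict growth makes it continuous, and right
  continuity gives joint measurability in time and outcome.\<close>

definition regular_path :: "(real \<Rightarrow> real) \<Rightarrow> bool" where
  "regular_path x \<longleftrightarrow> x 0 = 0 \<and> strict_mono_on {0..} x \<and>
     (\<forall>t\<ge>0. (x \<longlongrightarrow> x t) (at_right t)) \<and> filterlim x at_top at_top"

text \<open>Strict growth upgrades \<open>x s \<le> t\<close> to a strict inequality through an
  intermediate time. Nothing is said at \<open>s = y t\<close>, where \<open>x\<close> may jump
  across the level \<open>t\<close>; the later arguments stay off that point.\<close>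

lemma regular_path_inverse:
  assumes x: "regular_path x" and t: "0 \<le> t"
  defines "y \<equiv> (\<lambda>t. Inf {s. s > 0 \<and> x s > t})"
  shows regular_path_inverse_below: "\<And>s. 0 \<le> s \<Longrightarrow> s < y t \<Longrightarrow> x s < t"
    and regular_path_inverse_above: "\<And>s. y t < s \<Longrightarrow> t < x s"
    and regular_path_inverse_nonneg: "0 \<le> y t"
proof -
  have mono: "strict_mono_on {0..} x" and x0: "x 0 = 0" using x by (auto simp: regular_path_def)
  have "\<forall>\<^sub>F s in at_top. t < x s \<and> 0 < s"
    using x by (intro eventually_conj eventually_gt_at_top) (auto simp: regular_path_def filterlim_at_top_dense)
  then obtain s0 where "s0 > 0" "x s0 > t"
    using eventually_happens'[of "at_top :: real filter"] by force
  then have ne: "{s. s > 0 \<and> x s > t} \<noteq> {}" by auto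
  show nn: "0 \<le> y t" unfolding y_def using ne by (intro cInf_greatest) auto
  have bdd: "bdd_below {s. s > 0 \<and> x s > t}" by (auto intro: bdd_belowI[of _ 0])
  have le: "x s \<le> t" if "0 \<le> s" "s < y t" for s
  proof (cases "s = 0")
    case False
    show ?thesis
    proof (rule ccontr)
      assume "\<not> x s \<le> t"
      then have "y t \<le> s" unfolding y_def using that False by (intro cInf_lower bdd) auto
      then show False using that by simp
    qed
  qed (simp add: x0 t)
  show "x s < t" if "0 \<le> s" "s < y t" for s
  proof -
    from dense[OF that(2)] obtain r where r: "s < r" "r < y t" by blast
    then have "x s < x r" using mono that by (auto intro: strict_mono_onD)
    also have "x r \<le> t" using r that by (intro le) auto
    finally show ?thesis .
  qed
  show "t < x s" if "y t < s" for s
  proof -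
    have "Inf {s. s > 0 \<and> x s > t} < s" using that by (simp add: y_def)
    then obtain r where "r > 0" "x r > t" "r < s"
      unfolding cInf_less_iff[OF ne bdd] by auto
    then show ?thesis using strict_mono_onD[OF mono, of r s] by auto
  qed
qed

text \<open>A jump of the inverse would require a flat stretch of \<open>x\<close>. Concretely,
  \<open>x r < t\<close> and \<open>t < x r\<close> are open conditions on \<open>t\<close>, and
  they keep the inverse on the respective side of \<open>r\<close>.\<close>

lemma regular_path_inverse_continuous:
  assumes x: "regular_path x"
  shows "continuous_on {0..} (\<lambda>t. Inf {s. s > 0 \<and> x s > t})"
proof -
  let ?y = "\<lambda>t. Inf {s. s > 0 \<and> x s > t}"
  note above = regular_path_inverse_above[OF x] and below = regular_path_inverse_below[OF x]
    and nonneg = regular_path_inverse_nonneg[OF x]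
  show ?thesis
    unfolding continuous_on_def
  proof (intro ballI order_tendstoI)
    fix t :: real and a assume t: "t \<in> {0..}" and a: "a < ?y t"
    show "\<forall>\<^sub>F t' in at t within {0..}. a < ?y t'"
    proof (cases "0 \<le> a")
      case True
      obtain r where r: "a < r" "r < ?y t" using dense[OF a] by blast
      have "x r < t" using r t True by (intro below) auto
      then have "\<forall>\<^sub>F t' in at t within {0..}. x r < t'"
        by (intro order_tendstoD(1)[OF tendsto_ident_at])
      moreover have "\<forall>\<^sub>F t' in at t within {0..}. t' \<in> {0..}"
        by (simp add: eventually_at_filter)
      ultimately show ?thesis
      proof eventually_elim
        case (elim t')
        then have "\<not> ?y t' < r" using above[of t' r] by auto
        then show ?case using r by linarith
      qed
    next
      case False
      have "\<forall>\<^sub>F t' in at t within {0..}. t' \<in> {0..}"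
        by (simp add: eventually_at_filter)
      then show ?thesis
      proof eventually_elim
        case (elim t')
        then show ?case using nonneg[of t'] False by auto
      qed
    qed
  next
    fix t :: real and a assume t: "t \<in> {0..}" and a: "?y t < a"
    obtain r where r: "?y t < r" "r < a" using dense[OF a] by blast
    have "t < x r" using r t by (intro above) auto
    then have "\<forall>\<^sub>F t' in at t within {0..}. t' < x r"
      by (intro order_tendstoD(2)[OF tendsto_ident_at])
    moreover have "\<forall>\<^sub>F t' in at t within {0..}. t' \<in> {0..}"
      by (simp add: eventually_at_filter)
    ultimately show "\<forall>\<^sub>F t' in at t within {0..}. ?y t' < a"
    proof eventually_elim
      case (elim t')
      have "0 \<le> r" using nonneg[of t] r t by auto
      then have "\<not> r < ?y t'" using below[of t' r] elim by auto
      then show ?case using r by linarith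
    qed
  qed
qed

text \<open>The path stays above \<open>t\<close> after the passage time, so a passage before
  \<open>a\<close> is visible at some rational time and countably many events suffice.\<close>

lemma inverse_process_measurable:
  assumes L: "\<And>s. L s \<in> borel_measurable M" and reg: "\<And>\<omega>. \<omega> \<in> space M \<Longrightarrow> regular_path (\<lambda>s. L s \<omega>)"
    and t: "0 \<le> t"
  shows "inverse_process L t \<in> borel_measurable M"
proof (rule borel_measurable_iff_less[THEN iffD2], rule allI)
  fix a
  note [measurable] = L
  have "inverse_process L t \<omega> < a \<longleftrightarrow> (\<exists>r\<in>\<rat>. 0 \<le> r \<and> r < a \<and> t < L r \<omega>)" if \<omega>: "\<omega> \<in> space M" for \<omega>
  proof
    assume less: "inverse_process L t \<omega> < a"
    then obtain r where r: "r \<in> \<rat>" "inverse_process L t \<omega> < r" "r < a"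
      using Rats_dense_in_real[OF less] by blast
    then show "\<exists>r\<in>\<rat>. 0 \<le> r \<and> r < a \<and> t < L r \<omega>"
      using regular_path_inverse_above[OF reg[OF \<omega>] t, of r] regular_path_inverse_nonneg[OF reg[OF \<omega>] t]
      by (intro bexI[of _ r]) (auto simp: inverse_process_def)
  next
    assume "\<exists>r\<in>\<rat>. 0 \<le> r \<and> r < a \<and> t < L r \<omega>"
    then obtain r where r: "0 \<le> r" "r < a" "t < L r \<omega>" by blast
    have "\<not> r < inverse_process L t \<omega>"
      using regular_path_inverse_below[OF reg[OF \<omega>] t, of r] r by (auto simp: inverse_process_def)
    then show "inverse_process L t \<omega> < a" using r by simp
  qed
  then have "{\<omega> \<in> space M. inverse_process L t \<omega> < a} = {\<omega> \<in> space M. \<exists>r\<in>\<rat>. 0 \<le> r \<and> r < a \<and> t < L r \<omega>}"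
    by blast
  also have "\<dots> \<in> sets M"
    using countable_rat by measurable
  finally show "{\<omega> \<in> space M. inverse_process L t \<omega> < a} \<in> sets M" .
qed

text \<open>Chernoff's bound: on the event, \<open>exp (t * (K - L s \<omega>))\<close> is at least
  1.\<close>

lemma stable_subordinator_tail:
  assumes L: "standard_stable_subordinator M \<alpha> L" and s: "0 \<le> s" and t: "0 \<le> t"
  shows "measure M {\<omega> \<in> space M. L s \<omega> \<le> K} \<le> exp (t * K) * exp (- s * t powr \<alpha>)"
proof -
  interpret prob_space M using L by (simp add: standard_stable_subordinator_def levy_process_def)
  have [measurable]: "L s \<in> borel_measurable M"
    using L s by (simp add: standard_stable_subordinator_def levy_process_def)
  have E: "(\<integral>\<omega>. exp (- t * L s \<omega>) \<partial>M) = exp (- s * t powr \<alpha>)"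
    using L s t by (auto simp: standard_stable_subordinator_def)
  \<comment> \<open>A function that is not integrable has integral 0 by convention, whereas this
    integral is an exponential.\<close>
  then have int: "integrable M (\<lambda>\<omega>. exp (- t * L s \<omega>))"
    by (metis exp_not_eq_zero not_integrable_integral_eq)
  have "measure M {\<omega> \<in> space M. L s \<omega> \<le> K} = (\<integral>\<omega>. indicator {\<omega> \<in> space M. L s \<omega> \<le> K} \<omega> \<partial>M)"
    by simp
  also have "\<dots> \<le> (\<integral>\<omega>. exp (t * K) * exp (- t * L s \<omega>) \<partial>M)"
  proof (rule integral_mono)
    show "indicator {\<omega> \<in> space M. L s \<omega> \<le> K} \<omega> \<le> exp (t * K) * exp (- t * L s \<omega>)" for \<omega>
      using t mult_left_mono[of "L s \<omega>" K t] by (auto simp: exp_add[symmetric] split: split_indicator)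
    show "integrable M (indicat_real {\<omega> \<in> space M. L s \<omega> \<le> K})"
      by (rule integrable_real_indicator) (auto simp: less_top[symmetric])
  qed (use int in \<open>auto intro!: integrable_mult_right\<close>)
  also have "\<dots> = exp (t * K) * exp (- s * t powr \<alpha>)" using E by simp
  finally show ?thesis .
qed

text \<open>Let \<open>t\<close> tend to infinity in the tail bound at level 0.\<close>

lemma stable_subordinator_pos:
  assumes L: "standard_stable_subordinator M \<alpha> L" and \<alpha>: "0 < \<alpha>" and h: "0 < h"
  shows "measure M {\<omega> \<in> space M. L h \<omega> \<le> 0} = 0"
proof -
  have "((\<lambda>t. exp (- h * t powr \<alpha>)) \<longlongrightarrow> 0) at_top"
    by (rule filterlim_compose[OF exp_at_bot],
        rule filterlim_tendsto_neg_mult_at_bot[OF tendsto_const])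
       (use h \<alpha> in \<open>auto intro: real_powr_at_top\<close>)
  moreover have "\<forall>\<^sub>F t in at_top. measure M {\<omega> \<in> space M. L h \<omega> \<le> 0} \<le> exp (- h * t powr \<alpha>)"
    using eventually_ge_at_top[of 0]
    by eventually_elim (use stable_subordinator_tail[OF L, of h _ 0] h in simp)
  ultimately have "measure M {\<omega> \<in> space M. L h \<omega> \<le> 0} \<le> 0"
    by (rule tendsto_lowerbound) simp
  then show ?thesis using measure_nonneg[of M "{\<omega> \<in> space M. L h \<omega> \<le> 0}"] by linarith
qed

text \<open>By stationarity the increment between rational times \<open>q < r\<close> has the law of
  \<open>L (r - q)\<close> and is almost surely positive; monotonicity extends this to real times
  with two rationals in between. For divergence, the tail bound with \<open>t = 1\<close> gives the
  event \<open>L n \<le> K\<close> probability at most \<open>exp K * exp (- n)\<close>.\<close>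

lemma stable_subordinator_AE_regular:
  assumes L: "standard_stable_subordinator M \<alpha> L" and \<alpha>: "0 < \<alpha>"
  shows "AE \<omega> in M. regular_path (\<lambda>s. L s \<omega>)"
proof -
  interpret prob_space M using L by (simp add: standard_stable_subordinator_def levy_process_def)
  have [measurable]: "L s \<in> borel_measurable M" if "0 \<le> s" for s
    using L that by (simp add: standard_stable_subordinator_def levy_process_def)
  have strict: "AE \<omega> in M. L q \<omega> < L r \<omega>" if qr: "0 \<le> q" "q < r" for q r
  proof -
    have [measurable]: "L q \<in> borel_measurable M" "L r \<in> borel_measurable M" "L (r - q) \<in> borel_measurable M"
      using qr by simp_all
    have "distr M borel (\<lambda>\<omega>. L (q + (r - q)) \<omega> - L q \<omega>) = distr M borel (L (r - q))"
      using L qr unfolding standard_stable_subordinator_def levy_process_def by (metis diff_ge_0_iff_ge less_imp_le)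
    then have "measure (distr M borel (\<lambda>\<omega>. L r \<omega> - L q \<omega>)) {..0} = measure (distr M borel (L (r - q))) {..0}"
      by simp
    then have "prob {\<omega> \<in> space M. L r \<omega> - L q \<omega> \<le> 0} = prob {\<omega> \<in> space M. L (r - q) \<omega> \<le> 0}"
      by (simp add: measure_distr vimage_def Int_def conj_commute)
    then have "prob {\<omega> \<in> space M. L r \<omega> - L q \<omega> \<le> 0} = 0"
      using stable_subordinator_pos[OF L \<alpha>] qr by simp
    then have "AE \<omega> in M. \<omega> \<notin> {\<omega> \<in> space M. L r \<omega> - L q \<omega> \<le> 0}"
      by (subst (asm) prob_eq_0) auto
    then show ?thesis by (rule AE_mp) (auto intro!: AE_I2)
  qed
  have "AE \<omega> in M. \<forall>q\<in>\<rat>. \<forall>r\<in>\<rat>. 0 \<le> q \<longrightarrow> q < r \<longrightarrow> L q \<omega> < L r \<omega>"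
    unfolding AE_ball_countable[OF countable_rat] using strict by (auto simp: AE_all_countable)
  moreover have "AE \<omega> in M. \<forall>K::nat. \<exists>n::nat. real K < L (real n) \<omega>"
    unfolding AE_all_countable
  proof
    fix K :: nat
    have [measurable]: "L (real n) \<in> borel_measurable M" for n by simp
    let ?A = "{\<omega> \<in> space M. \<forall>n::nat. L (real n) \<omega> \<le> real K}"
    have "prob ?A \<le> exp (real K) * exp (- real n)" for n :: nat
    proof -
      have "prob ?A \<le> prob {\<omega> \<in> space M. L (real n) \<omega> \<le> real K}" by (intro finite_measure_mono) auto
      also have "\<dots> \<le> exp (real K) * exp (- real n)"
        using stable_subordinator_tail[OF L, of "real n" 1 "real K"] by simp
      finally show ?thesis .
    qed
    moreover have "(\<lambda>n. exp (real K) * exp (- real n)) \<longlonglongrightarrow> exp (real K) * 0"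
      by (intro tendsto_mult tendsto_const filterlim_compose[OF exp_at_bot]
          filterlim_compose[OF filterlim_uminus_at_bot_at_top] filterlim_real_sequentially)
    ultimately have "prob ?A \<le> 0"
      by (intro tendsto_lowerbound[of "\<lambda>n. exp (real K) * exp (- real n)" _ sequentially]) auto
    then have "prob ?A = 0" using measure_nonneg[of M ?A] by linarith
    then have "AE \<omega> in M. \<omega> \<notin> ?A" by (subst (asm) prob_eq_0) auto
    then show "AE \<omega> in M. \<exists>n::nat. real K < L (real n) \<omega>"
      by (rule AE_mp) (auto intro!: AE_I2 simp: not_le)
  qed
  moreover have "AE \<omega> in M. L 0 \<omega> = 0" "AE \<omega> in M. cadlag (\<lambda>s. L s \<omega>)" "AE \<omega> in M. mono_on {0..} (\<lambda>s. L s \<omega>)"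
    using L by (auto simp: standard_stable_subordinator_def levy_process_def)
  ultimately show ?thesis
  proof eventually_elim
    case (elim \<omega>)
    have mono: "L s \<omega> \<le> L t \<omega>" if "0 \<le> s" "s \<le> t" for s t
      using elim(5) that by (auto simp: mono_on_def)
    have "strict_mono_on {0..} (\<lambda>s. L s \<omega>)"
    proof (rule strict_mono_onI)
      fix s t :: real assume st: "s \<in> {0..}" "t \<in> {0..}" "s < t"
      obtain q where q: "q \<in> \<rat>" "s < q" "q < t" using Rats_dense_in_real[OF st(3)] by blast
      obtain r where r: "r \<in> \<rat>" "q < r" "r < t" using Rats_dense_in_real[OF q(3)] by blast
      have "L s \<omega> \<le> L q \<omega>" "L r \<omega> \<le> L t \<omega>" using q r st by (auto intro!: mono)
      moreover have "L q \<omega> < L r \<omega>" using elim(1) q r st by auto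
      ultimately show "L s \<omega> < L t \<omega>" by linarith
    qed
    moreover have "filterlim (\<lambda>s. L s \<omega>) at_top at_top"
      unfolding filterlim_at_top_dense
    proof
      fix Z :: real
      obtain n :: nat where n: "real (nat \<lceil>Z\<rceil>) < L (real n) \<omega>" using elim(2) by blast
      then have "Z < L (real n) \<omega>" by linarith
      then show "\<forall>\<^sub>F s in at_top. Z < L s \<omega>"
        using mono[of "real n"] by (auto simp: eventually_at_top_linorder intro!: exI[of _ "real n"] intro: less_le_trans)
    qed
    ultimately show ?case using elim(3,4) by (auto simp: regular_path_def cadlag_def)
  qed
qed

text \<open>On the exceptional null set the path is replaced by the identity, which is regular, and
  negative times are frozen at 0. The measurability arguments can then use regularity at every
  outcome and \<open>L' s\<close> at every real \<open>s\<close>.\<close>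

lemma stable_subordinator_regular_version:
  assumes L: "standard_stable_subordinator M \<alpha> L" and \<alpha>: "0 < \<alpha>"
  obtains L' where "\<And>s. L' s \<in> borel_measurable M" "\<And>s. L' (max 0 s) = L' s" "\<And>\<omega>. \<omega> \<in> space M \<Longrightarrow> regular_path (\<lambda>s. L' s \<omega>)"
    "AE \<omega> in M. \<forall>s\<ge>0. L' s \<omega> = L s \<omega>"
proof -
  obtain N where N: "{\<omega> \<in> space M. \<not> regular_path (\<lambda>s. L s \<omega>)} \<subseteq> N" "N \<in> null_sets M"
    using stable_subordinator_AE_regular[OF L \<alpha>] unfolding eventually_ae_filter by blast
  have N_sets [measurable]: "N \<in> sets M" using N by auto
  have [measurable]: "L s \<in> borel_measurable M" if "0 \<le> s" for s
    using L that by (simp add: standard_stable_subordinator_def levy_process_def)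
  define L' where "L' s \<omega> = (if \<omega> \<in> N then max 0 s else L (max 0 s) \<omega>)" for s \<omega>
  show ?thesis
  proof (rule that[of L'])
    show "L' s \<in> borel_measurable M" for s
      unfolding L'_def by measurable
    show "L' (max 0 s) = L' s" for s by (simp add: L'_def fun_eq_iff)
    have "((\<lambda>s. max 0 s) \<longlongrightarrow> max 0 t) (at_right t)" for t :: real
      by (intro tendsto_intros)
    then have "((\<lambda>s. max 0 s) \<longlongrightarrow> t) (at_right t)" if "0 \<le> t" for t :: real
      using that by (metis max.absorb2)
    moreover have "filterlim (max 0 :: real \<Rightarrow> real) at_top at_top"
      by (rule filterlim_at_top_mono[OF filterlim_ident]) simp
    ultimately have id: "regular_path (max 0)"
      by (auto simp: regular_path_def strict_mono_on_def)
    show "regular_path (\<lambda>s. L' s \<omega>)" if \<omega>: "\<omega> \<in> space M" for \<omega>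
    proof (cases "\<omega> \<in> N")
      case False
      then have reg: "regular_path (\<lambda>s. L s \<omega>)" using N \<omega> by auto
      have eq: "L' s \<omega> = L s \<omega>" if "0 \<le> s" for s using that False by (simp add: L'_def)
      have "((\<lambda>s. L' s \<omega>) \<longlongrightarrow> L' t \<omega>) (at_right t)" if t: "0 \<le> t" for t
      proof (rule Lim_transform_eventually)
        show "((\<lambda>s. L s \<omega>) \<longlongrightarrow> L' t \<omega>) (at_right t)" using reg t eq by (simp add: regular_path_def)
        show "\<forall>\<^sub>F s in at_right t. L s \<omega> = L' s \<omega>"
          using t by (auto simp: eventually_at_filter eq)
      qed
      moreover have "filterlim (\<lambda>s. L' s \<omega>) at_top at_top"
      proof (subst filterlim_cong[OF refl refl])
        show "filterlim (\<lambda>s. L s \<omega>) at_top at_top" using reg by (simp add: regular_path_def)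
        show "\<forall>\<^sub>F s in at_top. L' s \<omega> = L s \<omega>"
          using eventually_ge_at_top[of 0] by eventually_elim (rule eq)
      qed
      ultimately show ?thesis using reg by (auto simp: regular_path_def strict_mono_on_def eq)
    qed (use id in \<open>simp add: L'_def\<close>)
    have "AE \<omega> in M. \<omega> \<notin> N" using N(2) by (rule AE_not_in)
    then show "AE \<omega> in M. \<forall>s\<ge>0. L' s \<omega> = L s \<omega>"
      by eventually_elim (simp add: L'_def)
  qed
qed

text \<open>Time is approximated strictly from the right by the grid points \<open>a n s\<close>,
  which take countably many values, and right continuity identifies the limit.\<close>

lemma regular_jointly_measurable:
  assumes L: "\<And>s. L s \<in> borel_measurable M" and reg: "\<And>\<omega>. \<omega> \<in> space M \<Longrightarrow> regular_path (\<lambda>s. L s \<omega>)"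
    and L0: "\<And>s. L (max 0 s) = L s"
  shows "(\<lambda>(\<omega>, s). L s \<omega>) \<in> borel_measurable (M \<Otimes>\<^sub>M borel)"
proof -
  define a where "a n s = (real_of_int \<lfloor>real (Suc n) * s\<rfloor> + 1) / real (Suc n)" for n and s :: real
  have a: "s < a n s" "a n s \<le> s + 1 / real (Suc n)" for n s
  proof -
    have fl: "real_of_int \<lfloor>real (Suc n) * s\<rfloor> \<le> real (Suc n) * s" "real (Suc n) * s < real_of_int \<lfloor>real (Suc n) * s\<rfloor> + 1"
      by linarith+
    show "s < a n s" using fl(2) by (simp add: a_def pos_less_divide_eq mult.commute del: of_nat_Suc)
    show "a n s \<le> s + 1 / real (Suc n)"
      using fl(1) unfolding a_def add_divide_distrib by (simp add: pos_divide_le_eq mult.commute del: of_nat_Suc)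
  qed
  have "(\<lambda>p. L (max 0 (snd p)) (fst p)) \<in> borel_measurable (M \<Otimes>\<^sub>M borel)"
  proof (rule borel_measurable_LIMSEQ_real)
    fix n
    note [measurable] = L
    have "(\<lambda>p. (\<lambda>i p. L ((real_of_int i + 1) / real (Suc n)) (fst p)) \<lfloor>real (Suc n) * max 0 (snd p)\<rfloor> p)
        \<in> borel_measurable (M \<Otimes>\<^sub>M (borel :: real measure))"
      by (rule measurable_compose_countable) measurable
    then show "(\<lambda>p. L (a n (max 0 (snd p))) (fst p)) \<in> borel_measurable (M \<Otimes>\<^sub>M borel)"
      by (simp add: a_def)
  next
    fix p assume p: "p \<in> space (M \<Otimes>\<^sub>M (borel :: real measure))"
    let ?s = "max 0 (snd p)"
    have "((\<lambda>s. L s (fst p)) \<longlongrightarrow> L ?s (fst p)) (at_right ?s)"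
      using reg[of "fst p"] p by (auto simp: regular_path_def space_pair_measure)
    moreover have "filterlim (\<lambda>n. a n ?s) (at_right ?s) sequentially"
      unfolding filterlim_at
    proof
      show "\<forall>\<^sub>F n in sequentially. a n ?s \<in> {?s<..} \<and> a n ?s \<noteq> ?s"
        using a(1)[of ?s] by (auto intro!: always_eventually simp: less_imp_neq[symmetric])
      show "(\<lambda>n. a n ?s) \<longlonglongrightarrow> ?s"
      proof (rule tendsto_sandwich[where f = "\<lambda>_. ?s" and h = "\<lambda>n. ?s + 1 / real (Suc n)"])
        show "(\<lambda>n. ?s + 1 / real (Suc n)) \<longlonglongrightarrow> ?s"
          using tendsto_add[OF tendsto_const[of ?s] LIMSEQ_inverse_real_of_nat] by (simp add: inverse_eq_divide)
        show "\<forall>\<^sub>F n in sequentially. ?s \<le> a n ?s" using a(1)[of ?s] by (intro always_eventually allI less_imp_le)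
        show "\<forall>\<^sub>F n in sequentially. a n ?s \<le> ?s + 1 / real (Suc n)" by (intro always_eventually allI a)
      qed simp
    qed
    ultimately show "(\<lambda>n. L (a n ?s) (fst p)) \<longlonglongrightarrow> L ?s (fst p)"
      by (rule filterlim_compose)
  qed
  then show ?thesis by (simp add: case_prod_beta' L0)
qed

section \<open>Sampling a subordinator at the points of a Poisson process\<close>

abbreviation exponential_law :: "real \<Rightarrow> real measure" where
  "exponential_law l \<equiv> density lborel (exponential_density l)"

lemma exponential_law_AE_pos: "0 < l \<Longrightarrow> AE x in exponential_law l. 0 < x"
proof -
  assume l: "0 < l"
  have "AE x in lborel. x \<noteq> (0::real)" by (rule AE_lborel_singleton)
  then show ?thesis
    by (subst AE_density) (auto elim!: eventually_mono simp: exponential_density_def)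
qed

text \<open>Multiplying the density of rate \<open>l\<close> by \<open>exp (- c * x)\<close> gives
  \<open>l / (l + c)\<close> times the density of rate \<open>l + c\<close>.\<close>

lemma exponential_law_laplace:
  assumes l: "0 < l" and c: "0 \<le> c"
  shows "(\<integral>x. exp (- c * x) \<partial>exponential_law l) = l / (l + c)"
proof -
  interpret P: prob_space "exponential_law (l + c)" using l c by (intro prob_space_exponential_density) simp
  have "(\<integral>x. exp (- c * x) \<partial>exponential_law l) = (\<integral>x. exponential_density l x *\<^sub>R exp (- c * x) \<partial>lborel)"
    using l by (intro integral_density) (auto simp: exponential_density_nonneg)
  also have "\<dots> = (\<integral>x. l / (l + c) * (exponential_density (l + c) x *\<^sub>R 1) \<partial>lborel)"
    using l c by (intro Bochner_Integration.integral_cong) (auto simp: exponential_density_def exp_add[symmetric] field_simps)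
  also have "\<dots> = l / (l + c) * (\<integral>x. exponential_density (l + c) x *\<^sub>R 1 \<partial>lborel)"
    by (rule integral_mult_right_zero)
  also have "(\<integral>x. exponential_density (l + c) x *\<^sub>R (1 :: real) \<partial>lborel) = (\<integral>x. 1 \<partial>exponential_law (l + c))"
    using l c by (subst integral_density) (auto simp: exponential_density_nonneg)
  also have "\<dots> = 1" using P.prob_space by simp
  finally show ?thesis by simp
qed

abbreviation exponential_sequence :: "real \<Rightarrow> (nat \<Rightarrow> real) measure" where
  "exponential_sequence l \<equiv> (\<Pi>\<^sub>M j\<in>UNIV. exponential_law l)"

lemma prob_space_exponential_sequence: "0 < l \<Longrightarrow> prob_space (exponential_sequence l)"
  by (intro prob_space_PiM prob_space_exponential_density)

lemma sets_exponential_sequence: "sets (exponential_sequence l) = sets (\<Pi>\<^sub>M j\<in>UNIV. borel)"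
  by (intro sets_PiM_cong) auto

lemma distr_exponential_sequence_component:
  assumes l: "0 < l"
  shows "distr (exponential_sequence l) borel (\<lambda>e. e j) = exponential_law l"
proof -
  have "distr (exponential_sequence l) borel (\<lambda>e. e j) = distr (exponential_sequence l) (exponential_law l) (\<lambda>e. e j)"
    by (intro distr_cong) auto
  also have "\<dots> = exponential_law l"
    using l by (intro distr_PiM_component prob_space_exponential_density) auto
  finally show ?thesis .
qed

lemma indep_vars_exponential_sequence:
  assumes l: "0 < l"
  shows "prob_space.indep_vars (exponential_sequence l) (\<lambda>_. borel) (\<lambda>j e. e j) UNIV"
proof -
  interpret prob_space "exponential_sequence l" by (rule prob_space_exponential_sequence[OF l])
  have [measurable]: "(\<lambda>e. e j) \<in> borel_measurable (exponential_sequence l)" for j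
    by (rule measurable_compose[OF measurable_component_singleton]) auto
  show ?thesis
  proof (subst indep_vars_iff_distr_eq_PiM)
    show "distr (exponential_sequence l) (\<Pi>\<^sub>M i\<in>UNIV. borel) (\<lambda>x. \<lambda>i\<in>UNIV. x i) =
        (\<Pi>\<^sub>M i\<in>UNIV. distr (exponential_sequence l) borel (\<lambda>e. e i))"
      unfolding distr_exponential_sequence_component[OF l]
      by (simp add: distr_id2[OF sets_exponential_sequence[symmetric]] restrict_UNIV)
  qed auto
qed

text \<open>\<open>arrival e (Suc k)\<close> is the time of the event with index \<open>k\<close>,
  whose class is \<open>C k\<close>; \<open>arrival e 0\<close> is the origin and no event. This
  explains the \<open>Suc\<close> in all later uses.\<close>

definition arrival :: "(nat \<Rightarrow> real) \<Rightarrow> nat \<Rightarrow> real" where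
  "arrival e k = (\<Sum>j<k. e j)"

lemma arrival_0 [simp]: "arrival e 0 = 0"
  and arrival_Suc: "arrival e (Suc k) = arrival e k + e k"
  by (simp_all add: arrival_def)

lemma exponential_arrival_strong_law:
  assumes l: "0 < l"
  shows "AE e in exponential_sequence l. (\<lambda>n. arrival e n / real n) \<longlonglongrightarrow> 1 / l"
proof -
  interpret prob_space "exponential_sequence l" by (rule prob_space_exponential_sequence[OF l])
  have [measurable]: "(\<lambda>e. e j) \<in> borel_measurable (exponential_sequence l)" for j
    by (rule measurable_compose[OF measurable_component_singleton]) auto
  have D: "distributed (exponential_sequence l) lborel (\<lambda>e. e j) (exponential_density l)" for j
    unfolding distributed_def
    using distr_exponential_sequence_component[OF l, of j] by (simp cong: distr_cong)
  show ?thesis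
    unfolding arrival_def
  proof (rule strong_law_nonneg[OF indep_vars_exponential_sequence[OF l]])
    show "AE e in exponential_sequence l. 0 \<le> e n" for n
      using exponential_law_AE_pos[OF l]
      by (intro AE_PiM_component prob_space_exponential_density l) (auto elim: eventually_mono)
    show "integrable (exponential_sequence l) (\<lambda>e. (e n)\<^sup>2)" for n
      by (rule erlang_ith_moment_integrable[OF l D])
    show "expectation (\<lambda>e. e n) = 1 / l" for n
      by (rule exponential_distributed_expectation[OF l D])
    show "variance (\<lambda>e. e n) \<le> 1 / l\<^sup>2" for n
      using exponential_distributed_variance[OF l D] by simp
  qed
qed

text \<open>The times are deterministic here; \<open>increments_law\<close> inserts random ones by
  conditioning. Stationarity makes each factor depend on one time difference only, so that
  independent gaps will factorise.\<close>

lemma stable_increments_prob: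
  assumes L: "standard_stable_subordinator M \<alpha> L"
    and L'_meas: "\<And>s. L' s \<in> borel_measurable M"
    and eq: "AE \<omega> in M. \<forall>s\<ge>0. L' s \<omega> = L s \<omega>"
    and t0: "0 \<le> t 0" and t: "\<And>j. j < n \<Longrightarrow> t j \<le> t (Suc j)"
    and A [measurable]: "\<And>j. A j \<in> sets borel"
  shows "measure M {\<omega> \<in> space M. \<forall>j<n. L' (t (Suc j)) \<omega> - L' (t j) \<omega> \<in> A j} =
    (\<Prod>j<n. measure M {\<omega> \<in> space M. L' (t (Suc j) - t j) \<omega> \<in> A j})"
proof -
  interpret prob_space M using L by (simp add: standard_stable_subordinator_def levy_process_def)
  note [measurable] = L'_meas
  have L_meas [measurable]: "L s \<in> borel_measurable M" if "0 \<le> s" for s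
    using L that by (simp add: standard_stable_subordinator_def levy_process_def)
  have tj: "0 \<le> t j" if "j \<le> n" for j
    using that
  proof (induction j)
    case (Suc j)
    then show ?case using t[of j] by simp
  qed (use t0 in simp)
  show ?thesis
  \<comment> \<open>The product formula for independent families asks for a nonempty index
    set.\<close>
  proof (cases "n = 0")
    case True
    then show ?thesis by (simp add: prob_space)
  next
    case False
    have [measurable]: "L (t j) \<in> borel_measurable M" if "j \<le> n" for j using tj[OF that] by simp
    have ind: "indep_vars (\<lambda>_. borel) (\<lambda>i \<omega>. L (t (Suc i)) \<omega> - L (t i) \<omega>) {..<n}"
      using L t t0 by (simp add: standard_stable_subordinator_def levy_process_def)
    have "{\<omega> \<in> space M. \<forall>j\<in>{..<n}. L (t (Suc j)) \<omega> - L (t j) \<omega> \<in> A j} \<in> sets M"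
    proof (rule sets.sets_Collect_finite_All')
      fix j assume "j \<in> {..<n}"
      then have [measurable]: "L (t (Suc j)) \<in> borel_measurable M" "L (t j) \<in> borel_measurable M" by auto
      show "{\<omega> \<in> space M. L (t (Suc j)) \<omega> - L (t j) \<omega> \<in> A j} \<in> sets M" by measurable
    qed (use False in auto)
    then have "measure M {\<omega> \<in> space M. \<forall>j<n. L' (t (Suc j)) \<omega> - L' (t j) \<omega> \<in> A j} =
        measure M {\<omega> \<in> space M. \<forall>j<n. L (t (Suc j)) \<omega> - L (t j) \<omega> \<in> A j}"
    proof (intro measure_eq_AE)
      show "AE \<omega> in M. \<omega> \<in> {\<omega> \<in> space M. \<forall>j<n. L' (t (Suc j)) \<omega> - L' (t j) \<omega> \<in> A j} \<longleftrightarrow>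
          \<omega> \<in> {\<omega> \<in> space M. \<forall>j<n. L (t (Suc j)) \<omega> - L (t j) \<omega> \<in> A j}"
        using eq
      proof eventually_elim
        case (elim \<omega>)
        then have "L' (t j) \<omega> = L (t j) \<omega>" if "j \<le> n" for j using tj[OF that] by simp
        then show ?case by auto
      qed
    qed (auto simp: lessThan_def Ball_def)
    also have "{\<omega> \<in> space M. \<forall>j<n. L (t (Suc j)) \<omega> - L (t j) \<omega> \<in> A j} =
        (\<Inter>i\<in>{..<n}. (\<lambda>\<omega>. L (t (Suc i)) \<omega> - L (t i) \<omega>) -` A i \<inter> space M)"
      using False by auto
    also have "measure M \<dots> = (\<Prod>i<n. prob ((\<lambda>\<omega>. L (t (Suc i)) \<omega> - L (t i) \<omega>) -` A i \<inter> space M))"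
      using False by (intro indep_varsD_finite[OF ind]) auto
    also have "\<dots> = (\<Prod>j<n. measure M {\<omega> \<in> space M. L' (t (Suc j) - t j) \<omega> \<in> A j})"
    proof (rule prod.cong)
      fix j assume "j \<in> {..<n}"
      then have j: "j < n" by simp
      define h where "h = t (Suc j) - t j"
      have h: "0 \<le> h" "t (Suc j) = t j + h" using t[OF j] by (auto simp: h_def)
      have [measurable]: "L (t j + h) \<in> borel_measurable M" "L (t j) \<in> borel_measurable M" "L h \<in> borel_measurable M"
        using tj[of j] h j by auto
      have "distr M borel (\<lambda>\<omega>. L (t j + h) \<omega> - L (t j) \<omega>) = distr M borel (L h)"
        using L h tj[of j] j unfolding standard_stable_subordinator_def levy_process_def by auto
      then have "measure (distr M borel (\<lambda>\<omega>. L (t j + h) \<omega> - L (t j) \<omega>)) (A j) = measure (distr M borel (L h)) (A j)"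
        by simp
      then have "prob ((\<lambda>\<omega>. L (t j + h) \<omega> - L (t j) \<omega>) -` A j \<inter> space M) = prob (L h -` A j \<inter> space M)"
        by (simp add: measure_distr)
      also have "\<dots> = measure M {\<omega> \<in> space M. L' h \<omega> \<in> A j}"
        using eq h by (intro measure_eq_AE) (auto elim!: eventually_mono)
      finally show "prob ((\<lambda>\<omega>. L (t (Suc j)) \<omega> - L (t j) \<omega>) -` A j \<inter> space M) =
          measure M {\<omega> \<in> space M. L' (t (Suc j) - t j) \<omega> \<in> A j}"
        by (simp add: h(2))
    qed simp
    finally show ?thesis .
  qed
qed

text \<open>Paths are built from \<open>L'\<close>, while the distributional facts are stated for
  \<open>L\<close> and reach \<open>L'\<close> through \<open>version\<close>. In the application
  \<open>l\<close> is \<open>lam powr \<alpha>\<close>.\<close>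

locale regular_stable_subordinator =
  fixes M :: "'b measure" and \<alpha> l :: real and L L' :: "real \<Rightarrow> 'b \<Rightarrow> real"
  assumes L: "standard_stable_subordinator M \<alpha> L" and l: "0 < l"
    and L'_meas [measurable]: "\<And>s. L' s \<in> borel_measurable M"
    and reg: "\<And>\<omega>. \<omega> \<in> space M \<Longrightarrow> regular_path (\<lambda>s. L' s \<omega>)"
    and L'_max: "\<And>s. L' (max 0 s) = L' s"
    and version: "AE \<omega> in M. \<forall>s\<ge>0. L' s \<omega> = L s \<omega>"
begin

sublocale prob_space M using L by (simp add: standard_stable_subordinator_def levy_process_def)

lemma L'_nonneg: "\<omega> \<in> space M \<Longrightarrow> 0 \<le> L' s \<omega>"
proof -
  assume "\<omega> \<in> space M"
  then have "L' 0 \<omega> \<le> L' (max 0 s) \<omega>" "L' 0 \<omega> = 0"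
    using reg[of \<omega>] strict_mono_on_leD[of "{0..}" "\<lambda>s. L' s \<omega>" 0 "max 0 s"] by (auto simp: regular_path_def)
  then show ?thesis by (simp add: L'_max)
qed

lemma L'_0: "\<omega> \<in> space M \<Longrightarrow> L' 0 \<omega> = 0"
  using reg[of \<omega>] by (simp add: regular_path_def)

lemma L'_joint: "(\<lambda>(\<omega>, s). L' s \<omega>) \<in> borel_measurable (M \<Otimes>\<^sub>M borel)"
  by (rule regular_jointly_measurable[of L' M, OF L'_meas reg L'_max])

lemma L'_joint_compose:
  assumes "f \<in> measurable N M" "g \<in> borel_measurable N"
  shows "(\<lambda>x. L' (g x) (f x)) \<in> borel_measurable N"
  using measurable_compose[OF measurable_Pair[OF assms] L'_joint] by simp

lemma L'_laplace:
  assumes "0 \<le> s" "0 \<le> t"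
  shows "(\<integral>\<omega>. exp (- t * L' s \<omega>) \<partial>M) = exp (- s * t powr \<alpha>)"
proof -
  have [measurable]: "L s \<in> borel_measurable M"
    using L assms by (simp add: standard_stable_subordinator_def levy_process_def)
  have "(\<integral>\<omega>. exp (- t * L' s \<omega>) \<partial>M) = (\<integral>\<omega>. exp (- t * L s \<omega>) \<partial>M)"
  proof (rule integral_cong_AE)
    show "AE \<omega> in M. exp (- t * L' s \<omega>) = exp (- t * L s \<omega>)"
      using version by eventually_elim (use assms in simp)
  qed auto
  also have "\<dots> = exp (- s * t powr \<alpha>)" using L assms by (simp add: standard_stable_subordinator_def)
  finally show ?thesis .
qed

lemma waiting_measurable [measurable]:
  "(\<lambda>p. L' (snd p / v) (fst p)) \<in> borel_measurable (M \<Otimes>\<^sub>M exponential_law l)"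
  by (rule L'_joint_compose) auto

text \<open>For \<open>v = u powr \<alpha>\<close> the law does not depend on \<open>u\<close>, by self-similarity.\<close>

definition waiting_law :: "real \<Rightarrow> real \<Rightarrow> real measure" where
  "waiting_law u v = distr (M \<Otimes>\<^sub>M exponential_law l) borel (\<lambda>p. u * L' (snd p / v) (fst p))"

lemma prob_space_pair: "prob_space N \<Longrightarrow> prob_space (M \<Otimes>\<^sub>M N)"
proof -
  assume "prob_space N"
  then interpret N: prob_space N .
  interpret pair_prob_space M N ..
  show ?thesis by (rule P.prob_space_axioms)
qed

lemma waiting_law_distribution: "real_distribution (waiting_law u v)"
proof -
  interpret pair: prob_space "M \<Otimes>\<^sub>M exponential_law l"
    using l by (intro prob_space_pair prob_space_exponential_density)
  show ?thesis
    unfolding waiting_law_def real_distribution_def real_distribution_axioms_def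
    by (intro conjI pair.prob_space_distr) auto
qed

lemma waiting_law_nonneg:
  assumes "0 \<le> u"
  shows "AE x in waiting_law u v. 0 \<le> x"
  unfolding waiting_law_def
  using assms by (subst AE_distr_iff) (auto intro!: AE_I2 mult_nonneg_nonneg L'_nonneg simp: space_pair_measure)

text \<open>For a fixed exponential time \<open>x\<close> the integral over \<open>M\<close> is
  \<open>exp (- (x / u powr \<alpha>) * (s * u) powr \<alpha>)\<close>, in which \<open>u\<close>
  cancels; the exponential law does the rest.\<close>

lemma waiting_law_laplace:
  assumes u: "0 < u" and s: "0 \<le> s"
  shows "(\<integral>x. exp (- s * x) \<partial>waiting_law u (u powr \<alpha>)) = l / (l + s powr \<alpha>)"
proof -
  interpret E: prob_space "exponential_law l" by (rule prob_space_exponential_density[OF l])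
  interpret pair_prob_space M "exponential_law l" ..
  let ?v = "u powr \<alpha>"
  have int: "integrable (M \<Otimes>\<^sub>M exponential_law l) (\<lambda>(\<omega>, x). exp (- (s * u) * L' (x / ?v) \<omega>))"
    unfolding case_prod_beta'
  proof (rule P.integrable_const_bound[of _ 1])
    show "AE p in M \<Otimes>\<^sub>M exponential_law l. norm (exp (- (s * u) * L' (snd p / ?v) (fst p))) \<le> 1"
      using s u by (intro AE_I2) (auto intro!: mult_nonneg_nonneg L'_nonneg simp: space_pair_measure)
  qed measurable
  have "(\<integral>x. exp (- s * x) \<partial>waiting_law u ?v) =
      integral\<^sup>L (M \<Otimes>\<^sub>M exponential_law l) (\<lambda>(\<omega>, x). exp (- (s * u) * L' (x / ?v) \<omega>))"
    unfolding waiting_law_def by (subst integral_distr) (auto simp: case_prod_beta' ac_simps)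
  also have "\<dots> = (\<integral>x. (\<integral>\<omega>. exp (- (s * u) * L' (x / ?v) \<omega>) \<partial>M) \<partial>exponential_law l)"
    by (rule integral_snd[symmetric, OF int])
  also have "\<dots> = (\<integral>x. exp (- (s powr \<alpha>) * x) \<partial>exponential_law l)"
  proof (rule integral_cong_AE)
    show "AE x in exponential_law l. (\<integral>\<omega>. exp (- (s * u) * L' (x / ?v) \<omega>) \<partial>M) = exp (- (s powr \<alpha>) * x)"
      using exponential_law_AE_pos[OF l]
    proof eventually_elim
      case (elim x)
      then show ?case using L'_laplace[of "x / ?v" "s * u"] u s by (simp add: powr_mult mult.commute)
    qed
    show "(\<lambda>x. \<integral>\<omega>. exp (- (s * u) * L' (x / ?v) \<omega>) \<partial>M) \<in> borel_measurable (exponential_law l)"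
      using borel_measurable_integrable[OF integrable_snd[OF int]] by simp
  qed auto
  also have "\<dots> = l / (l + s powr \<alpha>)" by (rule exponential_law_laplace[OF l]) simp
  finally show ?thesis .
qed

text \<open>Given the gaps \<open>e\<close>, the increments are independent and number
  \<open>j\<close> depends on \<open>e j\<close> only. Integrating the product of the conditional
  probabilities \<open>H j (e j)\<close> over independent gaps factorises it.\<close>

lemma increments_law:
  assumes v: "0 < v"
  shows "distr (M \<Otimes>\<^sub>M exponential_sequence l) (\<Pi>\<^sub>M j\<in>UNIV. borel)
      (\<lambda>p j. u * (L' (arrival (snd p) (Suc j) / v) (fst p) - L' (arrival (snd p) j / v) (fst p))) =
    (\<Pi>\<^sub>M j\<in>UNIV. waiting_law u v)"
proof -
  interpret E: prob_space "exponential_sequence l" by (rule prob_space_exponential_sequence[OF l])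
  interpret E1: prob_space "exponential_law l" by (rule prob_space_exponential_density[OF l])
  interpret Q: pair_prob_space M "exponential_sequence l" ..
  interpret Q1: pair_prob_space M "exponential_law l" ..
  interpret WL: real_distribution "waiting_law u v" by (rule waiting_law_distribution)
  interpret W: product_prob_space "\<lambda>_. waiting_law u v" "UNIV :: nat set" ..
  have comp [measurable]: "(\<lambda>e. e j) \<in> borel_measurable (exponential_sequence l)" for j
    by (rule measurable_compose[OF measurable_component_singleton]) auto
  have arr [measurable]: "(\<lambda>e. arrival e j) \<in> borel_measurable (exponential_sequence l)" for j
    unfolding arrival_def by measurable
  have [measurable]: "(\<lambda>p. L' (arrival (snd p) j / v) (fst p)) \<in> borel_measurable (M \<Otimes>\<^sub>M exponential_sequence l)" for j
    by (rule L'_joint_compose) measurable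
  let ?X = "\<lambda>p j. u * (L' (arrival (snd p) (Suc j) / v) (fst p) - L' (arrival (snd p) j / v) (fst p))"
  have X [measurable]: "?X \<in> measurable (M \<Otimes>\<^sub>M exponential_sequence l) (\<Pi>\<^sub>M j\<in>UNIV. borel)"
    by (rule measurable_PiM_single') (auto simp: PiE_def)
  show ?thesis
  proof (rule W.PiM_eq)
    show "sets (distr (M \<Otimes>\<^sub>M exponential_sequence l) (\<Pi>\<^sub>M j\<in>UNIV. borel) ?X) = sets (\<Pi>\<^sub>M j\<in>(UNIV::nat set). waiting_law u v)"
      by (simp add: waiting_law_def cong: sets_PiM_cong)
    fix J :: "nat set" and F assume J: "finite J" and F: "\<And>j. j \<in> J \<Longrightarrow> F j \<in> sets (waiting_law u v)"
    \<comment> \<open>Trivial constraints fill \<open>J\<close> up to an initial segment, so that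
      consecutive increments are covered; \<open>A\<close> below absorbs the factor
      \<open>u\<close>.\<close>
    define B where "B j = (if j \<in> J then F j else UNIV)" for j
    have B [measurable]: "B j \<in> sets borel" for j using F by (auto simp: B_def)
    define A where "A j = (\<lambda>x. u * x) -` B j" for j
    have A [measurable]: "A j \<in> sets borel" for j
      unfolding A_def using measurable_sets_borel[of "\<lambda>x. u * x" borel "B j"] by simp
    obtain n where n: "J \<subseteq> {..<n}" using finite_nat_iff_bounded[THEN iffD1, OF J] by blast
    define H where "H j x = emeasure M {\<omega> \<in> space M. L' (x / v) \<omega> \<in> A j}" for j x
    let ?S = "{p \<in> space (M \<Otimes>\<^sub>M exponential_sequence l). \<forall>j<n.
        L' (arrival (snd p) (Suc j) / v) (fst p) - L' (arrival (snd p) j / v) (fst p) \<in> A j}"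
    let ?S1 = "\<lambda>j. {p \<in> space (M \<Otimes>\<^sub>M exponential_law l). L' (snd p / v) (fst p) \<in> A j}"
    have S: "?S \<in> sets (M \<Otimes>\<^sub>M exponential_sequence l)" by measurable
    have S1: "?S1 j \<in> sets (M \<Otimes>\<^sub>M exponential_law l)" for j by measurable
    have H_slice: "H j x = emeasure M ((\<lambda>\<omega>. (\<omega>, x)) -` ?S1 j)" for j x
      unfolding H_def by (intro arg_cong2[of _ _ _ _ emeasure] refl) (auto simp: space_pair_measure)
    have H_meas [measurable]: "H j \<in> borel_measurable borel" for j
      using Q1.measurable_emeasure_Pair2[OF S1[of j]] unfolding H_slice[abs_def] by simp
    have "emeasure (distr (M \<Otimes>\<^sub>M exponential_sequence l) (\<Pi>\<^sub>M j\<in>UNIV. borel) ?X)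
        (prod_emb UNIV (\<lambda>_. waiting_law u v) J (\<Pi>\<^sub>E j\<in>J. F j)) = emeasure (M \<Otimes>\<^sub>M exponential_sequence l) ?S"
    proof (subst emeasure_distr[OF X])
      have eq: "prod_emb UNIV (\<lambda>_. waiting_law u v) J (\<Pi>\<^sub>E j\<in>J. F j) = prod_emb UNIV (\<lambda>_. borel) J (\<Pi>\<^sub>E j\<in>J. F j)"
        by (simp add: prod_emb_def waiting_law_def)
      show "prod_emb UNIV (\<lambda>_. waiting_law u v) J (\<Pi>\<^sub>E j\<in>J. F j) \<in> sets (\<Pi>\<^sub>M j\<in>UNIV. borel)"
        unfolding eq using J F by (intro sets_PiM_I) auto
      have "?X -` prod_emb UNIV (\<lambda>_. waiting_law u v) J (\<Pi>\<^sub>E j\<in>J. F j) \<inter> space (M \<Otimes>\<^sub>M exponential_sequence l) = ?S"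
        using n by (auto simp: prod_emb_def PiE_def Pi_def A_def B_def extensional_def restrict_def waiting_law_def)
      then show "emeasure (M \<Otimes>\<^sub>M exponential_sequence l)
          (?X -` prod_emb UNIV (\<lambda>_. waiting_law u v) J (\<Pi>\<^sub>E j\<in>J. F j) \<inter> space (M \<Otimes>\<^sub>M exponential_sequence l)) =
          emeasure (M \<Otimes>\<^sub>M exponential_sequence l) ?S" by (rule arg_cong)
    qed
    also have "\<dots> = (\<integral>\<^sup>+e. emeasure M ((\<lambda>\<omega>. (\<omega>, e)) -` ?S) \<partial>exponential_sequence l)"
      by (rule Q.emeasure_pair_measure_alt2[OF S])
    also have "\<dots> = (\<integral>\<^sup>+e. (\<Prod>j<n. H j (e j)) \<partial>exponential_sequence l)"
    proof (rule nn_integral_cong_AE)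
      have "AE e in exponential_sequence l. 0 \<le> e j" for j
        using exponential_law_AE_pos[OF l]
        by (intro AE_PiM_component prob_space_exponential_density l) (auto elim: eventually_mono)
      then have "AE e in exponential_sequence l. \<forall>j. 0 \<le> e j" by (simp add: AE_all_countable)
      then show "AE e in exponential_sequence l. emeasure M ((\<lambda>\<omega>. (\<omega>, e)) -` ?S) = (\<Prod>j<n. H j (e j))"
        using AE_space
      proof eventually_elim
        case (elim e)
        have diff: "arrival e (Suc j) / v - arrival e j / v = e j / v" for j
          by (simp add: arrival_Suc add_divide_distrib)
        have "(\<lambda>\<omega>. (\<omega>, e)) -` ?S = {\<omega> \<in> space M. \<forall>j<n. L' (arrival e (Suc j) / v) \<omega> - L' (arrival e j / v) \<omega> \<in> A j}"
          using elim by (auto simp: space_pair_measure)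
        also have "emeasure M \<dots> = ennreal (\<Prod>j<n. measure M {\<omega> \<in> space M.
            L' (arrival e (Suc j) / v - arrival e j / v) \<omega> \<in> A j})"
          unfolding emeasure_eq_measure
          by (subst stable_increments_prob[OF L L'_meas version])
             (use elim v in \<open>auto simp: arrival_Suc divide_right_mono\<close>)
        also have "\<dots> = ennreal (\<Prod>j<n. measure M {\<omega> \<in> space M. L' (e j / v) \<omega> \<in> A j})"
          unfolding diff ..
        also have "\<dots> = (\<Prod>j<n. H j (e j))"
          by (simp add: H_def emeasure_eq_measure prod_ennreal)
        finally show ?case .
      qed
    qed
    also have "\<dots> = (\<Prod>j<n. \<integral>\<^sup>+e. H j (e j) \<partial>exponential_sequence l)"
      by (rule E.indep_vars_nn_integral)
         (auto intro!: E.indep_vars_compose2[OF E.indep_vars_subset[OF indep_vars_exponential_sequence[OF l]]])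
    also have "\<dots> = (\<Prod>j<n. emeasure (waiting_law u v) (B j))"
    proof (rule prod.cong)
      fix j
      have "(\<integral>\<^sup>+e. H j (e j) \<partial>exponential_sequence l) = (\<integral>\<^sup>+x. H j x \<partial>distr (exponential_sequence l) borel (\<lambda>e. e j))"
        by (subst nn_integral_distr) auto
      also have "\<dots> = (\<integral>\<^sup>+x. emeasure M ((\<lambda>\<omega>. (\<omega>, x)) -` ?S1 j) \<partial>exponential_law l)"
        unfolding distr_exponential_sequence_component[OF l] H_slice ..
      also have "\<dots> = emeasure (M \<Otimes>\<^sub>M exponential_law l) (?S1 j)"
        by (rule Q1.emeasure_pair_measure_alt2[OF S1, symmetric])
      also have "\<dots> = emeasure (waiting_law u v) (B j)"
        unfolding waiting_law_def
        by (subst emeasure_distr) (auto intro!: arg_cong2[of _ _ _ _ emeasure] simp: A_def)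
      finally show "(\<integral>\<^sup>+e. H j (e j) \<partial>exponential_sequence l) = emeasure (waiting_law u v) (B j)" .
    qed simp
    also have "\<dots> = (\<Prod>j\<in>J. emeasure (waiting_law u v) (F j))"
      using n WL.emeasure_space_1 by (intro prod.mono_neutral_cong_right) (auto simp: B_def)
    finally show "emeasure (distr (M \<Otimes>\<^sub>M exponential_sequence l) (\<Pi>\<^sub>M j\<in>UNIV. borel) ?X)
        (prod_emb UNIV (\<lambda>_. waiting_law u v) J (\<Pi>\<^sub>E j\<in>J. F j)) = (\<Prod>j\<in>J. emeasure (waiting_law u v) (F j))" .
  qed
qed

end

section \<open>Almost sure convergence of the coupled paths\<close>

lemma arrival_less: "(\<And>j. 0 < e j) \<Longrightarrow> j < k \<Longrightarrow> arrival e j < arrival e k"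
  by (rule lift_Suc_mono_less[of "arrival e"]) (auto simp: arrival_Suc)

lemma arrival_strict_mono: "(\<And>j. 0 < e j) \<Longrightarrow> strict_mono (arrival e)"
  by (auto intro!: strict_monoI arrival_less)

lemma arrival_unbounded:
  assumes "0 < l" "(\<lambda>n. arrival e n / real n) \<longlonglongrightarrow> 1 / l"
  shows "filterlim (arrival e) at_top sequentially"
proof -
  have "filterlim (\<lambda>n. (arrival e n / real n) * real n) at_top sequentially"
    by (rule filterlim_tendsto_pos_mult_at_top[OF assms(2)])
       (use assms(1) in \<open>auto intro: filterlim_real_sequentially\<close>)
  moreover have "\<forall>\<^sub>F n in sequentially. (arrival e n / real n) * real n = arrival e n"
    using eventually_gt_at_top[of 0] by eventually_elim simp
  ultimately show ?thesis by (simp add: filterlim_cong)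
qed

lemma finite_arrivals:
  assumes lim: "filterlim (arrival e) at_top sequentially"
  shows "finite {k. arrival e (Suc k) \<le> t}"
proof -
  have "\<forall>\<^sub>F k in sequentially. t < arrival e k"
    using lim by (simp add: filterlim_at_top_dense)
  then obtain n where "\<And>k. n \<le> k \<Longrightarrow> t < arrival e k" by (auto simp: eventually_sequentially)
  then have "{k. arrival e (Suc k) \<le> t} \<subseteq> {..<n}" by (auto simp: not_le[symmetric] not_less)
  then show ?thesis by (rule finite_subset) simp
qed

text \<open>Links \<open>Max\<close> in the definition of the process to a count of events: the set
  under \<open>Max\<close> contains 0 for the origin, so event \<open>k\<close> has occurred iff
  \<open>Suc k\<close> belongs to it. Divergence makes the set finite, without which
  \<open>Max\<close> would be meaningless.\<close>

lemma arrivals_initial_segment: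
  assumes e: "\<And>j. 0 < e j" and lim: "filterlim (arrival e) at_top sequentially" and t: "0 \<le> t"
  shows "{k. arrival e (Suc k) \<le> t} = {..<Max {n. (\<Sum>j<n. e j) \<le> t}}"
proof -
  let ?A = "{n. arrival e n \<le> t}"
  note mono = strict_mono_less_eq[OF arrival_strict_mono[of e, OF e]]
  have "finite (Suc ` {k. arrival e (Suc k) \<le> t})" using finite_arrivals[OF lim] by simp
  moreover have "?A \<subseteq> insert 0 (Suc ` {k. arrival e (Suc k) \<le> t})"
  proof
    fix n assume "n \<in> ?A"
    then show "n \<in> insert 0 (Suc ` {k. arrival e (Suc k) \<le> t})" by (cases n) auto
  qed
  ultimately have fin: "finite ?A" using finite_subset by blast
  have "0 \<in> ?A" using t by simp
  then have max: "Max ?A \<in> ?A" using Max_in[OF fin] by blast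
  have "n \<in> ?A \<longleftrightarrow> n \<le> Max ?A" for n
  proof
    assume "n \<le> Max ?A"
    then have "arrival e n \<le> arrival e (Max ?A)" by (simp add: mono)
    then show "n \<in> ?A" using max by simp
  qed (use fin in simp)
  then have "arrival e (Suc k) \<le> t \<longleftrightarrow> k < Max ?A" for k using Suc_le_eq by blast
  then have "{k. arrival e (Suc k) \<le> t} = {..<Max ?A}" unfolding lessThan_def by blast
  then show ?thesis by (simp add: arrival_def)
qed

text \<open>The elementary renewal argument: \<open>x\<close> lies between arrivals number
  \<open>m x\<close> and \<open>Suc (m x)\<close>, hence \<open>x / m x\<close> tends to
  \<open>1 / l\<close>; the class frequencies are then taken along \<open>m x\<close>.\<close>

lemma scaled_arrival_count_limit:
  assumes e: "\<And>j. 0 < e j" and l: "0 < l" and lim: "(\<lambda>n. arrival e n / real n) \<longlonglongrightarrow> 1 / l"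
    and label: "(\<lambda>n. real (card {k. k < n \<and> c k = i}) / real n) \<longlonglongrightarrow> q"
    and y: "0 \<le> y"
  shows "((\<lambda>v. real (card {k. arrival e (Suc k) \<le> v * y \<and> c k = i}) / v) \<longlongrightarrow> l * q * y) at_top"
proof -
  note unbdd = arrival_unbounded[OF l lim]
  define m where "m x = Max {n. (\<Sum>j<n. e j) \<le> x}" for x
  have m: "{k. arrival e (Suc k) \<le> x} = {..<m x}" if "0 \<le> x" for x
    unfolding m_def by (rule arrivals_initial_segment[OF e unbdd that])
  have iff: "arrival e (Suc k) \<le> x \<longleftrightarrow> k < m x" if "0 \<le> x" for k x
    using m[OF that] by auto
  have bounds: "arrival e (m x) \<le> x" "x < arrival e (Suc (m x))" if "0 \<le> x" for x
  proof -
    show "arrival e (m x) \<le> x"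
    proof (cases "m x")
      case (Suc k)
      then show ?thesis using iff[OF that, of k] by simp
    qed (use that in simp)
    show "x < arrival e (Suc (m x))" using iff[OF that, of "m x"] by simp
  qed
  have m_lim: "filterlim m at_top at_top"
    unfolding filterlim_at_top
  proof
    fix Z
    show "\<forall>\<^sub>F x in at_top. Z \<le> m x"
      using eventually_ge_at_top[of "max 0 (arrival e (Suc Z))"]
      by eventually_elim (use iff in \<open>auto intro: less_imp_le\<close>)
  qed
  have ratio: "((\<lambda>x. x / real (m x)) \<longlongrightarrow> 1 / l) at_top"
  proof (rule tendsto_sandwich)
    show "((\<lambda>x. arrival e (m x) / real (m x)) \<longlongrightarrow> 1 / l) at_top"
      by (rule filterlim_compose[OF lim m_lim])
    have "(\<lambda>n. arrival e (Suc n) / real (Suc n) * (real (Suc n) / real n)) \<longlonglongrightarrow> 1 / l * 1"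
      by (intro tendsto_mult LIMSEQ_Suc[OF lim] LIMSEQ_Suc_n_over_n)
    from filterlim_compose[OF this m_lim]
    show "((\<lambda>x. arrival e (Suc (m x)) / real (Suc (m x)) * (real (Suc (m x)) / real (m x))) \<longlongrightarrow> 1 / l) at_top"
      by (simp del: of_nat_Suc)
    show "\<forall>\<^sub>F x in at_top. arrival e (m x) / real (m x) \<le> x / real (m x)"
      using eventually_ge_at_top[of 0] by eventually_elim (intro divide_right_mono bounds; simp)
    show "\<forall>\<^sub>F x in at_top. x / real (m x) \<le> arrival e (Suc (m x)) / real (Suc (m x)) * (real (Suc (m x)) / real (m x))"
      using eventually_ge_at_top[of 0]
    proof eventually_elim
      case (elim x)
      have "arrival e (Suc (m x)) / real (Suc (m x)) * (real (Suc (m x)) / real (m x)) = arrival e (Suc (m x)) / real (m x)"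
        by (simp del: of_nat_Suc)
      then show ?case using bounds(2)[OF elim] by (simp add: divide_right_mono)
    qed
  qed
  have "((\<lambda>x. (real (card {k. k < m x \<and> c k = i}) / real (m x)) / (x / real (m x))) \<longlongrightarrow> q / (1 / l)) at_top"
    using l by (intro tendsto_divide filterlim_compose[OF label m_lim] ratio) auto
  moreover have "\<forall>\<^sub>F x in at_top. (real (card {k. k < m x \<and> c k = i}) / real (m x)) / (x / real (m x)) =
      real (card {k. arrival e (Suc k) \<le> x \<and> c k = i}) / x"
    using eventually_ge_at_top[of 0] eventually_compose_filterlim[OF eventually_gt_at_top[of 0] m_lim]
    by eventually_elim (simp add: iff)
  ultimately have base: "((\<lambda>x. real (card {k. arrival e (Suc k) \<le> x \<and> c k = i}) / x) \<longlongrightarrow> q / (1 / l)) at_top"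
    by (rule Lim_transform_eventually)
  show ?thesis
  \<comment> \<open>For \<open>y = 0\<close> the argument \<open>v * y\<close> does not tend to
    infinity, but no event has occurred by time 0.\<close>
  proof (cases "y = 0")
    case True
    have none: "{k. arrival e (Suc k) \<le> 0 \<and> c k = i} = {}"
      using arrival_less[of e 0, OF e] by (auto simp: not_le)
    have zero: "real (card {k. arrival e (Suc k) \<le> v * y \<and> c k = i}) / v = 0" for v
      unfolding True mult_zero_right none by simp
    show ?thesis unfolding zero by (simp add: True)
  next
    case False
    then have y: "0 < y" using y by simp
    have "filterlim (\<lambda>v. v * y) at_top at_top"
      by (rule filterlim_at_top_mult_tendsto_pos[OF tendsto_const y filterlim_ident])
    from tendsto_mult[OF filterlim_compose[OF base this] tendsto_const[of y]]
    show ?thesis using y by (simp add: field_simps)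
  qed
qed

text \<open>The scale is \<open>max 1 u\<close> rather than \<open>u\<close> so that the paths are in the space for every real \<open>u\<close>.\<close>

lemma coupled_path_limit:
  fixes c :: "nat \<Rightarrow> 'k::finite" and q :: "real ^ 'k"
  assumes x: "regular_path x" and e: "\<And>j. 0 < e j" and l: "0 < l" and \<alpha>: "0 < \<alpha>"
    and lim: "(\<lambda>n. arrival e n / real n) \<longlonglongrightarrow> 1 / l"
    and label: "\<And>i. (\<lambda>n. real (card {k. k < n \<and> c k = i}) / real n) \<longlonglongrightarrow> q $ i"
    and paths: "\<And>u. jump_path (max 1 u powr (- \<alpha>)) (\<lambda>k. x (arrival e (Suc k) / max 1 u powr \<alpha>)) c \<in> skorokhod_space"
    and fin: "\<And>u t. finite {k. x (arrival e (Suc k) / max 1 u powr \<alpha>) \<le> t}"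
  shows "limitin skorokhod_J1
    (\<lambda>u. jump_path (max 1 u powr (- \<alpha>)) (\<lambda>k. x (arrival e (Suc k) / max 1 u powr \<alpha>)) c)
    (\<lambda>t\<in>{0..}. (l * Inf {s. s > 0 \<and> x s > t}) *\<^sub>R q) at_top"
proof -
  define y where "y t = Inf {s. s > 0 \<and> x s > t}" for t
  have below: "\<And>s. 0 \<le> s \<Longrightarrow> s < y t \<Longrightarrow> x s < t" and above: "\<And>s. y t < s \<Longrightarrow> t < x s"
    and y0: "0 \<le> y t" if "0 \<le> t" for t
    using regular_path_inverse[OF x that] unfolding y_def by blast+
  have y_cont: "continuous_on {0..} y"
    using regular_path_inverse_continuous[OF x] by (simp add: y_def[abs_def])
  have arr0: "0 < arrival e (Suc k)" for k using arrival_less[of e 0 "Suc k", OF e] by simp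
  define v where "v u = max 1 u powr \<alpha>" for u :: real
  have v: "0 < v u" for u by (simp add: v_def)
  have v_inv: "max 1 u powr (- \<alpha>) = 1 / v u" for u by (simp add: v_def powr_minus_divide)
  have "filterlim (\<lambda>u. u powr \<alpha>) at_top at_top" by (rule real_powr_at_top[OF \<alpha>])
  then have v_lim: "filterlim v at_top at_top"
    by (rule filterlim_at_top_mono) (use \<alpha> in \<open>auto simp: v_def intro!: eventually_mono[OF eventually_ge_at_top[of 0]] powr_mono2\<close>)
  define f where "f i u t = real (card {k. x (arrival e (Suc k) / v u) \<le> t \<and> c k = i}) / v u" for i u t
  have fin': "finite {k. x (arrival e (Suc k) / v u) \<le> t \<and> c k = i}" for u t i
    by (rule finite_subset[OF _ fin[of u t]]) (auto simp: v_def)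
  note unbdd = arrival_unbounded[OF l lim]
  have f_lim: "((\<lambda>u. f i u t) \<longlongrightarrow> l * q $ i * y t) at_top" if t: "0 \<le> t" for i t
  proof -
    \<comment> \<open>\<open>G z u\<close> counts the Poisson points up to \<open>v u * z\<close>.
      It bounds \<open>f i u t\<close> from above at \<open>z = y t\<close>, but from below only for
      \<open>z < y t\<close>, since \<open>x\<close> may already exceed \<open>t\<close> at the
      passage time.\<close>
    define G where "G z u = real (card {k. arrival e (Suc k) \<le> v u * z \<and> c k = i}) / v u" for z u
    have G: "((\<lambda>u. G z u) \<longlongrightarrow> l * q $ i * z) at_top" if "0 \<le> z" for z
      unfolding G_def by (rule filterlim_compose[OF scaled_arrival_count_limit[OF e l lim label that] v_lim])
    have upper: "f i u t \<le> G (y t) u" for u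
    proof -
      have "x (arrival e (Suc k) / v u) \<le> t \<Longrightarrow> arrival e (Suc k) \<le> v u * y t" for k
      proof -
        assume "x (arrival e (Suc k) / v u) \<le> t"
        then have "\<not> y t < arrival e (Suc k) / v u" using above[OF t, of "arrival e (Suc k) / v u"] by linarith
        then show ?thesis using v[of u] by (simp add: not_less pos_divide_le_eq mult.commute)
      qed
      then show ?thesis
        unfolding f_def G_def using v[of u]
        by (intro divide_right_mono of_nat_mono card_mono finite_subset[OF _ finite_arrivals[OF unbdd, of "v u * y t"]]) auto
    qed
    have lower: "G z u \<le> f i u t" if z: "0 \<le> z" "z < y t" for z u
    proof -
      have "arrival e (Suc k) \<le> v u * z \<Longrightarrow> x (arrival e (Suc k) / v u) \<le> t" for k
      proof -
        assume "arrival e (Suc k) \<le> v u * z"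
        then have "arrival e (Suc k) / v u \<le> z" using v[of u] by (simp add: pos_divide_le_eq mult.commute)
        then have "x (arrival e (Suc k) / v u) < t"
          using z arr0[of k] v[of u] by (intro below[OF t]) auto
        then show ?thesis by simp
      qed
      then show ?thesis
        unfolding f_def G_def using v[of u] fin'[of u t i]
        by (intro divide_right_mono of_nat_mono card_mono) auto
    qed
    show ?thesis
    proof (rule order_tendstoI)
      fix a assume a: "l * q $ i * y t < a"
      show "\<forall>\<^sub>F u in at_top. f i u t < a"
        using order_tendstoD(2)[OF G[OF y0[OF t]] a] by eventually_elim (rule le_less_trans[OF upper])
    next
      fix a assume a: "a < l * q $ i * y t"
      show "\<forall>\<^sub>F u in at_top. a < f i u t"
      proof (cases "a < 0")
        case True
        have "0 \<le> f i u t" for u using v[of u] by (simp add: f_def)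
        then show ?thesis using True by (intro always_eventually allI) (rule less_le_trans[of a 0])
      next
        case False
        \<comment> \<open>With \<open>a \<ge> 0\<close> below the limit, \<open>b\<close> must be
          positive, and any \<open>z\<close> strictly between \<open>a / b\<close> and
          \<open>y t\<close> makes the lower bound exceed \<open>a\<close>; the midpoint is
          taken.\<close>
        define b where "b = l * q $ i"
        have b: "0 < b"
        proof (rule ccontr)
          assume "\<not> 0 < b"
          then have "b * y t \<le> 0" using y0[OF t] by (simp add: mult_nonpos_nonneg)
          then show False using a False by (simp add: b_def)
        qed
        define z where "z = (a / b + y t) / 2"
        have ab: "a / b < y t" using a b by (simp add: b_def pos_divide_less_eq mult.commute)
        have "0 \<le> a / b" using b False by simp
        have mid: "0 \<le> (r + s) / 2 \<and> (r + s) / 2 < s \<and> r < (r + s) / 2" if "0 \<le> r" "r < s" for r s :: real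
          using that by auto
        have z: "0 \<le> z" "z < y t" "a / b < z" using mid[OF \<open>0 \<le> a / b\<close> ab] by (simp_all only: z_def)
        have "a < l * q $ i * z" using z(3) b by (simp add: b_def pos_divide_less_eq mult.commute)
        from order_tendstoD(1)[OF G[OF z(1)] this] show ?thesis
          by eventually_elim (rule less_le_trans[OF _ lower[OF z(1,2)]])
      qed
    qed
  qed
  have f_mono: "mono_on {0..} (f i u)" for i u
    unfolding f_def using v[of u] fin'[of u]
    by (intro mono_onI divide_right_mono of_nat_mono card_mono) auto
  have "limitin skorokhod_J1
    (\<lambda>u. jump_path (max 1 u powr (- \<alpha>)) (\<lambda>k. x (arrival e (Suc k) / max 1 u powr \<alpha>)) c)
    (\<lambda>t\<in>{0..}. (l * y t) *\<^sub>R q) at_top"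
  proof (rule skorokhod_limit_uniformI)
    show "(\<lambda>t\<in>{0..}. (l * y t) *\<^sub>R q) \<in> skorokhod_space"
      by (intro skorokhod_space_scaleR continuous_intros y_cont)
    fix m r :: real assume m: "0 < m" and r: "0 < r"
    \<comment> \<open>The norm is bounded by the sum over the coordinates, so each of them is
      allowed an error \<open>r / K\<close>.\<close>
    define K where "K = real (CARD('k))"
    have K: "0 < K" by (simp add: K_def)
    have "\<forall>\<^sub>F u in at_top. \<forall>i\<in>UNIV. \<forall>t\<in>{0..m}. \<bar>f i u t - l * q $ i * y t\<bar> \<le> r / K"
    proof (rule eventually_ball_finite[OF finite], rule ballI)
      fix i
      show "\<forall>\<^sub>F u in at_top. \<forall>t\<in>{0..m}. \<bar>f i u t - l * q $ i * y t\<bar> \<le> r / K"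
        by (rule mono_pointwise_imp_uniform[OF f_mono f_lim])
           (use r K in \<open>auto intro!: continuous_intros y_cont\<close>)
    qed
    then show "\<forall>\<^sub>F u in at_top. \<forall>t\<in>{0..m}. norm (jump_path (max 1 u powr (- \<alpha>))
        (\<lambda>k. x (arrival e (Suc k) / max 1 u powr \<alpha>)) c t - (\<lambda>t\<in>{0..}. (l * y t) *\<^sub>R q) t) \<le> r"
    proof eventually_elim
      case (elim u)
      show ?case
      proof
        fix t assume t: "t \<in> {0..m}"
        let ?d = "jump_path (max 1 u powr (- \<alpha>)) (\<lambda>k. x (arrival e (Suc k) / max 1 u powr \<alpha>)) c t - (\<lambda>t\<in>{0..}. (l * y t) *\<^sub>R q) t"
        have d: "?d $ i = f i u t - l * q $ i * y t" for i
          using t unfolding v_inv by (simp add: jump_path_def f_def v_def)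
        have "norm ?d \<le> (\<Sum>i\<in>UNIV. \<bar>?d $ i\<bar>)" by (rule norm_le_l1_cart)
        also have "\<dots> \<le> (\<Sum>i\<in>(UNIV :: 'k set). r / K)"
          unfolding d using elim t by (intro sum_mono) auto
        also have "\<dots> = r" using K by (simp add: K_def)
        finally show "norm ?d \<le> r" .
      qed
    qed
  qed (rule paths)
  then show ?thesis by (simp add: y_def)
qed

section \<open>Arrival times of the fractional Poisson process\<close>

lemma mittag_leffler_0: "mittag_leffler \<theta> 0 = 1"
proof -
  have "mittag_leffler \<theta> 0 = (\<Sum>l. inverse (Gamma (1 + \<theta> * real l)) * 0 ^ l)"
    unfolding mittag_leffler_def by (simp add: divide_inverse mult.commute)
  also have "\<dots> = inverse (Gamma (1 + \<theta> * real 0))"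
    by (rule powser_zero[of "\<lambda>l. inverse (Gamma (1 + \<theta> * real l))"])
  finally show ?thesis by simp
qed

lemma independent_elements_distr:
  assumes M: "prob_space M" and ind: "independent_elements M S X T Y"
  shows "distr M (S \<Otimes>\<^sub>M T) (\<lambda>\<omega>. (X \<omega>, Y \<omega>)) = distr M S X \<Otimes>\<^sub>M distr M T Y"
proof -
  interpret prob_space M by fact
  have [measurable]: "X \<in> measurable M S" "Y \<in> measurable M T"
    using ind by (auto simp: independent_elements_def)
  interpret X: prob_space "distr M S X" by (rule prob_space_distr) simp
  interpret Y: prob_space "distr M T Y" by (rule prob_space_distr) simp
  show ?thesis
  proof (rule pair_measure_eqI[symmetric])
    fix A B assume "A \<in> sets (distr M S X)" "B \<in> sets (distr M T Y)"
    then have AB [measurable]: "A \<in> sets S" "B \<in> sets T" by auto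
    have "prob ((X -` A \<inter> space M) \<inter> (Y -` B \<inter> space M)) = prob (X -` A \<inter> space M) * prob (Y -` B \<inter> space M)"
      using ind unfolding independent_elements_def
      by (intro indep_setD[of "sigma_sets (space M) {X -` A \<inter> space M |A. A \<in> sets S}"
          "sigma_sets (space M) {Y -` A \<inter> space M |A. A \<in> sets T}"] sigma_sets.Basic)
        (use AB in auto)
    moreover have "(\<lambda>\<omega>. (X \<omega>, Y \<omega>)) -` (A \<times> B) \<inter> space M = (X -` A \<inter> space M) \<inter> (Y -` B \<inter> space M)" by auto
    ultimately show "emeasure (distr M S X) A * emeasure (distr M T Y) B =
        emeasure (distr M (S \<Otimes>\<^sub>M T) (\<lambda>\<omega>. (X \<omega>, Y \<omega>))) (A \<times> B)"
      by (simp add: emeasure_distr emeasure_eq_measure ennreal_mult)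
  qed (auto intro: X.sigma_finite_measure_axioms Y.sigma_finite_measure_axioms)
qed

text \<open>The arrival times must be read off the counting process, since the independence of the
  classes is assumed for the counting process only, not for the waiting times.\<close>

definition arrival_time :: "nat \<Rightarrow> (real \<Rightarrow> nat) \<Rightarrow> real" where
  "arrival_time k n = enn2real (SUP q\<in>\<rat> \<inter> {0..}. if n q \<le> k then ennreal q else 0)"

lemma arrival_time_measurable [measurable]:
  "arrival_time k \<in> borel_measurable (\<Pi>\<^sub>M t\<in>{0..}. count_space UNIV)"
proof -
  have "(\<lambda>n. if n q \<le> k then ennreal q else 0) \<in> borel_measurable (\<Pi>\<^sub>M t\<in>{0..}. count_space UNIV)"
    if "q \<in> \<rat> \<inter> {0..}" for q
  proof -
    have [measurable]: "(\<lambda>n. n q) \<in> measurable (\<Pi>\<^sub>M t\<in>{0::real..}. count_space (UNIV :: nat set)) (count_space UNIV)"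
      using that by (intro measurable_component_singleton) auto
    show ?thesis by measurable
  qed
  then show ?thesis
    unfolding arrival_time_def[abs_def]
    by (intro borel_measurable_enn2real borel_measurable_SUP) (auto intro: countable_rat)
qed

lemma arrival_time_eq:
  assumes "0 < s" and n: "\<And>q. 0 \<le> q \<Longrightarrow> n q \<le> k \<longleftrightarrow> q < s"
  shows "arrival_time k n = s"
proof -
  have "(SUP q\<in>\<rat> \<inter> {0..}. if n q \<le> k then ennreal q else 0) = ennreal s"
  proof (rule antisym)
    show "(SUP q\<in>\<rat> \<inter> {0..}. if n q \<le> k then ennreal q else 0) \<le> ennreal s"
      using n by (intro SUP_least) (auto intro: ennreal_leI)
    show "ennreal s \<le> (SUP q\<in>\<rat> \<inter> {0..}. if n q \<le> k then ennreal q else 0)"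
    proof (rule dense_le)
      fix y assume y: "y < ennreal s"
      then obtain r where r: "y = ennreal r" "0 \<le> r"
        by (cases y) auto
      with y have "r < s" by (simp add: ennreal_less_iff)
      from Rats_dense_in_real[OF this] obtain q where q: "q \<in> \<rat>" "r < q" "q < s" by blast
      have "y \<le> (if n q \<le> k then ennreal q else 0)"
        using r q n[of q] by (auto intro: ennreal_leI)
      also have "\<dots> \<le> (SUP q\<in>\<rat> \<inter> {0..}. if n q \<le> k then ennreal q else 0)"
        using q r by (intro SUP_upper) auto
      finally show "y \<le> (SUP q\<in>\<rat> \<inter> {0..}. if n q \<le> k then ennreal q else 0)" .
    qed
  qed
  then show ?thesis using assms(1) by (simp add: arrival_time_def)
qed

text \<open>A measurable property of the sequence alone, so that it can be transferred almost surely
  between processes of the same law.\<close>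

definition arrival_sequence :: "(nat \<Rightarrow> real) \<Rightarrow> bool" where
  "arrival_sequence s \<longleftrightarrow> strict_mono s \<and> 0 < s 0 \<and> filterlim s at_top sequentially"

lemma arrival_sequence_finite: "arrival_sequence s \<Longrightarrow> finite {k. s k \<le> t}"
proof -
  assume "arrival_sequence s"
  then have "\<forall>\<^sub>F k in sequentially. t < s k" by (simp add: arrival_sequence_def filterlim_at_top_dense)
  then obtain n where n: "\<And>k. n \<le> k \<Longrightarrow> t < s k" by (auto simp: eventually_sequentially)
  have "{k. s k \<le> t} \<subseteq> {..<n}" using n by (force simp: not_less[symmetric])
  then show ?thesis by (rule finite_subset) simp
qed

lemma arrival_sequence_measurable [measurable]:
  "Measurable.pred (\<Pi>\<^sub>M j\<in>UNIV. borel) arrival_sequence"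
proof -
  have "arrival_sequence s \<longleftrightarrow> (\<forall>k. s k < s (Suc k)) \<and> 0 < s 0 \<and> (\<forall>Z::nat. \<exists>n. \<forall>k\<ge>n. real Z \<le> s k)" for s
  proof -
    have "filterlim s at_top sequentially \<longleftrightarrow> (\<forall>Z::nat. \<exists>n. \<forall>k\<ge>n. real Z \<le> s k)"
    proof
      assume "filterlim s at_top sequentially"
      then show "\<forall>Z::nat. \<exists>n. \<forall>k\<ge>n. real Z \<le> s k"
        by (simp add: filterlim_at_top eventually_sequentially)
    next
      assume *: "\<forall>Z::nat. \<exists>n. \<forall>k\<ge>n. real Z \<le> s k"
      show "filterlim s at_top sequentially"
        unfolding filterlim_at_top eventually_sequentially
      proof
        fix Z :: real
        obtain n where "\<forall>k\<ge>n. real (nat \<lceil>Z\<rceil>) \<le> s k" using * by blast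
        moreover have "Z \<le> real (nat \<lceil>Z\<rceil>)" by (rule real_nat_ceiling_ge)
        ultimately show "\<exists>n. \<forall>k\<ge>n. Z \<le> s k" by (meson order_trans)
      qed
    qed
    then show ?thesis by (simp add: arrival_sequence_def strict_mono_Suc_iff)
  qed
  then have eq: "arrival_sequence = (\<lambda>s. (\<forall>k. s k < s (Suc k)) \<and> 0 < s 0 \<and> (\<forall>Z::nat. \<exists>n. \<forall>k\<ge>n. real Z \<le> s k))"
    by (intro ext)
  have [measurable]: "(\<lambda>s. s k) \<in> borel_measurable (\<Pi>\<^sub>M j\<in>UNIV. borel)" for k :: nat
    by (rule measurable_component_singleton) simp
  show ?thesis unfolding eq by measurable
qed

lemma prob_space_AE_fst:
  assumes "prob_space N" "AE x in M. P x"
  shows "AE p in M \<Otimes>\<^sub>M N. P (fst p)"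
proof (rule AE_distrD[OF measurable_fst])
  show "AE x in distr (M \<Otimes>\<^sub>M N) M fst. P x"
    unfolding prob_space.distr_pair_fst[OF assms(1)] by (rule assms(2))
qed

lemma prob_space_distr_snd:
  assumes M: "prob_space M" and N: "prob_space N"
  shows "distr (M \<Otimes>\<^sub>M N) N snd = N"
proof (rule measure_eqI)
  interpret M: prob_space M by fact
  interpret N: prob_space N by fact
  fix A assume "A \<in> sets (distr (M \<Otimes>\<^sub>M N) N snd)"
  then have A: "A \<in> sets N" by simp
  have "snd -` A \<inter> space (M \<Otimes>\<^sub>M N) = space M \<times> A"
    using sets.sets_into_space[OF A] by (auto simp: space_pair_measure)
  then show "emeasure (distr (M \<Otimes>\<^sub>M N) N snd) A = emeasure N A"
    using A by (simp add: emeasure_distr N.emeasure_pair_measure_Times M.emeasure_space_1)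
qed simp

lemma prob_space_AE_snd:
  assumes "prob_space M" "prob_space N" "AE y in N. P y"
  shows "AE p in M \<Otimes>\<^sub>M N. P (snd p)"
proof (rule AE_distrD[OF measurable_snd])
  show "AE y in distr (M \<Otimes>\<^sub>M N) N snd. P y"
    unfolding prob_space_distr_snd[OF assms(1,2)] by (rule assms(3))
qed

section \<open>The coupled arrival times and their law\<close>

context regular_stable_subordinator
begin

text \<open>These are the arrival times before rescaling; dividing by \<open>u\<close> leaves
  \<open>L'\<close> sampled at Poisson points of rate \<open>l * u powr \<alpha>\<close>.\<close>

definition coupled_time :: "real \<Rightarrow> 'b \<times> (nat \<Rightarrow> real) \<Rightarrow> nat \<Rightarrow> real" where
  "coupled_time u p k = u * L' (arrival (snd p) (Suc k) / u powr \<alpha>) (fst p)"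

lemma arrival_measurable_exponential [measurable]:
  "(\<lambda>e. arrival e k) \<in> borel_measurable (exponential_sequence l)"
proof -
  have [measurable]: "(\<lambda>e. e j) \<in> borel_measurable (exponential_sequence l)" for j
    by (rule measurable_compose[OF measurable_component_singleton]) auto
  show ?thesis unfolding arrival_def by measurable
qed

lemma L'_arrival_measurable [measurable]:
  "(\<lambda>p. L' (arrival (snd p) k / v) (fst p)) \<in> borel_measurable (M \<Otimes>\<^sub>M exponential_sequence l)"
  by (rule L'_joint_compose) measurable

lemma coupled_time_measurable [measurable]:
  "coupled_time u \<in> measurable (M \<Otimes>\<^sub>M exponential_sequence l) (\<Pi>\<^sub>M j\<in>UNIV. borel)"
  unfolding coupled_time_def[abs_def]
  by (rule measurable_PiM_single') (auto simp: PiE_def)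

lemma arrival_map_measurable [measurable]:
  "(\<lambda>x k. arrival x (Suc k)) \<in> measurable (\<Pi>\<^sub>M j\<in>UNIV. borel) (\<Pi>\<^sub>M j\<in>UNIV. borel)"
proof -
  have [measurable]: "(\<lambda>e. e j) \<in> borel_measurable (\<Pi>\<^sub>M j\<in>UNIV. borel)" for j :: nat
    by (rule measurable_component_singleton) simp
  show ?thesis
    unfolding arrival_def by (rule measurable_PiM_single') (auto simp: PiE_def)
qed

text \<open>Partial sums of the increments telescope to the sampled values because \<open>L'\<close>
  starts at 0, so this is the image of \<open>increments_law\<close> under summation.\<close>

lemma coupled_time_law:
  assumes u: "0 < u"
  shows "distr (M \<Otimes>\<^sub>M exponential_sequence l) (\<Pi>\<^sub>M j\<in>UNIV. borel) (coupled_time u) =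
    distr (\<Pi>\<^sub>M j\<in>UNIV. waiting_law u (u powr \<alpha>)) (\<Pi>\<^sub>M j\<in>UNIV. borel) (\<lambda>x k. arrival x (Suc k))"
proof -
  let ?v = "u powr \<alpha>"
  let ?X = "\<lambda>p j. u * (L' (arrival (snd p) (Suc j) / ?v) (fst p) - L' (arrival (snd p) j / ?v) (fst p))"
  have X: "?X \<in> measurable (M \<Otimes>\<^sub>M exponential_sequence l) (\<Pi>\<^sub>M j\<in>UNIV. borel)"
    by (rule measurable_PiM_single') (auto simp: PiE_def)
  have sum: "arrival (?X p) n = u * L' (arrival (snd p) n / ?v) (fst p)" if "fst p \<in> space M" for p n
  proof -
    have "arrival (?X p) n = u * (\<Sum>j<n. L' (arrival (snd p) (Suc j) / ?v) (fst p) - L' (arrival (snd p) j / ?v) (fst p))"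
      unfolding arrival_def[of "?X p"] by (rule sum_distrib_left[symmetric])
    also have "\<dots> = u * L' (arrival (snd p) n / ?v) (fst p)"
      using sum_lessThan_telescope[of "\<lambda>j. L' (arrival (snd p) j / ?v) (fst p)" n] L'_0[OF that] by simp
    finally show ?thesis .
  qed
  have "distr (\<Pi>\<^sub>M j\<in>UNIV. waiting_law u ?v) (\<Pi>\<^sub>M j\<in>UNIV. borel) (\<lambda>x k. arrival x (Suc k)) =
      distr (distr (M \<Otimes>\<^sub>M exponential_sequence l) (\<Pi>\<^sub>M j\<in>UNIV. borel) ?X) (\<Pi>\<^sub>M j\<in>UNIV. borel) (\<lambda>x k. arrival x (Suc k))"
    using increments_law[of ?v u] u by simp
  also have "\<dots> = distr (M \<Otimes>\<^sub>M exponential_sequence l) (\<Pi>\<^sub>M j\<in>UNIV. borel) ((\<lambda>x k. arrival x (Suc k)) \<circ> ?X)"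
    by (rule distr_distr[OF arrival_map_measurable X])
  also have "\<dots> = distr (M \<Otimes>\<^sub>M exponential_sequence l) (\<Pi>\<^sub>M j\<in>UNIV. borel) (coupled_time u)"
    by (intro distr_cong refl ext) (simp add: coupled_time_def sum space_pair_measure mem_Times_iff)
  finally show ?thesis by (rule sym)
qed

lemma coupled_AE:
  "AE p in M \<Otimes>\<^sub>M exponential_sequence l. fst p \<in> space M \<and> (\<forall>j. 0 < snd p j) \<and>
     (\<lambda>n. arrival (snd p) n / real n) \<longlonglongrightarrow> 1 / l"
proof -
  have "AE e in exponential_sequence l. 0 < e j" for j
    using exponential_law_AE_pos[OF l] by (intro AE_PiM_component prob_space_exponential_density l) auto
  then have "AE e in exponential_sequence l. \<forall>j. 0 < e j" by (simp add: AE_all_countable)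
  then have "AE e in exponential_sequence l. (\<forall>j. 0 < e j) \<and> (\<lambda>n. arrival e n / real n) \<longlonglongrightarrow> 1 / l"
    using exponential_arrival_strong_law[OF l] by eventually_elim simp
  then have "AE p in M \<Otimes>\<^sub>M exponential_sequence l. (\<forall>j. 0 < snd p j) \<and> (\<lambda>n. arrival (snd p) n / real n) \<longlonglongrightarrow> 1 / l"
    by (rule prob_space_AE_snd[OF prob_space_axioms prob_space_exponential_sequence[OF l]])
  moreover have "AE p in M \<Otimes>\<^sub>M exponential_sequence l. fst p \<in> space M"
    by (rule AE_I2) (simp add: space_pair_measure mem_Times_iff)
  ultimately show ?thesis by eventually_elim simp
qed

lemma coupled_arrival_sequence:
  assumes \<omega>: "\<omega> \<in> space M" and e: "\<And>j. 0 < e j" and lim: "(\<lambda>n. arrival e n / real n) \<longlonglongrightarrow> 1 / l"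
    and v: "0 < v"
  shows "arrival_sequence (\<lambda>k. L' (arrival e (Suc k) / v) \<omega>)"
proof -
  have mono: "strict_mono_on {0..} (\<lambda>s. L' s \<omega>)" and top: "filterlim (\<lambda>s. L' s \<omega>) at_top at_top"
    using reg[OF \<omega>] by (auto simp: regular_path_def)
  have arr0: "0 < arrival e (Suc k)" for k using arrival_less[of e 0 "Suc k", OF e] by simp
  have "strict_mono (\<lambda>k. L' (arrival e (Suc k) / v) \<omega>)"
    using arr0 v
    by (intro strict_monoI strict_mono_onD[OF mono] divide_strict_right_mono arrival_less e)
       (auto intro: less_imp_le divide_nonneg_pos)
  moreover have "L' 0 \<omega> < L' (arrival e (Suc 0) / v) \<omega>"
    using arr0[of 0] v by (intro strict_mono_onD[OF mono]) (auto intro: less_imp_le)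
  moreover have "filterlim (\<lambda>k. arrival e (Suc k) * (1 / v)) at_top sequentially"
    using v
    by (intro filterlim_at_top_mult_tendsto_pos[OF tendsto_const] filterlim_compose[OF arrival_unbounded[OF l lim] filterlim_Suc]) simp
  then have "filterlim (\<lambda>k. L' (arrival e (Suc k) / v) \<omega>) at_top sequentially"
    using filterlim_compose[OF top] by fastforce
  ultimately show ?thesis using L'_0[OF \<omega>] by (simp add: arrival_sequence_def)
qed

end

lemma arrival_sequence_scale: "0 < u \<Longrightarrow> arrival_sequence (\<lambda>k. s k / u) \<longleftrightarrow> arrival_sequence s" for u :: real
proof -
  have scale: "arrival_sequence (\<lambda>k. s k * c)" if "arrival_sequence s" "0 < c" for s :: "nat \<Rightarrow> real" and c
    using that filterlim_at_top_mult_tendsto_pos[OF tendsto_const that(2), of s sequentially]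
    by (auto simp: arrival_sequence_def strict_mono_def)
  assume u: "0 < u"
  show ?thesis
  proof
    assume "arrival_sequence (\<lambda>k. s k / u)"
    from scale[OF this u] show "arrival_sequence s" using u by simp
  next
    assume "arrival_sequence s"
    from scale[OF this, of "1 / u"] show "arrival_sequence (\<lambda>k. s k / u)" using u by simp
  qed
qed

text \<open>The waiting times have the law \<open>waiting_law\<close> because the Laplace transforms
  agree; independence lifts this to the sequence and to its partial sums. The arrival times read off
  \<open>N\<close> coincide almost surely with these sums.\<close>

lemma (in regular_stable_subordinator)
  fixes P :: "'a measure" and N :: "real \<Rightarrow> 'a \<Rightarrow> nat"
  assumes \<alpha>: "0 < \<alpha>" and lam: "0 < lam" and l_lam: "l = lam powr \<alpha>"
    and fpp: "fractional_poisson_process P \<alpha> lam N"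
  shows fractional_poisson_arrivals:
      "AE \<omega> in P. arrival_sequence (\<lambda>k. arrival_time k (\<lambda>t\<in>{0..}. N t \<omega>)) \<and>
        (\<forall>t\<ge>0. {k. arrival_time k (\<lambda>t\<in>{0..}. N t \<omega>) \<le> t} = {..<N t \<omega>})" (is ?AE)
    and fractional_poisson_arrivals_law:
      "0 < u \<Longrightarrow> distr P (\<Pi>\<^sub>M j\<in>UNIV. borel) (\<lambda>\<omega> k. arrival_time k (\<lambda>t\<in>{0..}. N t \<omega>)) =
        distr (M \<Otimes>\<^sub>M exponential_sequence l) (\<Pi>\<^sub>M j\<in>UNIV. borel) (coupled_time u)" (is "_ \<Longrightarrow> ?law u")
proof -
  interpret P: prob_space P using fpp by (simp add: fractional_poisson_process_def)
  obtain X :: "nat \<Rightarrow> 'a \<Rightarrow> real" where ind: "P.indep_vars (\<lambda>_. borel) X UNIV"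
    and X0: "\<And>j. AE \<omega> in P. X j \<omega> \<ge> 0"
    and cdf: "\<And>j x. 0 \<le> x \<Longrightarrow> measure P {\<omega> \<in> space P. X j \<omega> \<le> x} = 1 - mittag_leffler \<alpha> (- (lam powr \<alpha> * x powr \<alpha>))"
    and N: "AE \<omega> in P. \<forall>t\<ge>0. N t \<omega> = Max {n. (\<Sum>j<n. X j \<omega>) \<le> t}"
    and N_meas: "\<And>t. 0 \<le> t \<Longrightarrow> N t \<in> measurable P (count_space UNIV)"
    using fpp unfolding fractional_poisson_process_def by blast
  have X_meas [measurable]: "X j \<in> borel_measurable P" for j
    using ind by (auto simp: P.indep_vars_def)
  have XX [measurable]: "(\<lambda>\<omega> j. X j \<omega>) \<in> measurable P (\<Pi>\<^sub>M j\<in>UNIV. borel)"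
    by (rule measurable_PiM_single') (auto simp: PiE_def)
  have Xpos: "AE \<omega> in P. 0 < X j \<omega>" for j
  proof -
    have "P.prob {\<omega> \<in> space P. X j \<omega> \<le> 0} = 0"
      using cdf[of 0 j] by (simp add: mittag_leffler_0)
    then have "AE \<omega> in P. \<omega> \<notin> {\<omega> \<in> space P. X j \<omega> \<le> 0}"
      by (subst (asm) P.prob_eq_0) auto
    then show ?thesis by (rule AE_mp) (auto intro!: AE_I2)
  qed
  \<comment> \<open>The comparison starts at \<open>lam + 1\<close>, as the transform of the
    Mittag-Leffler law has been computed only above \<open>lam\<close>.\<close>
  have X_law: "distr P borel (X j) = waiting_law u (u powr \<alpha>)" if u: "0 < u" for j u
  proof (rule laplace_unique[where s = "lam + 1"])
    show dX: "real_distribution (distr P borel (X j))"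
      unfolding real_distribution_def real_distribution_axioms_def by (intro conjI P.prob_space_distr) auto
    show aX: "AE x in distr P borel (X j). 0 \<le> x"
      using X0[of j] by (subst AE_distr_iff) auto
    show "real_distribution (waiting_law u (u powr \<alpha>))" by (rule waiting_law_distribution)
    show "AE x in waiting_law u (u powr \<alpha>). 0 \<le> x" by (rule waiting_law_nonneg) (use u in simp)
    fix k :: nat
    have c: "measure (distr P borel (X j)) {..x} = 1 - mittag_leffler \<alpha> (- (lam powr \<alpha> * x powr \<alpha>))" if "0 \<le> x" for x
      using cdf[OF that, of j] by (simp add: measure_distr vimage_def Int_def conj_commute)
    show "(\<integral>x. exp (- (lam + 1 + real k) * x) \<partial>distr P borel (X j)) =
        (\<integral>x. exp (- (lam + 1 + real k) * x) \<partial>waiting_law u (u powr \<alpha>))"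
      by (subst laplace_mittag_leffler[OF dX aX \<alpha> lam c], assumption, simp,
          subst waiting_law_laplace[OF u]) (use lam in \<open>auto simp: l_lam\<close>)
  qed (use lam in simp)
  have law0: "distr P (\<Pi>\<^sub>M j\<in>UNIV. borel) (\<lambda>\<omega> k. arrival (\<lambda>j. X j \<omega>) (Suc k)) =
      distr (M \<Otimes>\<^sub>M exponential_sequence l) (\<Pi>\<^sub>M j\<in>UNIV. borel) (coupled_time u)" if u: "0 < u" for u
  proof -
    have "distr P (\<Pi>\<^sub>M j\<in>UNIV. borel) (\<lambda>\<omega> j. X j \<omega>) = (\<Pi>\<^sub>M j\<in>UNIV. waiting_law u (u powr \<alpha>))"
      using P.indep_vars_iff_distr_eq_PiM[of UNIV X "\<lambda>_. borel"] ind by (simp add: X_law[OF u] restrict_def)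
    moreover have "distr P (\<Pi>\<^sub>M j\<in>UNIV. borel) (\<lambda>\<omega> k. arrival (\<lambda>j. X j \<omega>) (Suc k)) =
        distr (distr P (\<Pi>\<^sub>M j\<in>UNIV. borel) (\<lambda>\<omega> j. X j \<omega>)) (\<Pi>\<^sub>M j\<in>UNIV. borel) (\<lambda>x k. arrival x (Suc k))"
      by (simp add: distr_distr[OF arrival_map_measurable XX] comp_def)
    ultimately show ?thesis using coupled_time_law[OF u] by simp
  qed
  \<comment> \<open>Divergence of the partial sums of \<open>X\<close> is not shown directly: it
    holds for the coupled times, where it follows from the growth of \<open>L'\<close>, and is
    carried over by equality in law.\<close>
  have "AE p in M \<Otimes>\<^sub>M exponential_sequence l. arrival_sequence (coupled_time 1 p)"
    using coupled_AE
  proof eventually_elim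
    case (elim p)
    then show ?case
      using coupled_arrival_sequence[of "fst p" "snd p" 1] by (simp add: coupled_time_def[abs_def])
  qed
  then have "AE s in distr (M \<Otimes>\<^sub>M exponential_sequence l) (\<Pi>\<^sub>M j\<in>UNIV. borel) (coupled_time 1). arrival_sequence s"
    by (subst AE_distr_iff) (use arrival_sequence_measurable in \<open>auto simp: pred_def\<close>)
  then have "AE s in distr P (\<Pi>\<^sub>M j\<in>UNIV. borel) (\<lambda>\<omega> k. arrival (\<lambda>j. X j \<omega>) (Suc k)). arrival_sequence s"
    by (simp only: law0[OF zero_less_one])
  moreover have arr_meas: "(\<lambda>\<omega> k. arrival (\<lambda>j. X j \<omega>) (Suc k)) \<in> measurable P (\<Pi>\<^sub>M j\<in>UNIV. borel)"
    by (rule measurable_compose[OF XX arrival_map_measurable])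
  ultimately have arr_seq: "AE \<omega> in P. arrival_sequence (\<lambda>k. arrival (\<lambda>j. X j \<omega>) (Suc k))"
    by (rule AE_distrD[rotated])
  have "AE \<omega> in P. \<forall>j. 0 < X j \<omega>" using Xpos by (simp add: AE_all_countable)
  with arr_seq N have key: "AE \<omega> in P. arrival_sequence (\<lambda>k. arrival (\<lambda>j. X j \<omega>) (Suc k)) \<and>
      (\<forall>t\<ge>0. {k. arrival (\<lambda>j. X j \<omega>) (Suc k) \<le> t} = {..<N t \<omega>}) \<and>
      (\<lambda>k. arrival_time k (\<lambda>t\<in>{0..}. N t \<omega>)) = (\<lambda>k. arrival (\<lambda>j. X j \<omega>) (Suc k))"
  proof eventually_elim
    case (elim \<omega>)
    let ?e = "\<lambda>j. X j \<omega>"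
    have unbdd: "filterlim (arrival ?e) at_top sequentially"
      using elim(1) filterlim_sequentially_Suc[of "arrival ?e"] by (simp add: arrival_sequence_def)
    have seg: "{k. arrival ?e (Suc k) \<le> t} = {..<N t \<omega>}" if "0 \<le> t" for t
      using arrivals_initial_segment[of ?e t, OF _ unbdd that] elim(2,3) that by simp
    have "arrival_time k (\<lambda>t\<in>{0..}. N t \<omega>) = arrival ?e (Suc k)" for k
    proof (rule arrival_time_eq)
      show "0 < arrival ?e (Suc k)" using arrival_less[of ?e 0 "Suc k"] elim(3) by simp
      fix q :: real assume q: "0 \<le> q"
      have "arrival ?e (Suc k) \<le> q \<longleftrightarrow> k < N q \<omega>" using seg[OF q] by blast
      then show "(\<lambda>t\<in>{0..}. N t \<omega>) q \<le> k \<longleftrightarrow> q < arrival ?e (Suc k)"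
        using q by (simp, linarith)
    qed
    then show ?case using elim(1) seg by blast
  qed
  then show ?AE
  proof eventually_elim
    case (elim \<omega>)
    then have "arrival_time k (\<lambda>t\<in>{0..}. N t \<omega>) = arrival (\<lambda>j. X j \<omega>) (Suc k)" for k by meson
    then show ?case using elim by simp
  qed
  show "?law u" if u: "0 < u"
  proof -
    have [measurable]: "(\<lambda>\<omega>. \<lambda>t\<in>{0..}. N t \<omega>) \<in> measurable P (\<Pi>\<^sub>M t\<in>{0..}. count_space UNIV)"
      by (rule measurable_restrict) (use N_meas in auto)
    have "distr P (\<Pi>\<^sub>M j\<in>UNIV. borel) (\<lambda>\<omega> k. arrival_time k (\<lambda>t\<in>{0..}. N t \<omega>)) =
        distr P (\<Pi>\<^sub>M j\<in>UNIV. borel) (\<lambda>\<omega> k. arrival (\<lambda>j. X j \<omega>) (Suc k))"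
    proof (rule distr_cong_AE)
      show "AE \<omega> in P. (\<lambda>k. arrival_time k (\<lambda>t\<in>{0..}. N t \<omega>)) = (\<lambda>k. arrival (\<lambda>j. X j \<omega>) (Suc k))"
        using key by eventually_elim simp
      show "(\<lambda>\<omega> k. arrival_time k (\<lambda>t\<in>{0..}. N t \<omega>)) \<in> measurable P (\<Pi>\<^sub>M j\<in>UNIV. borel)"
        by (rule measurable_PiM_single') (auto simp: PiE_def)
    qed (use arr_meas in auto)
    then show ?thesis using law0[OF u] by (rule trans)
  qed
qed

section \<open>Weak convergence\<close>

text \<open>Replacing bad sequences of arrival times by a fixed good one makes the path a measurable function of
  all sequences.\<close>

definition regularise :: "(nat \<Rightarrow> real) \<Rightarrow> nat \<Rightarrow> real" where
  "regularise s = (if arrival_sequence s then s else (\<lambda>k. real (Suc k)))"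

lemma arrival_sequence_regularise: "arrival_sequence (regularise s)"
proof -
  have "arrival_sequence (\<lambda>k. real (Suc k))"
    by (auto simp: arrival_sequence_def strict_mono_def simp del: of_nat_Suc
        intro!: filterlim_compose[OF filterlim_real_sequentially filterlim_Suc])
  then show ?thesis by (simp add: regularise_def)
qed

text \<open>One function of classes and arrival times serves the given and the coupled process, so
  equality of the joint laws of its arguments gives equality of the path laws.\<close>

definition count_path :: "real \<Rightarrow> real \<Rightarrow> (nat \<Rightarrow> 'k::finite) \<Rightarrow> (nat \<Rightarrow> real) \<Rightarrow> real \<Rightarrow> real ^ 'k" where
  "count_path \<alpha> u c s = jump_path (u powr (- \<alpha>)) (\<lambda>k. regularise s k / u) c"

lemma count_path_measurable:
  assumes u: "0 < u"
  shows "(\<lambda>(c, s). count_path \<alpha> u c s) \<in>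
    measurable ((\<Pi>\<^sub>M n\<in>UNIV. count_space (UNIV :: 'k::finite set)) \<Otimes>\<^sub>M (\<Pi>\<^sub>M j\<in>UNIV. borel)) (borel_of skorokhod_J1)"
proof -
  let ?N = "(\<Pi>\<^sub>M n\<in>(UNIV :: nat set). count_space (UNIV :: 'k set)) \<Otimes>\<^sub>M (\<Pi>\<^sub>M j\<in>(UNIV :: nat set). (borel :: real measure))"
  have comp [measurable]: "(\<lambda>s. s k) \<in> borel_measurable (\<Pi>\<^sub>M j\<in>UNIV. borel)" for k :: nat
    by (rule measurable_component_singleton) simp
  have [measurable]: "(\<lambda>c. c k) \<in> measurable (\<Pi>\<^sub>M n\<in>UNIV. count_space (UNIV :: 'k set)) (count_space UNIV)" for k :: nat
    by (rule measurable_component_singleton) simp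
  have reg_meas [measurable]: "(\<lambda>s. regularise s k) \<in> borel_measurable (\<Pi>\<^sub>M j\<in>UNIV. borel)" for k
  proof -
    have "(\<lambda>s. if arrival_sequence s then s k else real (Suc k)) \<in> borel_measurable (\<Pi>\<^sub>M j\<in>UNIV. borel)"
      by (intro measurable_If comp measurable_const predE arrival_sequence_measurable) simp
    then show ?thesis by (simp add: regularise_def if_distrib[of "\<lambda>f. f k"] cong: if_cong)
  qed
  have "(\<lambda>p. jump_path (u powr (- \<alpha>)) (\<lambda>k. regularise (snd p) k / u) (\<lambda>k. fst p k)) \<in> measurable ?N (borel_of skorokhod_J1)"
  proof (rule jump_path_measurable)
    fix p
    have "arrival_sequence (\<lambda>k. regularise (snd p) k / u)"
      using arrival_sequence_scale[OF u] arrival_sequence_regularise by blast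
    then show "strict_mono (\<lambda>k. regularise (snd p) k / u) \<and> 0 < regularise (snd p) 0 / u \<and> (\<forall>t. finite {k. regularise (snd p) k / u \<le> t})"
      using arrival_sequence_finite by (auto simp: arrival_sequence_def)
  qed measurable
  then show ?thesis by (simp add: count_path_def case_prod_beta')
qed

lemma class_frequency:
  fixes C :: "nat \<Rightarrow> 'a \<Rightarrow> 'k::finite"
  assumes P: "prob_space P" and ind: "prob_space.indep_vars P (\<lambda>_. count_space UNIV) C UNIV"
    and p: "\<And>n. measure P {\<omega> \<in> space P. C n \<omega> = i} = q"
  shows "AE \<omega> in P. (\<lambda>n. real (card {k. k < n \<and> C k \<omega> = i}) / real n) \<longlonglongrightarrow> q"
proof -
  interpret prob_space P by fact
  have [measurable]: "C n \<in> measurable P (count_space UNIV)" for n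
    using ind by (auto simp: indep_vars_def)
  define Z where "Z n \<omega> = (indicator {i} (C n \<omega>) :: real)" for n \<omega>
  have Z_meas [measurable]: "Z n \<in> borel_measurable P" for n unfolding Z_def by measurable
  have Z_int: "integrable P (Z n)" for n
    by (rule integrable_const_bound[of _ 1]) (auto simp: Z_def)
  have Z_sq: "(Z n \<omega>)\<^sup>2 = Z n \<omega>" for n \<omega> by (simp add: Z_def indicator_def)
  have mean: "expectation (Z n) = q" for n
  proof -
    have "expectation (Z n) = expectation (indicator {\<omega> \<in> space P. C n \<omega> = i})"
      by (intro Bochner_Integration.integral_cong) (auto simp: Z_def split: split_indicator)
    also have "\<dots> = q" using p[of n] by simp
    finally show ?thesis .
  qed
  have "AE \<omega> in P. (\<lambda>n. (\<Sum>k<n. Z k \<omega>) / real n) \<longlonglongrightarrow> q"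
  proof (rule strong_law_nonneg)
    show "indep_vars (\<lambda>_. borel) Z UNIV"
      unfolding Z_def by (rule indep_vars_compose2[OF ind]) simp
    show "integrable P (\<lambda>x. (Z n x)\<^sup>2)" for n unfolding Z_sq by (rule Z_int)
    \<comment> \<open>An indicator equals its square, so the variance is \<open>q\<close> minus the
      square of \<open>q\<close>.\<close>
    show "variance (Z n) \<le> q" for n
      using variance_eq[of "Z n"] Z_int[of n] mean[of n] by (simp add: Z_sq)
    show "expectation (Z n) = q" for n by (rule mean)
  qed (simp add: Z_def)
  moreover have "(\<Sum>k<n. Z k \<omega>) = real (card {k. k < n \<and> C k \<omega> = i})" for n \<omega>
  proof -
    have "(\<Sum>k<n. Z k \<omega>) = (\<Sum>k\<in>{k. k < n \<and> C k \<omega> = i}. 1)"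
      unfolding Z_def by (intro sum.mono_neutral_cong_right) (auto split: split_indicator)
    then show ?thesis by simp
  qed
  ultimately show ?thesis by simp
qed

lemma independent_elements_distr_maps:
  assumes M: "prob_space M" and ind: "independent_elements M S X T Y" and g [measurable]: "g \<in> measurable T T'"
  shows "distr M (S \<Otimes>\<^sub>M T') (\<lambda>\<omega>. (X \<omega>, g (Y \<omega>))) = distr M S X \<Otimes>\<^sub>M distr M T' (\<lambda>\<omega>. g (Y \<omega>))"
proof -
  interpret prob_space M by fact
  have [measurable]: "X \<in> measurable M S" "Y \<in> measurable M T"
    using ind by (auto simp: independent_elements_def)
  interpret gY: prob_space "distr (distr M T Y) T' g"
    by (intro prob_space.prob_space_distr prob_space_distr) auto
  have "distr M (S \<Otimes>\<^sub>M T') (\<lambda>\<omega>. (X \<omega>, g (Y \<omega>))) =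
      distr (distr M (S \<Otimes>\<^sub>M T) (\<lambda>\<omega>. (X \<omega>, Y \<omega>))) (S \<Otimes>\<^sub>M T') (\<lambda>(x, y). (x, g y))"
    by (subst distr_distr) (auto simp: comp_def)
  also have "\<dots> = distr (distr M S X \<Otimes>\<^sub>M distr M T Y) (S \<Otimes>\<^sub>M T') (\<lambda>(x, y). (x, g y))"
    unfolding independent_elements_distr[OF M ind] ..
  also have "\<dots> = distr (distr M S X) S (\<lambda>x. x) \<Otimes>\<^sub>M distr (distr M T Y) T' g"
    by (rule pair_measure_distr[symmetric]) (auto intro: gY.sigma_finite_measure_axioms)
  also have "distr (distr M S X) S (\<lambda>x. x) = distr M S X"
    by (rule distr_id2) simp
  also have "distr (distr M T Y) T' g = distr M T' (\<lambda>\<omega>. g (Y \<omega>))"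
    by (simp add: distr_distr comp_def)
  finally show ?thesis .
qed

theorem theorem2p6:
  fixes \<alpha> lam :: real
    and p :: "real ^ 'k"
    and M :: "'a measure"
    and N :: "real \<Rightarrow> 'a \<Rightarrow> nat"
    and C :: "nat \<Rightarrow> 'a \<Rightarrow> 'k"
    and M' :: "'b measure"
    and L :: "real \<Rightarrow> 'b \<Rightarrow> real"
  assumes "0 < \<alpha>" and "\<alpha> \<le> 1" and "0 < lam"
    and "\<And>i. 0 < p $ i" and "(\<Sum>i\<in>UNIV. p $ i) = 1"
    and "fractional_poisson_process M \<alpha> lam N"
    and "prob_space.indep_vars M (\<lambda>_. count_space UNIV) C UNIV"
    and "\<And>n i. measure M {\<omega> \<in> space M. C n \<omega> = i} = p $ i"
    and "independent_elements M
           (\<Pi>\<^sub>M n\<in>UNIV. count_space UNIV) (\<lambda>\<omega>. \<lambda>n\<in>UNIV. C n \<omega>)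
           (\<Pi>\<^sub>M t\<in>{0..}. count_space UNIV) (\<lambda>\<omega>. \<lambda>t\<in>{0..}. N t \<omega>)"
    and "standard_stable_subordinator M' \<alpha> L"
  shows "converges_in_distribution skorokhod_J1
           M (\<lambda>u \<omega>. \<lambda>t\<in>{0..}. u powr (- \<alpha>) *\<^sub>R (\<chi> i. real (class_count N C i (u * t) \<omega>)))
           M' (\<lambda>\<omega>. \<lambda>t\<in>{0..}. (lam powr \<alpha> * inverse_process L t \<omega>) *\<^sub>R p)
           at_top"
proof -
  note \<alpha> = assms(1) and lam = assms(3) and fpp = assms(6) and ind = assms(9)
  define l where "l = lam powr \<alpha>"
  have l: "0 < l" using lam by (simp add: l_def)
  obtain L' where L': "\<And>s. L' s \<in> borel_measurable M'" "\<And>s. L' (max 0 s) = L' s"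
    "\<And>\<omega>. \<omega> \<in> space M' \<Longrightarrow> regular_path (\<lambda>s. L' s \<omega>)" "AE \<omega> in M'. \<forall>s\<ge>0. L' s \<omega> = L s \<omega>"
    using stable_subordinator_regular_version[OF assms(10) \<alpha>] by blast
  interpret R: regular_stable_subordinator M' \<alpha> l L L'
    by unfold_locales (use assms(10) l L' in auto)
  interpret P: prob_space M using fpp by (simp add: fractional_poisson_process_def)
  let ?E = "exponential_sequence l"
  let ?CS = "\<Pi>\<^sub>M n\<in>(UNIV :: nat set). count_space (UNIV :: 'k set)"
  let ?RS = "\<Pi>\<^sub>M j\<in>(UNIV :: nat set). (borel :: real measure)"
  let ?J = "borel_of (skorokhod_J1 :: (real \<Rightarrow> real ^ 'k) topology)"
  have C_meas [measurable]: "(\<lambda>\<omega> n. C n \<omega>) \<in> measurable M ?CS"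
    using ind by (simp add: independent_elements_def restrict_UNIV)
  have N_meas [measurable]: "(\<lambda>\<omega>. \<lambda>t\<in>{0..}. N t \<omega>) \<in> measurable M (\<Pi>\<^sub>M t\<in>{0..}. count_space UNIV)"
    using ind by (simp add: independent_elements_def)
  have at_meas [measurable]: "(\<lambda>n k. arrival_time k n) \<in> measurable (\<Pi>\<^sub>M t\<in>{0..}. count_space UNIV) ?RS"
    by (rule measurable_PiM_single') (auto simp: PiE_def)
  define S where "S \<omega> k = arrival_time k (\<lambda>t\<in>{0..}. N t \<omega>)" for \<omega> k
  have S_meas [measurable]: "S \<in> measurable M ?RS"
    unfolding S_def[abs_def] by (rule measurable_compose[OF N_meas at_meas])
  note S_AE = R.fractional_poisson_arrivals[OF \<alpha> lam l_def fpp, folded S_def]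
  have S_law: "distr M ?RS S = distr (M' \<Otimes>\<^sub>M ?E) ?RS (R.coupled_time u)" if "0 < u" for u
    using R.fractional_poisson_arrivals_law[OF \<alpha> lam l_def fpp that] by (simp add: S_def[abs_def])
  \<comment> \<open>A Borel map for each \<open>u > 0\<close>, equal to the rescaled process
    wherever \<open>S \<omega>\<close> is an arrival sequence compatible with \<open>N\<close>; this
    is the version that \<open>is_law_of\<close> asks for.\<close>
  define X' where "X' u \<omega> = count_path \<alpha> u (\<lambda>n. C n \<omega>) (S \<omega>)" for u \<omega>
  define Y' where "Y' \<omega> = (\<lambda>t\<in>{0..}. (l * inverse_process L' t \<omega>) *\<^sub>R p)" for \<omega>
  have X'_meas: "X' u \<in> measurable M ?J" if "0 < u" for u
    using measurable_compose[OF measurable_Pair[OF C_meas S_meas] count_path_measurable[OF that, of \<alpha>]]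
    by (simp add: X'_def[abs_def])
  have Y'_meas: "Y' \<in> measurable M' ?J"
    unfolding Y'_def[abs_def]
  proof (rule scaled_path_measurable)
    show "(\<lambda>\<omega>. l * inverse_process L' t \<omega>) \<in> borel_measurable M'" if "0 \<le> t" for t
      using inverse_process_measurable[of L' M', OF L'(1) L'(3) that] by simp
    show "continuous_on {0..} (\<lambda>t. l * inverse_process L' t \<omega>)" if "\<omega> \<in> space M'" for \<omega>
      using regular_path_inverse_continuous[OF L'(3)[OF that]]
      by (intro continuous_intros) (simp add: inverse_process_def[abs_def])
  qed
  have X'_law: "is_law_of (distr M ?J (X' u)) ?J M
      (\<lambda>\<omega>. \<lambda>t\<in>{0..}. u powr (- \<alpha>) *\<^sub>R (\<chi> i. real (class_count N C i (u * t) \<omega>)))" if u: "0 < u" for u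
    unfolding is_law_of_def
  proof (intro exI[of _ "X' u"] conjI refl X'_meas[OF u])
    show "AE \<omega> in M. X' u \<omega> = (\<lambda>t\<in>{0..}. u powr (- \<alpha>) *\<^sub>R (\<chi> i. real (class_count N C i (u * t) \<omega>)))"
      using S_AE
    proof eventually_elim
      case (elim \<omega>)
      then have reg: "regularise (S \<omega>) = S \<omega>" by (simp add: regularise_def)
      have "{k. S \<omega> k / u \<le> t \<and> C k \<omega> = i} = {n. n < N (u * t) \<omega> \<and> C n \<omega> = i}" if "0 \<le> t" for t i
      proof -
        have "S \<omega> k / u \<le> t \<longleftrightarrow> S \<omega> k \<le> u * t" for k
          using u by (simp add: pos_divide_le_eq mult.commute)
        moreover have "{k. S \<omega> k \<le> u * t} = {..<N (u * t) \<omega>}" using elim u that by simp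
        ultimately show ?thesis by blast
      qed
      then show ?case
        by (auto simp: X'_def count_path_def jump_path_def reg class_count_def fun_eq_iff restrict_def)
    qed
  qed
  have Y'_law: "is_law_of (distr M' ?J Y') ?J M' (\<lambda>\<omega>. \<lambda>t\<in>{0..}. (lam powr \<alpha> * inverse_process L t \<omega>) *\<^sub>R p)"
    unfolding is_law_of_def
  proof (intro exI[of _ Y'] conjI refl Y'_meas)
    show "AE \<omega> in M'. Y' \<omega> = (\<lambda>t\<in>{0..}. (lam powr \<alpha> * inverse_process L t \<omega>) *\<^sub>R p)"
      using L'(4)
    proof eventually_elim
      case (elim \<omega>)
      then have "{s. s > 0 \<and> L' s \<omega> > t} = {s. s > 0 \<and> L s \<omega> > t}" for t by auto
      then show ?case by (simp add: Y'_def inverse_process_def l_def)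
    qed
  qed
  \<comment> \<open>Classes come from \<open>M\<close>, the subordinator from \<open>M'\<close> and
    the Poisson gaps from a new factor. The product structure makes classes and coupled times
    independent, and one space carries the coupled paths for all \<open>u\<close>.\<close>
  define Q where "Q = M \<Otimes>\<^sub>M (M' \<Otimes>\<^sub>M ?E)"
  interpret ME: prob_space "M' \<Otimes>\<^sub>M ?E"
    by (rule R.prob_space_pair[OF prob_space_exponential_sequence[OF l]])
  interpret MME: pair_prob_space M "M' \<Otimes>\<^sub>M ?E" ..
  interpret Q: prob_space Q unfolding Q_def by (rule MME.P.prob_space_axioms)
  define Z where "Z u r = count_path \<alpha> u (\<lambda>n. C n (fst r)) (R.coupled_time u (snd r))" for u r
  have CT_meas: "(\<lambda>r. (\<lambda>n. C n (fst r), R.coupled_time u (snd r))) \<in> measurable Q (?CS \<Otimes>\<^sub>M ?RS)" for u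
    unfolding Q_def
    by (intro measurable_Pair measurable_compose[OF measurable_fst C_meas] measurable_compose[OF measurable_snd R.coupled_time_measurable])
  have Z_meas: "Z u \<in> measurable Q ?J" if "0 < u" for u
    using measurable_compose[OF CT_meas count_path_measurable[OF that, of \<alpha>]]
    by (simp add: Z_def[abs_def])
  \<comment> \<open>Only for each \<open>u\<close> separately: the coupled arrival times vary with
    \<open>u\<close>, those on \<open>M\<close> do not. The assumed independence of classes and
    counting process turns equal marginal laws into equal joint laws.\<close>
  have joint: "distr M (?CS \<Otimes>\<^sub>M ?RS) (\<lambda>\<omega>. (\<lambda>n. C n \<omega>, S \<omega>)) =
      distr Q (?CS \<Otimes>\<^sub>M ?RS) (\<lambda>r. (\<lambda>n. C n (fst r), R.coupled_time u (snd r)))" if u: "0 < u" for u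
  proof -
    have "distr M (?CS \<Otimes>\<^sub>M ?RS) (\<lambda>\<omega>. (\<lambda>n. C n \<omega>, S \<omega>)) = distr M ?CS (\<lambda>\<omega> n. C n \<omega>) \<Otimes>\<^sub>M distr M ?RS S"
      using independent_elements_distr_maps[OF P.prob_space_axioms ind at_meas]
      by (simp add: S_def[abs_def] restrict_UNIV)
    also have "\<dots> = distr M ?CS (\<lambda>\<omega> n. C n \<omega>) \<Otimes>\<^sub>M distr (M' \<Otimes>\<^sub>M ?E) ?RS (R.coupled_time u)"
      unfolding S_law[OF u] ..
    also have "\<dots> = distr Q (?CS \<Otimes>\<^sub>M ?RS) (\<lambda>(\<omega>, q). (\<lambda>n. C n \<omega>, R.coupled_time u q))"
      unfolding Q_def
      by (rule pair_measure_distr)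
         (auto intro!: prob_space_imp_sigma_finite ME.prob_space_distr)
    finally show ?thesis by (simp add: case_prod_beta')
  qed
  have same_law: "distr M ?J (X' u) = distr Q ?J (Z u)" if u: "0 < u" for u
  proof -
    note cp = count_path_measurable[OF u, of \<alpha>, where 'k = 'k]
    have "distr M ?J (X' u) = distr (distr M (?CS \<Otimes>\<^sub>M ?RS) (\<lambda>\<omega>. (\<lambda>n. C n \<omega>, S \<omega>))) ?J (\<lambda>(c, s). count_path \<alpha> u c s)"
      by (subst distr_distr[OF cp measurable_Pair[OF C_meas S_meas]]) (simp add: comp_def X'_def[abs_def])
    also have "\<dots> = distr Q ?J (Z u)"
      unfolding joint[OF u] by (subst distr_distr[OF cp CT_meas]) (simp add: comp_def Z_def[abs_def])
    finally show ?thesis .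
  qed
  have Z_lim: "AE r in Q. limitin skorokhod_J1 (\<lambda>u. Z (max 1 u) r) (Y' (fst (snd r))) at_top"
  proof -
    have "AE \<omega> in M. \<forall>i. (\<lambda>n. real (card {k. k < n \<and> C k \<omega> = i}) / real n) \<longlonglongrightarrow> p $ i"
      using class_frequency[OF P.prob_space_axioms assms(7,8)] by (simp add: AE_all_countable)
    then have "AE r in Q. \<forall>i. (\<lambda>n. real (card {k. k < n \<and> C k (fst r) = i}) / real n) \<longlonglongrightarrow> p $ i"
      unfolding Q_def by (rule prob_space_AE_fst[OF ME.prob_space_axioms])
    moreover have "AE r in Q. fst (snd r) \<in> space M' \<and> (\<forall>j. 0 < snd (snd r) j) \<and>
        (\<lambda>n. arrival (snd (snd r)) n / real n) \<longlonglongrightarrow> 1 / l"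
      unfolding Q_def by (rule prob_space_AE_snd[OF P.prob_space_axioms ME.prob_space_axioms R.coupled_AE])
    ultimately show ?thesis
    proof eventually_elim
      case (elim r)
      define c \<omega> e where "c = (\<lambda>n. C n (fst r))" and "\<omega> = fst (snd r)" and "e = snd (snd r)"
      have \<omega>: "\<omega> \<in> space M'" and e: "\<And>j. 0 < e j" and lim: "(\<lambda>n. arrival e n / real n) \<longlonglongrightarrow> 1 / l"
        and label: "\<And>i. (\<lambda>n. real (card {k. k < n \<and> c k = i}) / real n) \<longlonglongrightarrow> p $ i"
        using elim by (auto simp: c_def \<omega>_def e_def)
      have seq: "arrival_sequence (\<lambda>k. L' (arrival e (Suc k) / max 1 u powr \<alpha>) \<omega>)" for u
        by (rule R.coupled_arrival_sequence[OF \<omega> e lim]) simp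
      have Z: "Z (max 1 u) r = jump_path (max 1 u powr (- \<alpha>)) (\<lambda>k. L' (arrival e (Suc k) / max 1 u powr \<alpha>) \<omega>) c" for u
      proof -
        have "arrival_sequence (R.coupled_time (max 1 u) (snd r))"
          using arrival_sequence_scale[of "max 1 u" "R.coupled_time (max 1 u) (snd r)"] seq[of u]
          by (simp add: R.coupled_time_def[abs_def] \<omega>_def e_def)
        then show ?thesis
          by (simp add: Z_def count_path_def regularise_def R.coupled_time_def c_def \<omega>_def e_def)
      qed
      have "limitin skorokhod_J1 (\<lambda>u. Z (max 1 u) r) (\<lambda>t\<in>{0..}. (l * Inf {s. s > 0 \<and> L' s \<omega> > t}) *\<^sub>R p) at_top"
        unfolding Z
        by (rule coupled_path_limit[OF L'(3)[OF \<omega>] e l \<alpha> lim label])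
           (auto intro!: jump_path_in_skorokhod_space arrival_sequence_finite seq)
      then show ?case by (simp add: Y'_def inverse_process_def \<omega>_def)
    qed
  qed
  have "converges_weakly skorokhod_J1 (\<lambda>u. distr M ?J (X' u)) (distr M' ?J Y') at_top"
    unfolding converges_weakly_def
  proof (intro allI impI, elim conjE)
    fix f :: "(real \<Rightarrow> real ^ 'k) \<Rightarrow> real"
    assume f: "continuous_map skorokhod_J1 euclideanreal f" and bdd: "bounded (f ` topspace skorokhod_J1)"
    have f_meas: "f \<in> borel_measurable ?J" by (rule continuous_map_measurable_borel_of[OF f])
    obtain B where B: "\<And>x. x \<in> skorokhod_space \<Longrightarrow> \<bar>f x\<bar> \<le> B"
      using bdd by (auto simp: bounded_iff)
    have pos: "0 < max 1 u" for u :: real by simp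
    \<comment> \<open>Dominated convergence along \<open>at_top\<close> demands measurability at
      every real index, which \<open>max 1 u\<close> secures; for \<open>u \<ge> 1\<close> it is
      \<open>u\<close> itself.\<close>
    have "((\<lambda>u. \<integral>r. f (Z (max 1 u) r) \<partial>Q) \<longlongrightarrow> (\<integral>r. f (Y' (fst (snd r))) \<partial>Q)) at_top"
    proof (rule integral_dominated_convergence_at_top[where w = "\<lambda>_. B"])
      show "(\<lambda>r. f (Y' (fst (snd r)))) \<in> borel_measurable Q"
        unfolding Q_def by (intro measurable_compose[OF _ f_meas] measurable_compose[OF _ Y'_meas]) measurable
      show "(\<lambda>r. f (Z (max 1 u) r)) \<in> borel_measurable Q" for u
        by (rule measurable_compose[OF Z_meas[OF pos] f_meas])
      show "AE r in Q. ((\<lambda>u. f (Z (max 1 u) r)) \<longlongrightarrow> f (Y' (fst (snd r)))) at_top"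
        using Z_lim
      proof eventually_elim
        case (elim r)
        from continuous_map_limit[OF f elim] show ?case by (simp add: comp_def)
      qed
      show "\<forall>\<^sub>F u in at_top. AE r in Q. norm (f (Z (max 1 u) r)) \<le> B"
        using measurable_space[OF Z_meas[OF pos]] by (intro always_eventually allI AE_I2) (simp add: B)
    qed simp
    moreover have "(\<integral>r. f (Y' (fst (snd r))) \<partial>Q) = (\<integral>x. f x \<partial>distr M' ?J Y')"
    proof -
      interpret E: prob_space ?E by (rule prob_space_exponential_sequence[OF l])
      have sndr: "distr Q (M' \<Otimes>\<^sub>M ?E) snd = M' \<Otimes>\<^sub>M ?E"
        unfolding Q_def by (rule prob_space_distr_snd[OF P.prob_space_axioms ME.prob_space_axioms])
      have fm: "(\<lambda>q. f (Y' (fst q))) \<in> borel_measurable (M' \<Otimes>\<^sub>M ?E)"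
        by (intro measurable_compose[OF _ f_meas] measurable_compose[OF _ Y'_meas]) measurable
      have "(\<integral>r. f (Y' (fst (snd r))) \<partial>Q) = (\<integral>q. f (Y' (fst q)) \<partial>distr Q (M' \<Otimes>\<^sub>M ?E) snd)"
        by (subst integral_distr[OF _ fm]) (auto simp: Q_def)
      also have "\<dots> = (\<integral>\<omega>. f (Y' \<omega>) \<partial>distr (M' \<Otimes>\<^sub>M ?E) M' fst)"
        unfolding sndr by (rule integral_distr[symmetric]) (auto intro: measurable_compose[OF Y'_meas f_meas])
      also have "\<dots> = (\<integral>x. f x \<partial>distr M' ?J Y')"
        unfolding E.distr_pair_fst by (rule integral_distr[symmetric, OF Y'_meas f_meas])
      finally show ?thesis .
    qed
    moreover have "\<forall>\<^sub>F u in at_top. (\<integral>r. f (Z (max 1 u) r) \<partial>Q) = (\<integral>x. f x \<partial>distr M ?J (X' u))"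
      using eventually_ge_at_top[of 1]
    proof eventually_elim
      case (elim u)
      then have u: "0 < u" "max 1 u = u" by auto
      show ?case unfolding u(2) same_law[OF u(1)] by (rule integral_distr[symmetric, OF Z_meas[OF u(1)] f_meas])
    qed
    ultimately show "((\<lambda>u. \<integral>x. f x \<partial>distr M ?J (X' u)) \<longlongrightarrow> (\<integral>x. f x \<partial>distr M' ?J Y')) at_top"
      by (simp add: tendsto_cong)
  qed
  then show ?thesis
    unfolding converges_in_distribution_def
    by (intro exI[of _ "\<lambda>u. distr M ?J (X' u)"] exI[of _ "distr M' ?J Y'"] conjI
        eventually_mono[OF eventually_gt_at_top[of 0]] X'_law Y'_law)
qed

end
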